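(* If $X$ is a metrizable space, then the following statements are equivalent: (1) $A_3(X)$ is a $k$-space; (2) $A_3(X)$ is a $k_R$-space; (3) either $X$ is locally compact or $\mathrm{NI}(X)$ is compact.
   Context: $\mathrm{NI}(X)$ denotes the set of all non-isolated points of $X$. For a non-empty Tychonoff space $X$, $A(X)$ is the free Abelian topological group over $X$: an Abelian topological group with a continuous map $i:X\to A(X)$ such that $i(X)$ algebraically generates $A(X)$ and every continuous map $f:X\to G$ to an Abelian topological group $G$ has the form $f=\overline{f}\circ i$ for some continuous homomorphism $\overline{f}:A(X)\to G$; $X$ is identified with $i(X)$, and is a free algebraic basis of $A(X)$. Each non-zero $g\in A(X)$ is uniquely $r_1x_1+\cdots+r_kx_k$ with $x_i\in X$ distinct and $r_i\in\mathbb{Z}\setminus\{0\}$; its reduced length is $\sum|r_i|$, and $0$ has reduced length $0$. $A_n(X)$ is the subspace of $A(X)$ of all elements of reduced length at most $n$. A space $Y$ is a $k$-space if a subset $C\subseteq Y$ is closed whenever $C\cap K$ is closed in $K$ for every compact $K\subseteq Y$. $Y$ is a $k_R$-space if $Y$ is Tychonoff and every $f:Y\to\mathbb{R}$ whose restriction to each compact subset is continuous is continuous. A space is locally compact if every point has a compact neighbourhood. *)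

theory Defs
  imports "HOL-Analysis.Analysis" "HOL-Algebra.Free_Abelian_Groups"
begin

definition non_isolated_points :: "'a topology \<Rightarrow> 'a set" where
  "non_isolated_points X = {x \<in> topspace X. \<not> openin X {x}}"

definition tychonoff_space :: "'a topology \<Rightarrow> bool" where
  "tychonoff_space X \<longleftrightarrow> completely_regular_space X \<and> Hausdorff_space X"

definition k_R_space :: "'a topology \<Rightarrow> bool" where
  "k_R_space Y \<longleftrightarrow> tychonoff_space Y \<and>
     (\<forall>f. (\<forall>K. compactin Y K \<longrightarrow> continuous_map (subtopology Y K) euclideanreal f)
        \<longrightarrow> continuous_map Y euclideanreal f)"

definition abelian_topological_group :: "('g, 'm) monoid_scheme \<Rightarrow> 'g topology \<Rightarrow> bool" where
  "abelian_topological_group G T \<longleftrightarrow>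
     comm_group G \<and> topspace T = carrier G \<and>
     continuous_map (prod_topology T T) T (\<lambda>(x, y). x \<otimes>\<^bsub>G\<^esub> y) \<and>
     continuous_map T T (\<lambda>x. inv\<^bsub>G\<^esub> x)"

text \<open>The universal property has to range over test groups of one fixed type.  The type
  \<open>'a \<Rightarrow>\<^sub>0 int\<close> of formal integer combinations of points of the space is large enough:
  by \<open>free_universal\<close> below, the factorization then holds for Abelian topological groups
  of every type.  Test groups are not required to be Hausdorff; for Tychonoff \<open>X\<close> the
  group obtained is Hausdorff anyway, so both conventions yield the same object.\<close>

definition free_abelian_topological_group ::
    "'a topology \<Rightarrow> ('g, 'm) monoid_scheme \<Rightarrow> 'g topology \<Rightarrow> ('a \<Rightarrow> 'g) \<Rightarrow> bool" where
  "free_abelian_topological_group X G T i \<longleftrightarrow>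
     abelian_topological_group G T \<and> continuous_map X T i \<and>
     generate G (i ` topspace X) = carrier G \<and>
     (\<forall>(H :: ('a \<Rightarrow>\<^sub>0 int) monoid) U f.
        abelian_topological_group H U \<and> continuous_map X U f \<longrightarrow>
        (\<exists>h \<in> hom G H. continuous_map T U h \<and> (\<forall>x \<in> topspace X. f x = h (i x))))"

text \<open>\<open>reduced_form X G i S r g\<close>: in additive notation, \<open>g\<close> is the sum of the
  \<open>r x \<cdot> i x\<close> over the finite set \<open>S\<close> of points, with non-zero coefficients; the zero
  element is given by \<open>S = {}\<close>.\<close>

definition reduced_form ::
    "'a topology \<Rightarrow> ('g, 'm) monoid_scheme \<Rightarrow> ('a \<Rightarrow> 'g) \<Rightarrow> 'a set \<Rightarrow> ('a \<Rightarrow> int) \<Rightarrow> 'g \<Rightarrow> bool" where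
  "reduced_form X G i S r g \<longleftrightarrow>
     finite S \<and> S \<subseteq> topspace X \<and> (\<forall>x\<in>S. r x \<noteq> 0) \<and>
     g = finprod G (\<lambda>x. i x [^]\<^bsub>G\<^esub> r x) S"

text \<open>Existence and uniqueness of the reduced form, which make the description below
  meaningful, are \<open>reduced_form_exists\<close> and \<open>reduced_form_unique\<close>.\<close>

definition reduced_length ::
    "'a topology \<Rightarrow> ('g, 'm) monoid_scheme \<Rightarrow> ('a \<Rightarrow> 'g) \<Rightarrow> 'g \<Rightarrow> nat" where
  "reduced_length X G i g =
     (THE n. \<exists>S r. reduced_form X G i S r g \<and> n = (\<Sum>x\<in>S. nat \<bar>r x\<bar>))"

definition bounded_length_subspace ::
    "nat \<Rightarrow> 'a topology \<Rightarrow> ('g, 'm) monoid_scheme \<Rightarrow> 'g topology \<Rightarrow> ('a \<Rightarrow> 'g) \<Rightarrow> 'g topology" where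
  "bounded_length_subspace n X G T i =
     subtopology T {g \<in> carrier G. reduced_length X G i g \<le> n}"


lemma abelian_topological_group_pullback:
  assumes G: "comm_group G" and H: "abelian_topological_group H U" and h: "h \<in> hom G H"
  shows "abelian_topological_group G (pullback_topology (carrier G) h U)"
proof -
  let ?V = "pullback_topology (carrier G) h U"
  interpret G: comm_group G by fact
  interpret H: comm_group H using H by (simp add: abelian_topological_group_def)
  interpret group_hom G H h using h by unfold_locales
  have U: "topspace U = carrier H"
    and mU: "continuous_map (prod_topology U U) U (\<lambda>(x, y). x \<otimes>\<^bsub>H\<^esub> y)"
    and iU: "continuous_map U U (\<lambda>x. inv\<^bsub>H\<^esub> x)"
    using H by (auto simp: abelian_topological_group_def)
  have V: "topspace ?V = carrier G"
    using U by (auto simp: topspace_pullback_topology)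
  have hV: "continuous_map ?V U h"
    using continuous_map_pullback[OF continuous_map_id, of "carrier G" h U] by (simp add: o_def)
  have m: "continuous_map (prod_topology ?V ?V) U (\<lambda>p. h (fst p) \<otimes>\<^bsub>H\<^esub> h (snd p))"
  proof -
    have "continuous_map (prod_topology ?V ?V) (prod_topology U U) (\<lambda>p. (h (fst p), h (snd p)))"
      using continuous_map_compose[OF continuous_map_fst hV]
            continuous_map_compose[OF continuous_map_snd hV]
      by (auto simp: continuous_map_paired o_def)
    from continuous_map_compose[OF this mU] show ?thesis by (simp add: o_def)
  qed
  have "continuous_map (prod_topology ?V ?V) ?V (\<lambda>(x, y). x \<otimes>\<^bsub>G\<^esub> y)"
  proof (rule continuous_map_pullback')
    show "continuous_map (prod_topology ?V ?V) U (h \<circ> (\<lambda>(x, y). x \<otimes>\<^bsub>G\<^esub> y))"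
      by (rule continuous_map_eq[OF m]) (auto simp: V)
  qed (auto simp: V)
  moreover have "continuous_map ?V ?V (\<lambda>x. inv\<^bsub>G\<^esub> x)"
  proof (rule continuous_map_pullback')
    show "continuous_map ?V U (h \<circ> (\<lambda>x. inv\<^bsub>G\<^esub> x))"
      by (rule continuous_map_eq[OF continuous_map_compose[OF hV iU]]) (auto simp: V)
  qed (auto simp: V)
  ultimately show ?thesis
    using V G by (simp add: abelian_topological_group_def)
qed

lemma free_group_trivial_topology:
  "\<exists>T. abelian_topological_group (free_Abelian_group (topspace X)) T \<and> continuous_map X T frag_of"
proof -
  let ?F = "free_Abelian_group (topspace X)"
  let ?U = "discrete_topology (UNIV :: unit set)"
  let ?H = "\<lparr>carrier = UNIV, monoid.mult = (\<lambda>_ _. ()), one = ()\<rparr>"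
  have cg: "comm_group ?H"
    by (rule comm_groupI) auto
  have cu: "continuous_map Y ?U f" for Y :: "'z topology" and f
  proof -
    have "f = (\<lambda>_. ())" by auto
    then show ?thesis by simp
  qed
  have H: "abelian_topological_group ?H ?U"
    using cg cu by (simp add: abelian_topological_group_def)
  have p: "(\<lambda>_. ()) \<in> hom ?F ?H" by (simp add: hom_def)
  have "continuous_map X (pullback_topology (carrier ?F) (\<lambda>_. ()) ?U) frag_of"
    by (rule continuous_map_pullback') (auto simp: cu)
  then show ?thesis
    using abelian_topological_group_pullback[OF abelian_free_Abelian_group H p] by blast
qed

lemma free_universal:
  fixes H :: "('h, 'k) monoid_scheme"
  assumes free: "free_abelian_topological_group X G T i"
    and H: "abelian_topological_group H U" and f: "continuous_map X U f"
  shows "\<exists>h \<in> hom G H. continuous_map T U h \<and> (\<forall>x \<in> topspace X. f x = h (i x))"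
proof -
  let ?F = "free_Abelian_group (topspace X)"
  interpret H: comm_group H using H by (simp add: abelian_topological_group_def)
  have U: "topspace U = carrier H" using H by (simp add: abelian_topological_group_def)
  have "f ` topspace X \<subseteq> carrier H"
    using f U by (auto simp: continuous_map_def)
  then obtain p where p: "p \<in> hom ?F H" and pf: "\<And>x. x \<in> topspace X \<Longrightarrow> p (frag_of x) = f x"
    using H.free_Abelian_group_universal by metis
  let ?V = "pullback_topology (carrier ?F) p U"
  have V: "abelian_topological_group ?F ?V"
    by (rule abelian_topological_group_pullback[OF abelian_free_Abelian_group H p])
  have c: "continuous_map X ?V frag_of"
  proof (rule continuous_map_pullback')
    show "continuous_map X U (p \<circ> frag_of)"
      by (rule continuous_map_eq[OF f]) (simp add: pf)
  qed auto
  obtain h where h: "h \<in> hom G ?F" "continuous_map T ?V h"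
      "\<forall>x\<in>topspace X. frag_of x = h (i x)"
    using free V c unfolding free_abelian_topological_group_def by blast
  have "continuous_map ?V U p"
    using continuous_map_pullback[OF continuous_map_id, of "carrier ?F" p U] by (simp add: o_def)
  then have "continuous_map T U (p \<circ> h)"
    using h(2) continuous_map_compose by blast
  moreover have "p \<circ> h \<in> hom G H"
    using h(1) p by (rule hom_compose)
  ultimately show ?thesis
    using h(3) pf by (intro bexI[of _ "p \<circ> h"]) auto
qed

lemma generate_hom_eq:
  assumes "group G" "group H" "h \<in> hom G H" "k \<in> hom G H" "S \<subseteq> carrier G"
    and eq: "\<And>x. x \<in> S \<Longrightarrow> h x = k x" and g: "g \<in> generate G S"
  shows "h g = k g"
proof -
  interpret G: group G by fact
  interpret h: group_hom G H h using assms by (simp add: group_hom_def group_hom_axioms_def)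
  interpret k: group_hom G H k using assms by (simp add: group_hom_def group_hom_axioms_def)
  from g show ?thesis
  proof induction
    case (eng a b)
    then show ?case using G.generate_in_carrier[OF assms(5)] by simp
  qed (use assms(5) eq in \<open>auto simp: subset_iff\<close>)
qed

lemma hom_finprod_frag:
  assumes "comm_group G" and h: "h \<in> hom G (free_Abelian_group Z)" and "finite S"
    and "\<And>x. x \<in> S \<Longrightarrow> i x \<in> carrier G" "\<And>x. x \<in> S \<Longrightarrow> h (i x) = frag_of x" "S \<subseteq> Z"
  shows "h (finprod G (\<lambda>x. i x [^]\<^bsub>G\<^esub> (r x :: int)) S) = (\<Sum>x\<in>S. frag_cmul (r x) (frag_of x))"
proof -
  interpret G: comm_group G by fact
  interpret group_hom G "free_Abelian_group Z" h
    using h by (simp add: group_hom_def group_hom_axioms_def)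
  show ?thesis
    using assms(3-6)
  proof (induction S)
    case (insert x S)
    have "finprod G (\<lambda>x. i x [^]\<^bsub>G\<^esub> r x) S \<in> carrier G"
      using insert.prems by (intro G.finprod_closed) auto
    moreover have "h (i x [^]\<^bsub>G\<^esub> r x) = frag_cmul (r x) (frag_of x)"
      using insert.prems by (simp add: hom_int_pow)
    ultimately show ?case
      using insert by (subst G.finprod_insert) auto
  qed (use hom_one in simp)
qed

lemma free_hom_frag:
  assumes free: "free_abelian_topological_group X G T i"
  obtains h where "h \<in> hom G (free_Abelian_group (topspace X))"
    "\<And>x. x \<in> topspace X \<Longrightarrow> h (i x) = frag_of x" "inj_on h (carrier G)"
proof -
  let ?F = "free_Abelian_group (topspace X)"
  obtain I where "abelian_topological_group ?F I" "continuous_map X I frag_of"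
    using free_group_trivial_topology by blast
  then obtain h where h: "h \<in> hom G ?F" "\<forall>x\<in>topspace X. frag_of x = h (i x)"
    using free unfolding free_abelian_topological_group_def by blast
  have G: "comm_group G" and T: "topspace T = carrier G"
    and gen: "generate G (i ` topspace X) = carrier G" and ci: "continuous_map X T i"
    using free by (auto simp: free_abelian_topological_group_def abelian_topological_group_def)
  interpret G: comm_group G by (rule G)
  have iG: "i ` topspace X \<subseteq> carrier G"
    using ci T by (auto simp: continuous_map_def)
  then obtain p where p: "p \<in> hom ?F G" "\<And>x. x \<in> topspace X \<Longrightarrow> p (frag_of x) = i x"
    using G.free_Abelian_group_universal by metis
  have "(p \<circ> h) g = id g" if "g \<in> carrier G" for g
  proof (rule generate_hom_eq[of G G "p \<circ> h" id "i ` topspace X"])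
    show "p \<circ> h \<in> hom G G" using h(1) p(1) by (rule hom_compose)
    show "g \<in> generate G (i ` topspace X)" using that gen by simp
    show "(p \<circ> h) x = id x" if "x \<in> i ` topspace X" for x
      using that h(2) p(2) by force
  qed (use iG in \<open>auto simp: hom_def\<close>)
  then have "inj_on h (carrier G)"
    by (intro inj_on_inverseI[of _ p]) simp
  with h show thesis by (intro that) auto
qed

lemma reduced_form_unique:
  assumes free: "free_abelian_topological_group X G T i"
    and "reduced_form X G i S r g" "reduced_form X G i S' r' g"
  shows "S = S'" and "\<forall>x\<in>S. r x = r' x"
proof -
  obtain h where h: "h \<in> hom G (free_Abelian_group (topspace X))"
    "\<And>x. x \<in> topspace X \<Longrightarrow> h (i x) = frag_of x"
    using free_hom_frag[OF free] by metis
  have G: "comm_group G" and iG: "\<And>x. x \<in> topspace X \<Longrightarrow> i x \<in> carrier G"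
    using free by (auto simp: free_abelian_topological_group_def abelian_topological_group_def continuous_map_def)
  have *: "Poly_Mapping.lookup (h g) x = (if x \<in> A then s x else 0)"
    if "reduced_form X G i A s g" for A s x
  proof -
    have A: "finite A" "A \<subseteq> topspace X" "g = finprod G (\<lambda>x. i x [^]\<^bsub>G\<^esub> s x) A"
      using that by (auto simp: reduced_form_def)
    have "h g = (\<Sum>x\<in>A. frag_cmul (s x) (frag_of x))"
      unfolding A(3) by (rule hom_finprod_frag[OF G h(1) A(1) _ _ A(2)]) (use A(2) iG h(2) in auto)
    then have "Poly_Mapping.lookup (h g) x = (\<Sum>y\<in>A. s y * (if x = y then 1 else 0))"
      by (simp add: lookup_sum)
    then show ?thesis
      using A(1) by (simp add: if_distrib[of "\<lambda>z. _ * z"] cong: if_cong)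
  qed
  have nz: "\<forall>x\<in>S. r x \<noteq> 0" "\<forall>x\<in>S'. r' x \<noteq> 0"
    using assms(2,3) by (auto simp: reduced_form_def)
  have eq: "(if x \<in> S then r x else 0) = (if x \<in> S' then r' x else 0)" for x
    using *[OF assms(2), of x] *[OF assms(3), of x] by simp
  show "S = S'"
    using eq nz by (metis subsetI subset_antisym)
  with eq show "\<forall>x\<in>S. r x = r' x" by metis
qed

lemma reduced_form_exists:
  assumes free: "free_abelian_topological_group X G T i" and g: "g \<in> carrier G"
  shows "\<exists>S r. reduced_form X G i S r g"
proof -
  obtain h where h: "h \<in> hom G (free_Abelian_group (topspace X))"
    "\<And>x. x \<in> topspace X \<Longrightarrow> h (i x) = frag_of x" "inj_on h (carrier G)"
    using free_hom_frag[OF free] by metis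
  have G: "comm_group G" and iG: "\<And>x. x \<in> topspace X \<Longrightarrow> i x \<in> carrier G"
    using free by (auto simp: free_abelian_topological_group_def abelian_topological_group_def continuous_map_def)
  interpret G: comm_group G by (rule G)
  let ?S = "Poly_Mapping.keys (h g)" and ?r = "Poly_Mapping.lookup (h g)"
  let ?g = "finprod G (\<lambda>x. i x [^]\<^bsub>G\<^esub> ?r x) ?S"
  have S: "?S \<subseteq> topspace X"
    using hom_in_carrier[OF h(1) g] by simp
  have "h ?g = (\<Sum>x\<in>?S. frag_cmul (?r x) (frag_of x))"
    by (rule hom_finprod_frag[OF G h(1) finite_keys _ _ S]) (use S iG h(2) in auto)
  also have "\<dots> = h g"
    using frag_expansion[of "h g"] by (simp add: frag_extend_def o_def)
  finally have "h g = h ?g" by simp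
  moreover have "?g \<in> carrier G"
    using S iG by (intro G.finprod_closed) auto
  ultimately have "g = ?g"
    using h(3) g by (auto dest: inj_onD)
  with S show ?thesis
    by (intro exI[of _ ?S] exI[of _ ?r]) (auto simp: reduced_form_def in_keys_iff)
qed

lemma reduced_length_eq:
  assumes "free_abelian_topological_group X G T i" "reduced_form X G i S r g"
  shows "reduced_length X G i g = (\<Sum>x\<in>S. nat \<bar>r x\<bar>)"
  unfolding reduced_length_def
proof (rule the_equality)
  fix n assume "\<exists>S r. reduced_form X G i S r g \<and> n = (\<Sum>x\<in>S. nat \<bar>r x\<bar>)"
  then obtain S' r' where "reduced_form X G i S' r' g" "n = (\<Sum>x\<in>S'. nat \<bar>r' x\<bar>)"
    by blast
  then show "n = (\<Sum>x\<in>S. nat \<bar>r x\<bar>)"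
    using reduced_form_unique[OF assms(1,2)] by (auto intro!: sum.cong)
qed (use assms in auto)

text \<open>Existence of \<open>A(X)\<close>: the free Abelian group on \<open>X\<close> with the supremum of all group
  topologies making the inclusion of \<open>X\<close> continuous.\<close>

lemma free_abelian_topological_group_exists:
  fixes X :: "'a topology"
  shows "\<exists>T. free_abelian_topological_group X (free_Abelian_group (topspace X)) T frag_of"
proof -
  let ?F = "free_Abelian_group (topspace X)"
  define \<T> where "\<T> = {T. abelian_topological_group ?F T \<and> continuous_map X T frag_of}"
  define J where "J = topology_generated_by (\<Union>T\<in>\<T>. {U. openin T U})"
  interpret F: comm_group ?F by (rule abelian_free_Abelian_group)
  have top: "topspace T = carrier ?F" if "T \<in> \<T>" for T
    using that by (simp add: \<T>_def abelian_topological_group_def)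
  have triv: "\<exists>T. T \<in> \<T>"
    using free_group_trivial_topology[of X] by (auto simp: \<T>_def)
  have "\<Union> {U. openin T U} = carrier ?F" if "T \<in> \<T>" for T
    using top[OF that] by (simp add: topspace_def)
  then have "(\<Union>T\<in>\<T>. \<Union> {U. openin T U}) = carrier ?F"
    using triv by auto
  moreover have "\<Union> (\<Union>T\<in>\<T>. {U. openin T U}) = (\<Union>T\<in>\<T>. \<Union> {U. openin T U})"
    by blast
  ultimately have SJ: "\<Union> (\<Union>T\<in>\<T>. {U. openin T U}) = carrier ?F"
    by simp
  then have tJ: "topspace J = carrier ?F"
    unfolding J_def topology_generated_by_topspace .
  have JT: "continuous_map J T id" if "T \<in> \<T>" for T
  proof -
    have "openin J U" if "openin T U" for U
      unfolding J_def by (rule topology_generated_by_Basis) (use that \<open>T \<in> \<T>\<close> in auto)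
    moreover have "{x \<in> topspace J. id x \<in> U} = U" if "openin T U" for U
      using openin_subset[OF that] unfolding tJ top[OF \<open>T \<in> \<T>\<close>] id_apply by blast
    ultimately show ?thesis
      using tJ top[OF that] by (simp add: continuous_map_def)
  qed
  have intoJ: "continuous_map Y J f"
    if "\<And>T. T \<in> \<T> \<Longrightarrow> continuous_map Y T f" for Y :: "'z topology" and f
    unfolding J_def
  proof (rule continuous_on_generated_topo)
    fix U assume "U \<in> (\<Union>T\<in>\<T>. {U. openin T U})"
    then show "openin Y (f -` U \<inter> topspace Y)"
      using that by (auto simp: continuous_map_alt)
  next
    obtain T where "T \<in> \<T>" using triv by blast
    then show "f ` topspace Y \<subseteq> \<Union> (\<Union>T\<in>\<T>. {U. openin T U})"
      unfolding SJ using that[of T] top[of T] by (auto simp: continuous_map_def)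
  qed
  have "continuous_map (prod_topology J J) J (\<lambda>(x, y). x \<otimes>\<^bsub>?F\<^esub> y)"
  proof (rule intoJ)
    fix T assume T: "T \<in> \<T>"
    have "continuous_map (prod_topology J J) (prod_topology T T) (\<lambda>p. (fst p, snd p))"
      using continuous_map_compose[OF continuous_map_fst JT[OF T]]
            continuous_map_compose[OF continuous_map_snd JT[OF T]]
      by (intro continuous_map_pairedI) (auto simp only: o_def id_apply)
    then have "continuous_map (prod_topology J J) T ((\<lambda>(x, y). x \<otimes>\<^bsub>?F\<^esub> y) \<circ> (\<lambda>p. (fst p, snd p)))"
      using T by (intro continuous_map_compose) (auto simp: \<T>_def abelian_topological_group_def)
    then show "continuous_map (prod_topology J J) T (\<lambda>(x, y). x \<otimes>\<^bsub>?F\<^esub> y)"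
      by (simp add: o_def)
  qed
  moreover have "continuous_map J J (\<lambda>x. inv\<^bsub>?F\<^esub> x)"
  proof (rule intoJ)
    fix T assume T: "T \<in> \<T>"
    then have "continuous_map J T ((\<lambda>x. inv\<^bsub>?F\<^esub> x) \<circ> id)"
      by (intro continuous_map_compose[OF JT[OF T]]) (auto simp: \<T>_def abelian_topological_group_def)
    then show "continuous_map J T (\<lambda>x. inv\<^bsub>?F\<^esub> x)" by simp
  qed
  ultimately have J: "abelian_topological_group ?F J"
    using tJ by (simp add: abelian_topological_group_def abelian_free_Abelian_group)
  have cX: "continuous_map X J frag_of"
    by (rule intoJ) (simp add: \<T>_def)
  have gen: "generate ?F (frag_of ` topspace X) = carrier ?F"
  proof
    show "generate ?F (frag_of ` topspace X) \<subseteq> carrier ?F"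
      by (rule F.generate_incl) auto
    have "c \<in> generate ?F (frag_of ` topspace X)" if "Poly_Mapping.keys c \<subseteq> topspace X" for c
      using that
    proof (rule free_Abelian_group_induct)
      show "0 \<in> generate ?F (frag_of ` topspace X)"
        using generate.one[of ?F] by simp
    next
      fix x y
      assume xy: "Poly_Mapping.keys x \<subseteq> topspace X" "Poly_Mapping.keys y \<subseteq> topspace X"
        "x \<in> generate ?F (frag_of ` topspace X)" "y \<in> generate ?F (frag_of ` topspace X)"
      then have "x \<otimes>\<^bsub>?F\<^esub> inv\<^bsub>?F\<^esub> y \<in> generate ?F (frag_of ` topspace X)"
        by (intro generate.eng F.generate_m_inv_closed) auto
      then show "x - y \<in> generate ?F (frag_of ` topspace X)"
        using xy by simp
    qed (auto intro: generate.incl)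
    then show "carrier ?F \<subseteq> generate ?F (frag_of ` topspace X)"
      by auto
  qed
  have univ: "\<exists>h \<in> hom ?F H. continuous_map J U h \<and> (\<forall>x \<in> topspace X. f x = h (frag_of x))"
    if H: "abelian_topological_group H U" and f: "continuous_map X U f"
    for H :: "('a \<Rightarrow>\<^sub>0 int) monoid" and U f
  proof -
    interpret H: comm_group H using H by (simp add: abelian_topological_group_def)
    have "f ` topspace X \<subseteq> carrier H"
      using f H by (auto simp: continuous_map_def abelian_topological_group_def)
    then obtain p where p: "p \<in> hom ?F H" and pf: "\<And>x. x \<in> topspace X \<Longrightarrow> p (frag_of x) = f x"
      using H.free_Abelian_group_universal by metis
    let ?V = "pullback_topology (carrier ?F) p U"
    have "continuous_map X ?V frag_of"
    proof (rule continuous_map_pullback')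
      show "continuous_map X U (p \<circ> frag_of)"
        by (rule continuous_map_eq[OF f]) (simp add: pf)
    qed auto
    then have "?V \<in> \<T>"
      using abelian_topological_group_pullback[OF abelian_free_Abelian_group H p] by (simp add: \<T>_def)
    from continuous_map_compose[OF JT[OF this]] have "continuous_map J U p"
      using continuous_map_pullback[OF continuous_map_id, of "carrier ?F" p U] by fastforce
    then show ?thesis using p pf by auto
  qed
  show ?thesis
    unfolding free_abelian_topological_group_def using J cX gen univ by blast
qed

end

(* On the group of integer combinations of points of X, the topology of A(X) is the finest group
   topology making X -> A(X) continuous; so every pseudonorm whose restriction to X is continuous
   has open balls in A(X), and the only pseudonorms needed are suprema of the extensions of
   equicontinuous families of bump functions.

   Under (3), every sequentially open W in A_3(X) is open: each g in W has a pseudonorm ball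
   inside W.  If g has length 2 or 3, bumps around the points of g force every nearby element
   of length at most that of g to be a perturbation of g point by point.  The remaining points
   are 0, where the nearby elements are y - z and W gives a neighbourhood of the diagonal, and
   x0 (or -x0), where the nearby elements are x + y - z.  At x0 one needs a radius around x0 that
   serves for all w = lim y = lim z simultaneously; it exists by compactness of a neighbourhood
   of x0 or of NI(X).  The same balls show that A_3(X) is completely regular.

   If (3) fails, choose x0 without compact neighbourhoods, a discrete sequence y_n of non-isolated
   points, for each n a closed discrete sequence x_{n,k} within t/(2n+2) of x0, and u_{n,k} -> y_n.
   The points x_{n,k} + u_{n,k} - y_n accumulate at x0, but they have neighbourhoods of which
   every compact set meets only finitely many; the sum of the corresponding bumps is continuous on
   compact sets and discontinuous at x0. *)

theory Submission
  imports Defs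
begin

section \<open>Formal integer combinations\<close>

text \<open>If \<open>F\<close> is nonnegative and its extension to the group is positive (negative)
  on an element, then some point in the support of \<open>F\<close> has a positive (negative)
  coefficient. Splitting off that point lowers the length by one, so an element of length at most 3
  is known completely after at most three such steps. The extension of the constant 1 is the sum of
  the coefficients; closeness in it fixes this integer and thereby the parity of the length, so an
  element of length 2 is not approached by elements of length 3. What remains difficult is
  cancellation: an element of length 0 or 1 is approached by longer ones containing a pair y - z
  that nearly cancels, anywhere in X. Finitely many bumps cannot see such a pair, hence the families
  indexed by all points of X. Around 0 the pair comes alone and only its own position matters.
  Around x0 a third point x comes with it, and the admissible distance of x from x0 could shrink
  with the position of the pair. The counterexample uses exactly this freedom: the index n ties the
  distance of x from x0 to the place of the pair.\<close>

definition frag_eval :: "('a \<Rightarrow> real) \<Rightarrow> ('a \<Rightarrow>\<^sub>0 int) \<Rightarrow> real" where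
  "frag_eval F c = (\<Sum>x\<in>Poly_Mapping.keys c. of_int (Poly_Mapping.lookup c x) * F x)"

definition frag_length :: "('a \<Rightarrow>\<^sub>0 int) \<Rightarrow> nat" where
  "frag_length c = (\<Sum>x\<in>Poly_Mapping.keys c. nat \<bar>Poly_Mapping.lookup c x\<bar>)"

lemma frag_eval_superset:
  assumes "finite S" "Poly_Mapping.keys c \<subseteq> S"
  shows "frag_eval F c = (\<Sum>x\<in>S. of_int (Poly_Mapping.lookup c x) * F x)"
  unfolding frag_eval_def using assms
  by (intro sum.mono_neutral_left) (auto simp: not_in_keys_iff_lookup_eq_zero)

lemma frag_length_superset:
  assumes "finite S" "Poly_Mapping.keys c \<subseteq> S"
  shows "frag_length c = (\<Sum>x\<in>S. nat \<bar>Poly_Mapping.lookup c x\<bar>)"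
  unfolding frag_length_def using assms
  by (intro sum.mono_neutral_left) (auto simp: not_in_keys_iff_lookup_eq_zero)

lemma frag_eval_0 [simp]: "frag_eval F 0 = 0"
  by (simp add: frag_eval_def)

lemma frag_eval_of [simp]: "frag_eval F (frag_of x) = F x"
  by (simp add: frag_eval_def)

lemma frag_eval_minus [simp]: "frag_eval F (- c) = - frag_eval F c"
  by (simp add: frag_eval_def sum_negf)

lemma frag_eval_add [simp]: "frag_eval F (b + c) = frag_eval F b + frag_eval F c"
proof -
  let ?S = "Poly_Mapping.keys b \<union> Poly_Mapping.keys c"
  have "Poly_Mapping.keys (b + c) \<subseteq> ?S" by (rule keys_add)
  then show ?thesis
    by (simp add: frag_eval_superset[of ?S] lookup_add sum.distrib distrib_right)
qed

lemma frag_eval_diff [simp]: "frag_eval F (b - c) = frag_eval F b - frag_eval F c"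
  using frag_eval_add[of F b "- c"] by simp

lemma frag_eval_cmul [simp]: "frag_eval F (frag_cmul k c) = of_int k * frag_eval F c"
  by (cases "k = 0")
     (auto simp: frag_eval_superset[of "Poly_Mapping.keys c"] keys_cmul sum_distrib_left mult_ac)

lemma frag_length_0 [simp]: "frag_length 0 = 0"
  by (simp add: frag_length_def)

lemma frag_length_of [simp]: "frag_length (frag_of x) = 1"
  by (simp add: frag_length_def)

lemma frag_length_minus [simp]: "frag_length (- c) = frag_length c"
  by (simp add: frag_length_def)

lemma frag_length_eq_0 [simp]: "frag_length c = 0 \<longleftrightarrow> c = 0"
proof
  assume "frag_length c = 0"
  then have "\<forall>x\<in>Poly_Mapping.keys c. nat \<bar>Poly_Mapping.lookup c x\<bar> = 0"
    by (simp add: frag_length_def)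
  then have "Poly_Mapping.lookup c x = 0" for x
    by (cases "x \<in> Poly_Mapping.keys c") (auto simp: not_in_keys_iff_lookup_eq_zero)
  then show "c = 0" by (simp add: poly_mapping_eqI)
qed simp

lemma frag_length_add: "frag_length (b + c) \<le> frag_length b + frag_length c"
proof -
  let ?S = "Poly_Mapping.keys b \<union> Poly_Mapping.keys c"
  have "Poly_Mapping.keys (b + c) \<subseteq> ?S" by (rule keys_add)
  then have "frag_length (b + c) = (\<Sum>x\<in>?S. nat \<bar>Poly_Mapping.lookup b x + Poly_Mapping.lookup c x\<bar>)"
    by (simp add: frag_length_superset[of ?S] lookup_add)
  also have "\<dots> \<le> (\<Sum>x\<in>?S. nat \<bar>Poly_Mapping.lookup b x\<bar> + nat \<bar>Poly_Mapping.lookup c x\<bar>)"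
    by (intro sum_mono) simp
  also have "\<dots> = frag_length b + frag_length c"
    by (simp add: frag_length_superset[of ?S] sum.distrib)
  finally show ?thesis .
qed

lemma abs_frag_eval_le:
  assumes "\<And>x. x \<in> Poly_Mapping.keys c \<Longrightarrow> \<bar>F x\<bar> \<le> 1"
  shows "\<bar>frag_eval F c\<bar> \<le> frag_length c"
proof -
  have "\<bar>frag_eval F c\<bar> \<le> (\<Sum>x\<in>Poly_Mapping.keys c. \<bar>of_int (Poly_Mapping.lookup c x) * F x\<bar>)"
    unfolding frag_eval_def by (rule sum_abs)
  also have "\<dots> \<le> (\<Sum>x\<in>Poly_Mapping.keys c. of_int \<bar>Poly_Mapping.lookup c x\<bar>)"
    by (intro sum_mono) (simp add: abs_mult mult_left_le assms)
  also have "\<dots> = frag_length c"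
    by (simp add: frag_length_def)
  finally show ?thesis .
qed

text \<open>The sign condition makes \<open>s\<close> the sign of the coefficient of
  \<open>x\<close>, so subtracting \<open>s\<close> moves this coefficient one step towards 0 and
  leaves the others alone. The decompositions below are built from this step.\<close>

lemma frag_length_peel:
  assumes s: "s = 1 \<or> s = -1" and pos: "s * Poly_Mapping.lookup c x > 0"
  shows "frag_length c = Suc (frag_length (c - frag_cmul s (frag_of x)))"
proof -
  let ?K = "Poly_Mapping.keys c" and ?b = "c - frag_cmul s (frag_of x)"
  have x: "x \<in> ?K" using pos by (cases "x \<in> ?K") (auto simp: not_in_keys_iff_lookup_eq_zero)
  have sub: "Poly_Mapping.keys ?b \<subseteq> ?K"
    using x keys_diff[of c "frag_cmul s (frag_of x)"] by (auto split: if_splits)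
  have "frag_length c = nat \<bar>Poly_Mapping.lookup c x\<bar> + (\<Sum>y\<in>?K - {x}. nat \<bar>Poly_Mapping.lookup c y\<bar>)"
    unfolding frag_length_def by (rule sum.remove[OF _ x]) simp
  moreover have "frag_length ?b = nat \<bar>Poly_Mapping.lookup ?b x\<bar> + (\<Sum>y\<in>?K - {x}. nat \<bar>Poly_Mapping.lookup ?b y\<bar>)"
    unfolding frag_length_superset[OF finite_keys sub] by (rule sum.remove[OF _ x]) simp
  moreover have "(\<Sum>y\<in>?K - {x}. nat \<bar>Poly_Mapping.lookup ?b y\<bar>) = (\<Sum>y\<in>?K - {x}. nat \<bar>Poly_Mapping.lookup c y\<bar>)"
    by (intro sum.cong) (auto simp: lookup_minus)
  moreover have "nat \<bar>Poly_Mapping.lookup c x\<bar> = Suc (nat \<bar>Poly_Mapping.lookup ?b x\<bar>)"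
    using s pos by (auto simp: lookup_minus)
  ultimately show ?thesis by simp
qed

lemma keys_peel:
  assumes "Poly_Mapping.keys c \<subseteq> S" "x \<in> S"
  shows "Poly_Mapping.keys (c - frag_cmul s (frag_of x)) \<subseteq> S"
  using assms keys_diff[of c "frag_cmul s (frag_of x)"] by (auto split: if_splits)

text \<open>A positive sum has a positive summand. As \<open>F\<close> is nonnegative, this summand
  reveals both a point in the support of \<open>F\<close> and the sign of its coefficient;
  \<open>s = -1\<close> serves to find points with negative coefficients.\<close>

lemma frag_eval_pos_witness:
  assumes "\<And>x. F x \<ge> 0" and pos: "of_int s * frag_eval F c > 0"
  obtains x where "x \<in> Poly_Mapping.keys c" "F x > 0" "s * Poly_Mapping.lookup c x > 0"
proof -
  have "0 < (\<Sum>x\<in>Poly_Mapping.keys c. of_int (s * Poly_Mapping.lookup c x) * F x)"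
    using pos by (simp add: frag_eval_def sum_distrib_left mult.assoc)
  then obtain x where x: "x \<in> Poly_Mapping.keys c" "of_int (s * Poly_Mapping.lookup c x) * F x > 0"
    using sum_nonpos[of "Poly_Mapping.keys c" "\<lambda>x. of_int (s * Poly_Mapping.lookup c x) * F x"]
    by (metis linorder_not_less)
  then have "F x > 0"
    using assms(1)[of x] by (metis mult_zero_right order_le_imp_less_or_eq less_irrefl)
  moreover have "s * Poly_Mapping.lookup c x > 0"
    using x(2) \<open>F x > 0\<close> by (metis of_int_0_less_iff zero_less_mult_pos2)
  ultimately show thesis using x(1) that by blast
qed

text \<open>An integer and its absolute value have the same parity. Hence elements whose coefficient
  sums differ by less than 1 have lengths of equal parity.\<close>

lemma frag_length_parity: "\<exists>k::int. frag_eval (\<lambda>_. 1) c = of_int (int (frag_length c) + 2 * k)"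
proof -
  have "even (\<Sum>x\<in>Poly_Mapping.keys c. \<bar>Poly_Mapping.lookup c x\<bar> - Poly_Mapping.lookup c x)"
    by (intro dvd_sum) simp
  then obtain k where "(\<Sum>x\<in>Poly_Mapping.keys c. \<bar>Poly_Mapping.lookup c x\<bar> - Poly_Mapping.lookup c x) = 2 * k"
    by (elim dvdE)
  then have "(\<Sum>x\<in>Poly_Mapping.keys c. Poly_Mapping.lookup c x) = int (frag_length c) + 2 * (- k)"
    by (simp add: frag_length_def sum_subtractf)
  then have "frag_eval (\<lambda>_. 1) c = of_int (int (frag_length c) + 2 * (- k))"
    by (simp only: frag_eval_def mult_1_right flip: of_int_sum)
  then show ?thesis by blast
qed

section \<open>Pseudonorms on the free group\<close>

text \<open>The group is fixed to be that of formal combinations, whose coefficients are directly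
  accessible. Other models are reached at the end by a homeomorphism that preserves length.\<close>

locale free_metric = Metric_space M d for M :: "'a set" and d +
  fixes T :: "('a \<Rightarrow>\<^sub>0 int) topology"
  assumes free: "free_abelian_topological_group (Metric_space.mtopology M d) (free_Abelian_group M) T frag_of"
begin

abbreviation "C \<equiv> {c. Poly_Mapping.keys c \<subseteq> M}"

text \<open>Nonnegativity follows from the first three conditions, as 0 = \<open>N 0\<close> \<le>
  \<open>N c + N (- c)\<close>. Continuity is demanded only along the points of \<open>M\<close>;
  the universal property extends it to the whole group.\<close>

definition continuous_seminorm :: "(('a \<Rightarrow>\<^sub>0 int) \<Rightarrow> real) \<Rightarrow> bool" where
  "continuous_seminorm N \<longleftrightarrow> N 0 = 0 \<and> (\<forall>c. N (- c) = N c) \<and> (\<forall>b c. N (b + c) \<le> N b + N c) \<and>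
    (\<forall>x\<in>M. \<forall>e>0. \<exists>r>0. \<forall>y\<in>M. d x y < r \<longrightarrow> N (frag_of x - frag_of y) < e)"

lemma topspace_T [simp]: "topspace T = C"
  using free by (auto simp: free_abelian_topological_group_def abelian_topological_group_def)

lemma C_closed:
  "b \<in> C \<Longrightarrow> c \<in> C \<Longrightarrow> b + c \<in> C" "b \<in> C \<Longrightarrow> c \<in> C \<Longrightarrow> b - c \<in> C"
  using keys_add[of b c] keys_diff[of b c] by auto

lemma continuous_frag_of: "continuous_map mtopology T frag_of"
  using free by (simp add: free_abelian_topological_group_def)

lemma continuous_add: "continuous_map (prod_topology T T) T (\<lambda>(x, y). x + y)"
  using free by (simp add: free_abelian_topological_group_def abelian_topological_group_def)

lemma continuous_uminus: "continuous_map T T uminus"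
proof -
  have "continuous_map T T (\<lambda>x. inv\<^bsub>free_Abelian_group M\<^esub> x)"
    using free by (simp add: free_abelian_topological_group_def abelian_topological_group_def)
  then show ?thesis by (rule continuous_map_eq) simp
qed

text \<open>The open sets are described directly, not through a metric, because distinct elements
  may have distance 0.\<close>

definition seminorm_topology :: "(('a \<Rightarrow>\<^sub>0 int) \<Rightarrow> real) \<Rightarrow> ('a \<Rightarrow>\<^sub>0 int) topology" where
  "seminorm_topology N = topology (\<lambda>S. S \<subseteq> C \<and> (\<forall>x\<in>S. \<exists>e>0. \<forall>y\<in>C. N (y - x) < e \<longrightarrow> y \<in> S))"

lemma openin_seminorm_topology:
  "openin (seminorm_topology N) S \<longleftrightarrow> S \<subseteq> C \<and> (\<forall>x\<in>S. \<exists>e>0. \<forall>y\<in>C. N (y - x) < e \<longrightarrow> y \<in> S)"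
proof -
  have "istopology (\<lambda>S. S \<subseteq> C \<and> (\<forall>x\<in>S. \<exists>e>0. \<forall>y\<in>C. N (y - x) < e \<longrightarrow> y \<in> S))"
    unfolding istopology_def
  proof (intro conjI allI impI ballI)
    fix S S' x
    assume S: "S \<subseteq> C \<and> (\<forall>x\<in>S. \<exists>e>0. \<forall>y\<in>C. N (y - x) < e \<longrightarrow> y \<in> S)"
      and S': "S' \<subseteq> C \<and> (\<forall>x\<in>S'. \<exists>e>0. \<forall>y\<in>C. N (y - x) < e \<longrightarrow> y \<in> S')"
    from S show "S \<inter> S' \<subseteq> C" by (meson Int_lower1 order_trans)
    assume x: "x \<in> S \<inter> S'"
    from x obtain e where "e > 0" "\<forall>y\<in>C. N (y - x) < e \<longrightarrow> y \<in> S"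
      using S by (meson IntE)
    moreover from x obtain e' where "e' > 0" "\<forall>y\<in>C. N (y - x) < e' \<longrightarrow> y \<in> S'"
      using S' by (meson IntE)
    ultimately show "\<exists>e>0. \<forall>y\<in>C. N (y - x) < e \<longrightarrow> y \<in> S \<inter> S'"
      by (intro exI[of _ "min e e'"]) simp
  next
    fix \<K> x
    assume K: "\<forall>K\<in>\<K>. K \<subseteq> C \<and> (\<forall>x\<in>K. \<exists>e>0. \<forall>y\<in>C. N (y - x) < e \<longrightarrow> y \<in> K)"
    then show "\<Union>\<K> \<subseteq> C" by (meson Sup_le_iff)
    assume "x \<in> \<Union>\<K>"
    then show "\<exists>e>0. \<forall>y\<in>C. N (y - x) < e \<longrightarrow> y \<in> \<Union>\<K>"
      using K by (meson UnionE UnionI)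
  qed
  then show ?thesis by (simp add: seminorm_topology_def)
qed

lemma openin_seminorm_topologyE:
  assumes "openin (seminorm_topology N) S" "x \<in> S"
  obtains e where "e > 0" "\<forall>y\<in>C. N (y - x) < e \<longrightarrow> y \<in> S"
  using assms unfolding openin_seminorm_topology by (meson assms)

lemma openin_seminorm_ball:
  assumes "continuous_seminorm N"
  shows "openin (seminorm_topology N) {c \<in> C. N (c - g) < e}"
  unfolding openin_seminorm_topology
proof (intro conjI ballI)
  fix x assume x: "x \<in> {c \<in> C. N (c - g) < e}"
  have tri: "N (y - g) \<le> N (y - x) + N (x - g)" for y
  proof -
    have "N ((y - x) + (x - g)) \<le> N (y - x) + N (x - g)"
      using assms unfolding continuous_seminorm_def by blast
    then show ?thesis by simp
  qed
  then show "\<exists>e'>0. \<forall>y\<in>C. N (y - x) < e' \<longrightarrow> y \<in> {c \<in> C. N (c - g) < e}"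
    using x by (intro exI[of _ "e - N (x - g)"]) (auto intro: le_less_trans[OF tri])
qed auto

lemma topspace_seminorm_topology [simp]: "topspace (seminorm_topology N) = C"
proof
  show "topspace (seminorm_topology N) \<subseteq> C"
    using openin_seminorm_topology openin_topspace by blast
  have "openin (seminorm_topology N) C"
    unfolding openin_seminorm_topology by (auto intro!: exI[of _ "1::real"])
  then show "C \<subseteq> topspace (seminorm_topology N)"
    by (rule openin_subset)
qed

lemma group_seminorm_topology:
  assumes N: "continuous_seminorm N"
  shows "abelian_topological_group (free_Abelian_group M) (seminorm_topology N)"
proof -
  let ?U = "seminorm_topology N"
  have N0: "N 0 = 0" and Nm: "\<And>c. N (- c) = N c" and Na: "\<And>b c. N (b + c) \<le> N b + N c"
    using N by (auto simp: continuous_seminorm_def)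
  have "continuous_map (prod_topology ?U ?U) ?U (\<lambda>(x, y). x + y)"
    unfolding continuous_map_def
  proof (intro conjI allI impI)
    fix S assume S: "openin ?U S"
    show "openin (prod_topology ?U ?U) {p \<in> topspace (prod_topology ?U ?U). (\<lambda>(x, y). x + y) p \<in> S}"
      unfolding openin_prod_topology_alt
    proof (intro allI impI)
      fix x y assume "(x, y) \<in> {p \<in> topspace (prod_topology ?U ?U). (\<lambda>(x, y). x + y) p \<in> S}"
      then have xy: "x \<in> C" "y \<in> C" "x + y \<in> S" by auto
      obtain e where e: "e > 0" "\<forall>z\<in>C. N (z - (x + y)) < e \<longrightarrow> z \<in> S"
        by (rule openin_seminorm_topologyE[OF S xy(3)])
      have "u + v \<in> S" if "u \<in> C" "v \<in> C" "N (u - x) < e / 2" "N (v - y) < e / 2" for u v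
      proof -
        have "N (u + v - (x + y)) \<le> N (u - x) + N (v - y)"
          using Na[of "u - x" "v - y"] by (simp add: algebra_simps)
        then have "N (u + v - (x + y)) < e" using that(3,4) by simp
        with C_closed(1)[OF that(1,2)] show ?thesis by (rule e(2)[rule_format])
      qed
      then have "{c \<in> C. N (c - x) < e / 2} \<times> {c \<in> C. N (c - y) < e / 2}
          \<subseteq> {p \<in> topspace (prod_topology ?U ?U). (\<lambda>(x, y). x + y) p \<in> S}"
        by auto
      moreover have "x \<in> {c \<in> C. N (c - x) < e / 2}" "y \<in> {c \<in> C. N (c - y) < e / 2}"
        using xy e(1) N0 by auto
      ultimately show "\<exists>U V. openin ?U U \<and> openin ?U V \<and> x \<in> U \<and> y \<in> V \<and>
          U \<times> V \<subseteq> {p \<in> topspace (prod_topology ?U ?U). (\<lambda>(x, y). x + y) p \<in> S}"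
        using openin_seminorm_ball[OF N] by blast
    qed
  next
    show "(\<lambda>(x, y). x + y) \<in> topspace (prod_topology ?U ?U) \<rightarrow> topspace ?U"
    proof (rule funcsetI)
      fix p assume "p \<in> topspace (prod_topology ?U ?U)"
      then have "fst p \<in> C" "snd p \<in> C" by auto
      then have "fst p + snd p \<in> C" by (rule C_closed)
      then show "(case p of (x, y) \<Rightarrow> x + y) \<in> topspace ?U" by (simp add: case_prod_unfold)
    qed
  qed
  moreover have "continuous_map ?U ?U uminus"
    unfolding continuous_map_def
  proof (intro conjI allI impI)
    fix S assume S: "openin ?U S"
    show "openin ?U {x \<in> topspace ?U. - x \<in> S}"
      unfolding openin_seminorm_topology topspace_seminorm_topology
    proof (intro conjI ballI)
      fix x assume "x \<in> {x \<in> C. - x \<in> S}"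
      then have x: "- x \<in> S" by simp
      obtain e where e: "e > 0" "\<forall>z\<in>C. N (z - (- x)) < e \<longrightarrow> z \<in> S"
        by (rule openin_seminorm_topologyE[OF S x])
      have "- y \<in> S" if "y \<in> C" "N (y - x) < e" for y
      proof (rule e(2)[rule_format])
        have "- y - (- x) = - (y - x)" by simp
        then show "N (- y - (- x)) < e" using Nm[of "y - x"] that(2) by metis
      qed (use that in simp)
      then show "\<exists>e>0. \<forall>y\<in>C. N (y - x) < e \<longrightarrow> y \<in> {x \<in> C. - x \<in> S}"
        using e(1) by (intro exI[of _ e]) simp
    qed auto
  qed auto
  then have "continuous_map ?U ?U (\<lambda>x. inv\<^bsub>free_Abelian_group M\<^esub> x)"
    by (rule continuous_map_eq) simp
  ultimately show ?thesis
    by (auto simp: abelian_topological_group_def abelian_free_Abelian_group)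
qed


text \<open>The inclusion of \<open>M\<close> into the seminormed group is continuous, so it extends
  to a continuous homomorphism. This fixes the generators and is therefore the identity, which says
  that \<open>T\<close> is finer than the topology of the seminorm.\<close>

lemma openin_T_if_seminorm:
  assumes N: "continuous_seminorm N" and S: "openin (seminorm_topology N) S"
  shows "openin T S"
proof -
  let ?F = "free_Abelian_group M" and ?U = "seminorm_topology N"
  have "continuous_map mtopology ?U frag_of"
    unfolding continuous_map_def
  proof (intro conjI allI impI)
    fix S assume S: "openin ?U S"
    have "\<exists>r>0. mball x r \<subseteq> {x \<in> topspace mtopology. frag_of x \<in> S}"
      if x: "x \<in> M" "frag_of x \<in> S" for x
    proof -
      obtain e where e: "e > 0" "\<forall>z\<in>C. N (z - frag_of x) < e \<longrightarrow> z \<in> S"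
        by (rule openin_seminorm_topologyE[OF S x(2)])
      obtain r where r: "r > 0" "\<forall>y\<in>M. d x y < r \<longrightarrow> N (frag_of x - frag_of y) < e"
        using N x(1) e(1) unfolding continuous_seminorm_def by meson
      have "N (frag_of y - frag_of x) = N (frag_of x - frag_of y)" for y
        using N unfolding continuous_seminorm_def by (metis minus_diff_eq)
      then have "frag_of y \<in> S" if "y \<in> M" "d x y < r" for y
        using r(2) that by (intro e(2)[rule_format]) (auto simp: keys_frag_of)
      then show ?thesis using r(1) by (intro exI[of _ r]) auto
    qed
    then show "openin mtopology {x \<in> topspace mtopology. frag_of x \<in> S}"
      unfolding openin_mtopology by (metis (no_types, lifting) mem_Collect_eq subsetI topspace_mtopology)
  next
    show "frag_of \<in> topspace mtopology \<rightarrow> topspace ?U"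
      by (auto simp: keys_frag_of)
  qed
  then obtain h where h: "h \<in> hom ?F ?F" "continuous_map T ?U h" "\<forall>x\<in>M. h (frag_of x) = frag_of x"
    using free_universal[OF free group_seminorm_topology[OF N]] by (metis topspace_mtopology)
  have "h c = id c" if "c \<in> C" for c
  proof (rule generate_hom_eq[of ?F ?F h id "frag_of ` M"])
    show "c \<in> generate ?F (frag_of ` M)"
      using free that by (simp add: free_abelian_topological_group_def)
    show "id \<in> hom ?F ?F" by (simp add: hom_def)
    show "h x = id x" if "x \<in> frag_of ` M" for x
      using that h(3) by auto
  qed (use h(1) in auto)
  then have "{c \<in> topspace T. h c \<in> S} = S"
    using openin_subset[OF S] by auto
  then show ?thesis
    using h(2) S unfolding continuous_map_def by metis
qed

lemma continuous_map_if_seminorm: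
  assumes N: "continuous_seminorm N" and f: "\<And>b c. b \<in> C \<Longrightarrow> c \<in> C \<Longrightarrow> \<bar>f b - f c\<bar> \<le> N (b - c)"
  shows "continuous_map T euclideanreal f"
  unfolding continuous_map_def
proof (intro conjI allI impI)
  fix S assume S: "openin euclideanreal S"
  have "openin (seminorm_topology N) {x \<in> topspace T. f x \<in> S}"
    unfolding openin_seminorm_topology topspace_T
  proof (intro conjI ballI)
    fix x assume "x \<in> {x \<in> C. f x \<in> S}"
    then have x: "x \<in> C" "f x \<in> S" by auto
    then obtain e where e: "e > 0" "ball (f x) e \<subseteq> S"
      using S openE by (metis open_openin)
    have "f y \<in> S" if "y \<in> C" "N (y - x) < e" for y
      using f[OF that(1) x(1)] that(2) e(2) by (auto simp: subset_iff dist_real_def)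
    then show "\<exists>e>0. \<forall>y\<in>C. N (y - x) < e \<longrightarrow> y \<in> {x \<in> C. f x \<in> S}"
      using e(1) by (intro exI[of _ e]) simp
  qed auto
  then show "openin T {x \<in> topspace T. f x \<in> S}"
    by (rule openin_T_if_seminorm[OF N])
qed auto

lemma continuous_seminorm_le:
  assumes "continuous_seminorm N"
  shows "\<bar>N b - N c\<bar> \<le> N (b - c)"
proof -
  have "N b \<le> N (b - c) + N c" "N c \<le> N (c - b) + N b" "N (b - c) = N (c - b)"
    using assms unfolding continuous_seminorm_def by (metis diff_add_cancel, metis diff_add_cancel, metis minus_diff_eq)
  then show ?thesis by linarith
qed

lemma continuous_map_seminorm_diff:
  assumes N: "continuous_seminorm N"
  shows "continuous_map T euclideanreal (\<lambda>c. N (c - g))"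
proof (rule continuous_map_if_seminorm[OF N])
  show "\<bar>N (b - g) - N (c - g)\<bar> \<le> N (b - c)" for b c
    using continuous_seminorm_le[OF N, of "b - g" "c - g"] by simp
qed

lemma continuous_seminorm_max:
  assumes "continuous_seminorm N" "continuous_seminorm N'"
  shows "continuous_seminorm (\<lambda>c. max (N c) (N' c))"
  unfolding continuous_seminorm_def
proof (intro conjI allI ballI impI)
  fix x e assume xe: "x \<in> M" "(e::real) > 0"
  obtain r where "r > 0" "\<forall>y\<in>M. d x y < r \<longrightarrow> N (frag_of x - frag_of y) < e"
    using assms(1) xe unfolding continuous_seminorm_def by meson
  moreover obtain r' where "r' > 0" "\<forall>y\<in>M. d x y < r' \<longrightarrow> N' (frag_of x - frag_of y) < e"
    using assms(2) xe unfolding continuous_seminorm_def by meson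
  ultimately show "\<exists>r>0. \<forall>y\<in>M. d x y < r \<longrightarrow> max (N (frag_of x - frag_of y)) (N' (frag_of x - frag_of y)) < e"
    by (intro exI[of _ "min r r'"]) simp
next
  fix b c
  have "N (b + c) \<le> N b + N c" "N' (b + c) \<le> N' b + N' c"
    using assms unfolding continuous_seminorm_def by blast+
  then show "max (N (b + c)) (N' (b + c)) \<le> max (N b) (N' b) + max (N c) (N' c)"
    by linarith
qed (use assms in \<open>auto simp: continuous_seminorm_def\<close>)

lemma continuous_seminorm_frag_eval:
  assumes F: "continuous_map mtopology euclideanreal F"
  shows "continuous_seminorm (\<lambda>c. \<bar>frag_eval F c\<bar>)"
  unfolding continuous_seminorm_def
proof (intro conjI allI ballI impI)
  fix x e assume xe: "x \<in> M" "(e::real) > 0"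
  have "openin mtopology {y \<in> topspace mtopology. F y \<in> ball (F x) e}"
    by (intro openin_continuous_map_preimage[OF F]) simp
  then obtain r where "r > 0" "mball x r \<subseteq> {y \<in> topspace mtopology. F y \<in> ball (F x) e}"
    using xe unfolding openin_mtopology by (metis (no_types, lifting) centre_in_ball mem_Collect_eq topspace_mtopology)
  then show "\<exists>r>0. \<forall>y\<in>M. d x y < r \<longrightarrow> \<bar>frag_eval F (frag_of x - frag_of y)\<bar> < e"
    using xe by (intro exI[of _ r]) (auto simp: subset_iff dist_real_def)
qed auto

lemma continuous_map_frag_eval:
  assumes "continuous_map mtopology euclideanreal F"
  shows "continuous_map T euclideanreal (frag_eval F)"
  by (rule continuous_map_if_seminorm[OF continuous_seminorm_frag_eval[OF assms]]) simp


section \<open>Bumps and the seminorms built from them\<close>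

definition bump :: "'a \<Rightarrow> real \<Rightarrow> 'a \<Rightarrow> real" where
  "bump p r x = max 0 (1 - d p x / r)"

lemma bump_nonneg [simp]: "bump p r x \<ge> 0"
  by (simp add: bump_def)

lemma bump_le_1: "r > 0 \<Longrightarrow> bump p r x \<le> 1"
  by (simp add: bump_def)

lemma bump_self [simp]: "p \<in> M \<Longrightarrow> bump p r p = 1"
  by (simp add: bump_def)

lemma bump_pos_iff: "r > 0 \<Longrightarrow> bump p r x > 0 \<longleftrightarrow> d p x < r"
  by (simp add: bump_def less_max_iff_disj)

lemma bump_eq_0: "r > 0 \<Longrightarrow> r \<le> d p x \<Longrightarrow> bump p r x = 0"
  by (simp add: bump_def)

lemma continuous_map_real_if:
  assumes f: "\<And>x e. x \<in> M \<Longrightarrow> e > 0 \<Longrightarrow> \<exists>r>0. \<forall>y\<in>M. d x y < r \<longrightarrow> \<bar>f y - f x\<bar> < e"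
  shows "continuous_map mtopology euclideanreal f"
  unfolding continuous_map_def
proof (intro conjI allI impI)
  fix S assume S: "openin euclideanreal S"
  show "openin mtopology {x \<in> topspace mtopology. f x \<in> S}"
    unfolding openin_mtopology topspace_mtopology
  proof (intro conjI allI impI)
    fix x assume "x \<in> {x \<in> M. f x \<in> S}"
    then have x: "x \<in> M" "f x \<in> S" by auto
    obtain e where e: "e > 0" "ball (f x) e \<subseteq> S"
      using S x(2) openE by (metis open_openin)
    obtain r where "r > 0" "\<forall>y\<in>M. d x y < r \<longrightarrow> \<bar>f y - f x\<bar> < e"
      using f[OF x(1) e(1)] by meson
    then show "\<exists>r>0. mball x r \<subseteq> {x \<in> M. f x \<in> S}"
      using e(2) by (intro exI[of _ r]) (auto simp: subset_iff dist_real_def abs_minus_commute)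
  qed auto
qed auto

lemma continuous_bump:
  assumes "p \<in> M" "r > 0"
  shows "continuous_map mtopology euclideanreal (bump p r)"
proof -
  have "continuous_map mtopology euclideanreal (\<lambda>x. d p x)"
  proof (rule continuous_map_real_if)
    fix x e assume "x \<in> M" "(e::real) > 0"
    then show "\<exists>r>0. \<forall>y\<in>M. d x y < r \<longrightarrow> \<bar>d p y - d p x\<bar> < e"
      using mdist_reverse_triangle[of y p x for y] assms(1)
      by (intro exI[of _ e]) (smt (verit) commute)
  qed
  then show ?thesis
    unfolding bump_def using assms(2)
    by (intro continuous_map_real_max continuous_map_diff continuous_map_real_divide) (use assms(2) in auto)
qed

lemma continuous_seminorm_bump:
  "p \<in> M \<Longrightarrow> r > 0 \<Longrightarrow> continuous_seminorm (\<lambda>c. \<bar>frag_eval (bump p r) c\<bar>)"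
  by (intro continuous_seminorm_frag_eval continuous_bump)

text \<open>The bound 1 keeps the supremum finite, since each extension is then bounded by the
  length. Equicontinuity at each point keeps it continuous along \<open>M\<close> even for infinite
  families.\<close>

lemma continuous_seminorm_SUP:
  assumes bnd: "\<And>w x. w \<in> A \<Longrightarrow> 0 \<le> \<phi> w x \<and> \<phi> w x \<le> 1"
    and equi: "\<And>x e. x \<in> M \<Longrightarrow> e > 0 \<Longrightarrow> \<exists>r>0. \<forall>w\<in>A. \<forall>y\<in>M. d x y < r \<longrightarrow> \<bar>\<phi> w x - \<phi> w y\<bar> < e"
  obtains N where "continuous_seminorm N" "\<And>w c. w \<in> A \<Longrightarrow> \<bar>frag_eval (\<phi> w) c\<bar> \<le> N c"
proof
  \<comment> \<open>The inserted 0 keeps the set nonempty when \<open>A\<close> is empty; the other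
    members are nonnegative anyway.\<close>
  define V where "V c = insert 0 ((\<lambda>w. \<bar>frag_eval (\<phi> w) c\<bar>) ` A)" for c
  have V0: "0 \<in> V c" for c by (simp add: V_def)
  have "\<bar>frag_eval (\<phi> w) c\<bar> \<le> frag_length c" if "w \<in> A" for w c
    using bnd[OF that] by (intro abs_frag_eval_le) auto
  then have le: "t \<le> frag_length c" if "t \<in> V c" for t c
    using that by (auto simp: V_def)
  then have bdd: "bdd_above (V c)" for c
    by (meson bdd_aboveI)
  show upper: "\<bar>frag_eval (\<phi> w) c\<bar> \<le> Sup (V c)" if "w \<in> A" for w c
    using that by (intro cSup_upper bdd) (auto simp: V_def)
  have least: "Sup (V c) \<le> t" if "0 \<le> t" "\<And>w. w \<in> A \<Longrightarrow> \<bar>frag_eval (\<phi> w) c\<bar> \<le> t" for c t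
    using that by (intro cSup_least) (auto simp: V_def)
  have nonneg: "0 \<le> Sup (V c)" for c
    by (rule cSup_upper[OF V0 bdd])
  show "continuous_seminorm (\<lambda>c. Sup (V c))"
    unfolding continuous_seminorm_def
  proof (intro conjI allI ballI impI)
    show "Sup (V 0) = 0"
      by (rule antisym[OF least nonneg]) auto
    show "Sup (V (- c)) = Sup (V c)" for c
      by (simp add: V_def)
    show "Sup (V (b + c)) \<le> Sup (V b) + Sup (V c)" for b c
    proof (rule least)
      fix w assume "w \<in> A"
      then show "\<bar>frag_eval (\<phi> w) (b + c)\<bar> \<le> Sup (V b) + Sup (V c)"
        using upper[of w b] upper[of w c] by simp
    qed (use nonneg in simp)
    fix x e assume "x \<in> M" "(e::real) > 0"
    \<comment> \<open>Half of \<open>e\<close>, because a supremum of values below a bound may reach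
      the bound.\<close>
    then obtain r where r: "r > 0" "\<forall>w\<in>A. \<forall>y\<in>M. d x y < r \<longrightarrow> \<bar>\<phi> w x - \<phi> w y\<bar> < e / 2"
      using equi[of x "e / 2"] by auto
    have "Sup (V (frag_of x - frag_of y)) \<le> e / 2" if "y \<in> M" "d x y < r" for y
      using r(2) that \<open>e > 0\<close> by (intro least) (auto intro: less_imp_le)
    then show "\<exists>r>0. \<forall>y\<in>M. d x y < r \<longrightarrow> Sup (V (frag_of x - frag_of y)) < e"
      using r(1) \<open>e > 0\<close> by (intro exI[of _ r]) fastforce
  qed
qed

text \<open>The hypothesis says that \<open>P\<close> holds near the diagonal. The radius of the
  bump at \<open>w\<close> has to depend on \<open>w\<close>, and arbitrary radii could destroy
  equicontinuity. The supremum of the admissible radii up to 1 is used since it cannot vary faster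
  than the distance.\<close>

lemma diagonal_bumps:
  assumes P: "\<forall>w\<in>M. \<exists>e>0. \<forall>y\<in>M. \<forall>z\<in>M. d w y < e \<longrightarrow> d w z < e \<longrightarrow> P y z"
  shows "\<exists>\<phi> N. continuous_seminorm N \<and> (\<forall>w\<in>M. \<phi> w w = (1::real) \<and>
    (\<forall>x. 0 \<le> \<phi> w x) \<and> (\<forall>x\<in>M. \<phi> w x > 0 \<longrightarrow> P x w) \<and> (\<forall>c. \<bar>frag_eval (\<phi> w) c\<bar> \<le> N c))"
proof -
  \<comment> \<open>The cap 1 keeps the supremum finite where arbitrarily large radii would
    do.\<close>
  define Q where "Q w e \<longleftrightarrow> 0 < e \<and> e \<le> 1 \<and> (\<forall>y\<in>M. \<forall>z\<in>M. d w y < e \<longrightarrow> d w z < e \<longrightarrow> P y z)" for w e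
  define E where "E w = Sup {e. Q w e}" for w \<comment> \<open>1-Lipschitz, whence the bumps of radius \<open>E w / 2\<close> are equicontinuous\<close>
  have bdd: "bdd_above {e. Q w e}" for w
    by (rule bdd_aboveI[of _ 1]) (simp add: Q_def)
  have ne: "\<exists>e. Q w e" if "w \<in> M" for w
  proof -
    from bspec[OF P that] obtain e where "e > 0" "\<forall>y\<in>M. \<forall>z\<in>M. d w y < e \<longrightarrow> d w z < e \<longrightarrow> P y z"
      by meson
    then have "Q w (min e 1)" by (simp add: Q_def)
    then show ?thesis ..
  qed
  have E_upper: "e \<le> E w" if "Q w e" for w e
    unfolding E_def by (rule cSup_upper) (use that bdd in auto)
  have E_pos: "E w > 0" if "w \<in> M" for w
    using ne[OF that] E_upper unfolding Q_def by (meson less_le_trans)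
  have E_witness: "\<exists>e. Q w e \<and> t < e" if "w \<in> M" "t < E w" for w t
    using less_cSupE[of t "{e. Q w e}"] that ne unfolding E_def by (metis empty_iff mem_Collect_eq)
  have E_Lip: "E w \<le> E x + d w x" if "w \<in> M" "x \<in> M" for w x
  proof (rule ccontr)
    assume "\<not> E w \<le> E x + d w x"
    with that(1) have "\<exists>e. Q w e \<and> E x + d w x < e"
      by (intro E_witness) auto
    then obtain e where e: "Q w e" "E x + d w x < e" by blast
    \<comment> \<open>The ball of this radius around \<open>x\<close> lies in the ball of radius
      \<open>e\<close> around \<open>w\<close>.\<close>
    have "Q x (e - d w x)"
      unfolding Q_def
    proof (intro conjI ballI impI)
      show "0 < e - d w x" using e(2) E_pos[OF that(2)] by linarith
      show "e - d w x \<le> 1" using e(1) nonneg[of w x] unfolding Q_def by linarith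
      fix y z assume yz: "y \<in> M" "z \<in> M" "d x y < e - d w x" "d x z < e - d w x"
      then have "d w y < e" "d w z < e"
        using triangle[OF that yz(1)] triangle[OF that yz(2)] by linarith+
      then show "P y z" using e(1) yz(1,2) unfolding Q_def by meson
    qed
    then show False using E_upper[of x "e - d w x"] e(2) by linarith
  qed
  define \<phi> where "\<phi> w = bump w (E w / 2)" for w
  have equi: "\<exists>r>0. \<forall>w\<in>M. \<forall>y\<in>M. d x y < r \<longrightarrow> \<bar>\<phi> w x - \<phi> w y\<bar> < e" if x: "x \<in> M" and "e > 0" for x e
  proof (intro exI conjI ballI impI)
    let ?R = "E x"
    have R: "?R > 0" by (rule E_pos[OF x])
    \<comment> \<open>A bump that is nonzero at \<open>x\<close> or \<open>y\<close> has
      \<open>E w\<close> \<ge> \<open>?R / 2\<close>, hence Lipschitz constant at most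
      \<open>4 / ?R\<close>. The second bound then makes the difference less than
      \<open>e / 2\<close>.\<close>
    show "min (?R / 4) (e * ?R / 8) > 0" using R \<open>e > 0\<close> by simp
    fix w y assume wy: "w \<in> M" "y \<in> M" "d x y < min (?R / 4) (e * ?R / 8)"
    have Ew: "E w > 0" by (rule E_pos[OF wy(1)])
    show "\<bar>\<phi> w x - \<phi> w y\<bar> < e"
    proof (cases "d w x < E w / 2 \<or> d w y < E w / 2")
      case True
      have "E x \<le> E y + d x y" "E x \<le> E w + d x w" "E y \<le> E w + d y w"
        by (rule E_Lip; use x wy in simp)+
      moreover have "d x y < ?R / 4" using wy(3) by simp
      ultimately have "?R \<le> 2 * E w"
        using True Ew commute[of w x] commute[of w y] by linarith
      have "\<bar>\<phi> w x - \<phi> w y\<bar> \<le> \<bar>d w x / (E w / 2) - d w y / (E w / 2)\<bar>"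
        unfolding \<phi>_def bump_def by linarith
      also have "\<dots> = \<bar>d w x - d w y\<bar> / (E w / 2)"
        using Ew by (metis abs_div_pos diff_divide_distrib half_gt_zero)
      also have "\<dots> \<le> d x y / (E w / 2)"
        using Ew mdist_reverse_triangle[of x w y] x wy by (intro divide_right_mono) (auto simp: commute[of w x])
      also have "\<dots> \<le> d x y / (?R / 4)"
        using Ew R \<open>?R \<le> 2 * E w\<close> by (intro divide_left_mono) auto
      also have "\<dots> < (e * ?R / 8) / (?R / 4)"
        using wy(3) R by (intro divide_strict_right_mono) auto
      also have "\<dots> \<le> e"
        using R \<open>e > 0\<close> by simp
      finally show ?thesis .
    next
      case False
      then show ?thesis using Ew \<open>e > 0\<close> by (simp add: \<phi>_def bump_eq_0)
    qed
  qed
  have bnd: "0 \<le> \<phi> w x \<and> \<phi> w x \<le> 1" if "w \<in> M" for w x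
    using E_pos[OF that] by (simp add: \<phi>_def bump_le_1)
  obtain N where N: "continuous_seminorm N" "\<And>w c. w \<in> M \<Longrightarrow> \<bar>frag_eval (\<phi> w) c\<bar> \<le> N c"
    using continuous_seminorm_SUP[OF bnd equi] by metis
  have "P x w" if "w \<in> M" "x \<in> M" "\<phi> w x > 0" for w x
  proof -
    have "d w x < E w / 2" using that E_pos by (simp add: \<phi>_def bump_pos_iff)
    then have "\<exists>e. Q w e \<and> d w x < e"
      using that(1) E_pos[OF that(1)] by (intro E_witness) auto
    then obtain e where "Q w e" "d w x < e" by blast
    then show ?thesis using that(1,2) by (simp add: Q_def)
  qed
  moreover have "\<phi> w w = 1" if "w \<in> M" for w
    using that by (simp add: \<phi>_def)
  ultimately show ?thesis
    using N bnd by (intro exI[of _ \<phi>] exI[of _ N]) simp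
qed

lemma continuous_seminorm_finite_bound:
  assumes "finite S" "\<And>p. p \<in> S \<Longrightarrow> continuous_seminorm (n p)"
  shows "\<exists>N. continuous_seminorm N \<and> (\<forall>p\<in>S. \<forall>c. n p c \<le> N c)"
  using assms
proof (induction S)
  case empty
  have "continuous_seminorm (\<lambda>c. \<bar>frag_eval (\<lambda>_. 0) c\<bar>)"
    by (rule continuous_seminorm_frag_eval) simp
  then show ?case by auto
next
  case (insert p S)
  then obtain N where "continuous_seminorm N" "\<forall>p\<in>S. \<forall>c. n p c \<le> N c"
    by (metis insertCI)
  then have "continuous_seminorm (\<lambda>c. max (n p c) (N c))" "\<forall>q\<in>insert p S. \<forall>c. n q c \<le> max (n p c) (N c)"
    using insert.prems by (auto intro!: continuous_seminorm_max simp: le_max_iff_disj)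
  then show ?case by blast
qed

end

section \<open>Words of signed points and their perturbations\<close>

definition signed_sum :: "(int \<times> 'a) list \<Rightarrow> 'a \<Rightarrow>\<^sub>0 int" where
  "signed_sum L = (\<Sum>(s, p)\<leftarrow>L. frag_cmul s (frag_of p))"

lemma signed_sum_simps [simp]:
  "signed_sum [] = 0" "signed_sum ((s, p) # L) = frag_cmul s (frag_of p) + signed_sum L"
  by (simp_all add: signed_sum_def)

lemma frag_length_signed_sum:
  "\<forall>(s, p)\<in>set L. s = 1 \<or> s = -1 \<Longrightarrow> frag_length (signed_sum L) \<le> length L"
proof (induction L)
  case (Cons a L)
  obtain s p where a: "a = (s, p)" by (cases a)
  have "frag_length (frag_cmul s (frag_of p)) \<le> 1"
    using Cons.prems a by auto
  then show ?case
    using Cons a frag_length_add[of "frag_cmul s (frag_of p)" "signed_sum L"] by simp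
qed simp

lemma keys_signed_sum: "\<forall>(s, p)\<in>set L. p \<in> S \<Longrightarrow> Poly_Mapping.keys (signed_sum L) \<subseteq> S"
proof (induction L)
  case (Cons a L)
  obtain s p where a: "a = (s, p)" by (cases a)
  show ?case
    using Cons a keys_add[of "frag_cmul s (frag_of p)" "signed_sum L"] keys_cmul[of s "frag_of p"] by auto
qed simp

text \<open>Points are listed with multiplicity. Each letter carries the sign of the coefficient of
  its point, so no point occurs with both signs and nothing cancels in the word.\<close>

lemma signed_sum_exists:
  "\<exists>L. signed_sum L = c \<and> length L = frag_length c \<and>
       (\<forall>(s, p)\<in>set L. (s = 1 \<or> s = -1) \<and> p \<in> Poly_Mapping.keys c \<and> s * Poly_Mapping.lookup c p > 0)"
proof (induction "frag_length c" arbitrary: c)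
  case 0
  then show ?case by (intro exI[of _ "[]"]) auto
next
  case (Suc n)
  then have "c \<noteq> 0" by auto
  then obtain x where x: "x \<in> Poly_Mapping.keys c" by (meson ex_in_conv keys_eq_empty)
  define s where "s = sgn (Poly_Mapping.lookup c x)"
  have nz: "Poly_Mapping.lookup c x \<noteq> 0" using x by (metis not_in_keys_iff_lookup_eq_zero)
  then have s: "s = 1 \<or> s = -1" "s * Poly_Mapping.lookup c x > 0"
    by (auto simp: s_def sgn_if)
  let ?b = "c - frag_cmul s (frag_of x)"
  have "frag_length c = Suc (frag_length ?b)" by (rule frag_length_peel[OF s])
  then have "n = frag_length ?b" using Suc.hyps(2) by simp
  from Suc.hyps(1)[OF this] obtain L where L: "signed_sum L = ?b" "length L = frag_length ?b"
    "\<forall>(s, p)\<in>set L. (s = 1 \<or> s = -1) \<and> p \<in> Poly_Mapping.keys ?b \<and> s * Poly_Mapping.lookup ?b p > 0"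
    by blast
  have "(s' = 1 \<or> s' = -1) \<and> p \<in> Poly_Mapping.keys c \<and> s' * Poly_Mapping.lookup c p > 0"
    if "(s', p) \<in> set L" for s' p
  proof (cases "p = x")
    case True
    have "s' = 1 \<or> s' = -1" "s' * Poly_Mapping.lookup ?b x > 0"
      using L(3) that True by auto
    then show ?thesis using True s x by (auto simp: lookup_minus)
  next
    case False
    then have "Poly_Mapping.lookup ?b p = Poly_Mapping.lookup c p" by (simp add: lookup_minus)
    moreover have "s' = 1 \<or> s' = -1" "s' * Poly_Mapping.lookup ?b p > 0"
      using L(3) that by auto
    moreover have "p \<in> Poly_Mapping.keys c"
      using calculation(1,3) by (cases "p \<in> Poly_Mapping.keys c") (auto simp: not_in_keys_iff_lookup_eq_zero)
    ultimately show ?thesis by simp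
  qed
  then have "\<forall>(s', p)\<in>set ((s, x) # L). (s' = 1 \<or> s' = -1) \<and> p \<in> Poly_Mapping.keys c \<and> s' * Poly_Mapping.lookup c p > 0"
    using s x by auto
  moreover have "signed_sum ((s, x) # L) = c" "length ((s, x) # L) = frag_length c"
    using L(1,2) \<open>frag_length c = Suc (frag_length ?b)\<close> by simp_all
  ultimately show ?case by blast
qed

lemma frag_eval_signed_sum_count:
  assumes "F p = 1" "s * s = 1"
    and "\<forall>(s', q)\<in>set L. (q = p \<longrightarrow> s' = s) \<and> (q \<noteq> p \<longrightarrow> F q = 0)"
  shows "of_int s * frag_eval F (signed_sum L) = count_list L (s, p)"
  using assms(3)
proof (induction L)
  case (Cons a L)
  obtain s' q where a: "a = (s', q)" by (cases a)
  have ss: "real_of_int s * real_of_int s = 1"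
    using assms(2) by (metis of_int_1 of_int_mult)
  show ?case
    using Cons a assms(1) ss by (auto simp: distrib_left)
qed simp

context free_metric begin

text \<open>The letters move separately: copies of one point may go to different points, and letters
  that cancel in the sum may cease to do so.\<close>

abbreviation near :: "real \<Rightarrow> (int \<times> 'a) list \<Rightarrow> (int \<times> 'a) list \<Rightarrow> bool" where
  "near r \<equiv> list_all2 (\<lambda>(s, p) (s', p'). s' = s \<and> p' \<in> M \<and> d p p' < r)"

text \<open>The signed value at the first letter exceeds its multiplicity minus 1, which is
  nonnegative, so \<open>c\<close> has a point of the right sign within \<open>r\<close> of it.
  Splitting off this point costs the bump at most 1 while the multiplicity drops by 1, so the
  hypothesis survives. Bumps at other points do not see it, their centres being at least
  \<open>2 * r\<close> away. As \<open>c\<close> is not longer than the word, nothing is left at the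
  end.\<close>

lemma bump_decomposition:
  assumes "r > 0" "Poly_Mapping.keys c \<subseteq> M" "frag_length c \<le> length L"
    and "\<And>s p. (s, p) \<in> set L \<Longrightarrow> (s = 1 \<or> s = -1) \<and> p \<in> M"
    and "\<And>s p s' q. (s, p) \<in> set L \<Longrightarrow> (s', q) \<in> set L \<Longrightarrow> (q = p \<longrightarrow> s' = s) \<and> (q \<noteq> p \<longrightarrow> 2 * r \<le> d p q)"
    and "\<And>s p. (s, p) \<in> set L \<Longrightarrow> of_int s * frag_eval (bump p r) c > real (count_list L (s, p)) - 1"
  shows "\<exists>L'. near r L L' \<and> signed_sum L' = c"
  using assms(2-)
proof (induction L arbitrary: c)
  case Nil
  then show ?case by (intro exI[of _ "[]"]) auto
next
  case (Cons a L)
  obtain s p where a: "a = (s, p)" by (cases a)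
  have sp: "s = 1 \<or> s = -1" "p \<in> M" using Cons.prems(3)[of s p] a by auto
  have "of_int s * frag_eval (bump p r) c > 0"
    using Cons.prems(5)[of s p] a by simp
  then obtain x where x: "x \<in> Poly_Mapping.keys c" "bump p r x > 0" "s * Poly_Mapping.lookup c x > 0"
    by (rule frag_eval_pos_witness[of "bump p r", OF bump_nonneg])
  then have xM: "x \<in> M" and dx: "d p x < r"
    using Cons.prems(1) \<open>r > 0\<close> by (auto simp: bump_pos_iff)
  let ?b = "c - frag_cmul s (frag_of x)"
  have len: "frag_length c = Suc (frag_length ?b)"
    by (rule frag_length_peel[OF sp(1) x(3)])
  have ss: "real_of_int s * real_of_int s = 1" using sp(1) by auto
  have "\<exists>L'. near r L L' \<and> signed_sum L' = ?b"
  proof (rule Cons.IH)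
    show "Poly_Mapping.keys ?b \<subseteq> M" using Cons.prems(1) xM by (rule keys_peel)
    show "frag_length ?b \<le> length L" using Cons.prems(2) len by simp
    show "(s = 1 \<or> s = -1) \<and> p \<in> M" if "(s, p) \<in> set L" for s p
      using Cons.prems(3)[of s p] that by simp
    show "(q = p \<longrightarrow> s' = s) \<and> (q \<noteq> p \<longrightarrow> 2 * r \<le> d p q)" if "(s, p) \<in> set L" "(s', q) \<in> set L" for s p s' q
      using Cons.prems(4)[of s p s' q] that by simp
    show "of_int s' * frag_eval (bump q r) ?b > real (count_list L (s', q)) - 1" if "(s', q) \<in> set L" for s' q
    proof (cases "q = p")
      case True
      then have "s' = s" using Cons.prems(4)[of s p s' q] that a by simp
      have "of_int s * frag_eval (bump p r) ?b = of_int s * frag_eval (bump p r) c - bump p r x"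
        using ss by (simp add: right_diff_distrib flip: mult.assoc)
      then show ?thesis
        using Cons.prems(5)[of s p] a bump_le_1[OF \<open>r > 0\<close>, of p x] True \<open>s' = s\<close> by simp
    next
      case False
      then have "2 * r \<le> d p q" "q \<in> M"
        using Cons.prems(4)[of s p s' q] Cons.prems(3)[of s' q] that a by simp_all
      then have "bump q r x = 0"
        using triangle[OF sp(2) xM, of q] dx commute[of q x] \<open>r > 0\<close> by (intro bump_eq_0) auto
      then show ?thesis
        using Cons.prems(5)[of s' q] that a False by simp
    qed
  qed
  then obtain L' where "near r L L'" "signed_sum L' = ?b" by blast
  then show ?case using a xM dx by (intro exI[of _ "(s, x) # L'"]) simp
qed

lemma limitin_add:
  assumes "limitin T s a F" "limitin T t b F"
  shows "limitin T (\<lambda>j. s j + t j) (a + b) F"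
proof -
  have "limitin (prod_topology T T) (\<lambda>j. (s j, t j)) (a, b) F"
    using assms by (simp add: limitin_pairwise o_def)
  from continuous_map_limit[OF continuous_add this] show ?thesis by (simp add: o_def)
qed

lemma limitin_uminus:
  assumes "limitin T s a F"
  shows "limitin T (\<lambda>j. - s j) (- a) F"
  using continuous_map_limit[OF continuous_uminus assms] by (simp add: o_def)

lemma limitin_diff:
  assumes "limitin T s a F" "limitin T t b F"
  shows "limitin T (\<lambda>j. s j - t j) (a - b) F"
  using limitin_add[OF assms(1) limitin_uminus[OF assms(2)]] by simp

lemma limitin_frag_of:
  assumes "limitin mtopology s a F"
  shows "limitin T (\<lambda>j. frag_of (s j)) (frag_of a) F"
  using continuous_map_limit[OF continuous_frag_of assms] by (simp add: o_def)

lemma limitin_mtopology_if: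
  assumes "a \<in> M" "\<And>j. s j \<in> M" "\<And>j. d a (s j) < inverse (real (Suc j))"
  shows "limitin mtopology s a sequentially"
proof -
  have "(\<lambda>j. d (s j) a) \<longlonglongrightarrow> 0"
    by (rule real_tendsto_sandwich[OF _ _ tendsto_const LIMSEQ_inverse_real_of_nat])
       (use assms(3) in \<open>auto intro!: always_eventually less_imp_le simp: commute\<close>)
  then show ?thesis
    using assms(1,2) by (simp add: limitin_metric_dist_null)
qed

lemma limitin_signed_sum:
  assumes "\<And>j. near (inverse (real (Suc j))) L (Ls j)"
    "\<And>s p. (s, p) \<in> set L \<Longrightarrow> (s = 1 \<or> s = -1) \<and> p \<in> M"
  shows "limitin T (\<lambda>j. signed_sum (Ls j)) (signed_sum L) sequentially"
  using assms
proof (induction L arbitrary: Ls)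
  case Nil
  then have "Ls j = []" for j by simp
  then show ?case by (simp add: limitin_const)
next
  case (Cons a L)
  obtain s p where a: "a = (s, p)" by (cases a)
  have sp: "s = 1 \<or> s = -1" "p \<in> M" using Cons.prems(2)[of s p] a by auto
  define q where "q j = snd (hd (Ls j))" for j
  define K where "K j = tl (Ls j)" for j
  have qK: "Ls j = (s, q j) # K j" "q j \<in> M" "d p (q j) < inverse (real (Suc j))"
      "near (inverse (real (Suc j))) L (K j)" for j
    using Cons.prems(1)[of j] a by (auto simp: list_all2_Cons1 q_def K_def)
  have "limitin T (\<lambda>j. frag_of (q j)) (frag_of p) sequentially"
    by (intro limitin_frag_of limitin_mtopology_if sp qK)
  then have "limitin T (\<lambda>j. frag_cmul s (frag_of (q j))) (frag_cmul s (frag_of p)) sequentially"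
    using sp(1) limitin_uminus by auto
  moreover have "limitin T (\<lambda>j. signed_sum (K j)) (signed_sum L) sequentially"
    by (rule Cons.IH[OF qK(4) Cons.prems(2)]) simp
  ultimately show ?case
    using limitin_add a qK(1) by simp
qed

end

lemma frag_decomposition_0:
  assumes c: "Poly_Mapping.keys c \<subseteq> S" "frag_length c \<le> 3" and eval: "\<bar>frag_eval (\<lambda>_. 1) c\<bar> < 1"
  shows "c = 0 \<or> (\<exists>x\<in>S. \<exists>y\<in>S. c = frag_of x - frag_of y)"
proof (cases "c = 0")
  case False
  obtain k where k: "frag_eval (\<lambda>_. 1) c = of_int (int (frag_length c) + 2 * k)"
    using frag_length_parity by blast
  then have "\<bar>int (frag_length c) + 2 * k\<bar> < 1"
    using eval by linarith
  \<comment> \<open>The coefficient sum is an integer of absolute value below 1, hence 0; so the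
    length is even.\<close>
  then have "frag_length c \<noteq> 3" and e0: "frag_eval (\<lambda>_. 1) c = 0"
    using k by presburger+
  then have len: "frag_length c \<le> 2" using c(2) by linarith
  from signed_sum_exists[of c] obtain L where L: "signed_sum L = c" "length L = frag_length c"
      "\<forall>(s, p)\<in>set L. (s = 1 \<or> s = -1) \<and> p \<in> Poly_Mapping.keys c \<and> s * Poly_Mapping.lookup c p > 0"
    by (elim exE conjE)
  then have "L \<noteq> []" using False by auto
  then obtain s x L1 where L1: "L = (s, x) # L1" by (metis list.exhaust surj_pair)
  show ?thesis
  proof (cases L1)
    case Nil
    then show ?thesis using L e0 L1 by auto
  next
    case (Cons a L2)
    then have "length L = Suc (Suc (length L2))" using L1 by simp
    then have "length L2 = 0" using L(2) len by linarith
    then have "L2 = []" by simp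
    then obtain t y where "L = [(s, x), (t, y)]"
      using L1 Cons by (cases a) simp
    with L(1,3) have "(s = 1 \<or> s = -1)" "(t = 1 \<or> t = -1)" "x \<in> S" "y \<in> S"
        "c = frag_cmul s (frag_of x) + frag_cmul t (frag_of y)"
      using c(1) by auto
    moreover from this(5) e0 have "s + t = 0" by (simp flip: of_int_add)
    ultimately have "c = frag_of x - frag_of y \<or> c = frag_of y - frag_of x" by auto
    then show ?thesis using \<open>x \<in> S\<close> \<open>y \<in> S\<close> by blast
  qed
qed simp

lemma frag_decomposition_1:
  assumes c: "Poly_Mapping.keys c \<subseteq> S" "frag_length c \<le> 3" and eval: "\<bar>frag_eval (\<lambda>_. 1) c - 1\<bar> < 1"
  shows "\<exists>x\<in>S. \<exists>y\<in>S. \<exists>z\<in>S. c = frag_of x + frag_of y - frag_of z"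
proof -
  have "of_int 1 * frag_eval (\<lambda>_. 1) c > 0" using eval by simp
  then obtain x where x: "x \<in> Poly_Mapping.keys c" "1 * Poly_Mapping.lookup c x > 0"
    by (rule frag_eval_pos_witness[of "\<lambda>_. 1", rotated]) simp_all
  have "frag_length c = Suc (frag_length (c - frag_cmul 1 (frag_of x)))"
    by (rule frag_length_peel) (use x(2) in auto)
  then have "frag_length (c - frag_of x) \<le> 3" using c(2) by simp
  moreover have "Poly_Mapping.keys (c - frag_of x) \<subseteq> S"
    using keys_peel[OF c(1), of x 1] x(1) c(1) by auto
  moreover have "\<bar>frag_eval (\<lambda>_. 1) (c - frag_of x)\<bar> < 1" using eval by simp
  ultimately consider "c - frag_of x = 0" | y z where "y \<in> S" "z \<in> S" "c - frag_of x = frag_of y - frag_of z"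
    using frag_decomposition_0 by metis
  then show ?thesis
  proof cases
    case 1
    \<comment> \<open>Here \<open>c\<close> is the single point \<open>x\<close>, written as x + x -
      x; the three points need not be distinct.\<close>
    then show ?thesis using x(1) c(1) by (intro bexI[of _ x]) auto
  next
    case 2
    then have "c = frag_of x + frag_of y - frag_of z" by (metis add_diff_eq diff_add_cancel add.commute)
    then show ?thesis using 2 x(1) c(1) by blast
  qed
qed

context free_metric begin

section \<open>Sequentially open subsets of \<open>A\<^sub>3(X)\<close>\<close>

text \<open>Asking for one index is as strong as asking for almost all of them, because the
  condition applies to subsequences as well.\<close>

definition seq_open :: "nat \<Rightarrow> ('a \<Rightarrow>\<^sub>0 int) set \<Rightarrow> bool" where
  "seq_open n W \<longleftrightarrow> (\<forall>s g. (\<forall>j. s j \<in> C \<and> frag_length (s j) \<le> n) \<longrightarrow> limitin T s g sequentially \<longrightarrow>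
     g \<in> W \<longrightarrow> (\<exists>j. s j \<in> W))"

lemma seq_open_mono: "seq_open n W \<Longrightarrow> m \<le> n \<Longrightarrow> seq_open m W"
  unfolding seq_open_def by (meson order_trans)

lemma seq_openD:
  "seq_open n W \<Longrightarrow> (\<And>j. Poly_Mapping.keys (s j) \<subseteq> M) \<Longrightarrow> (\<And>j. frag_length (s j) \<le> n) \<Longrightarrow>
    limitin T s g sequentially \<Longrightarrow> g \<in> W \<Longrightarrow> \<exists>j. s j \<in> W"
  unfolding seq_open_def by auto

lemma frag_length_triple: "frag_length (frag_of x + frag_of y - frag_of z) \<le> 3"
  using frag_length_add[of "frag_of x + frag_of y" "- frag_of z"] frag_length_add[of "frag_of x" "frag_of y"] by simp

lemma keys_triple:
  "x \<in> M \<Longrightarrow> y \<in> M \<Longrightarrow> z \<in> M \<Longrightarrow> Poly_Mapping.keys (frag_of x + frag_of y - frag_of z) \<subseteq> M"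
  using C_closed(2)[OF C_closed(1), of "frag_of x" "frag_of y" "frag_of z"] by (simp add: keys_frag_of)

lemma frag_length_pair: "frag_length (frag_of x - frag_of y) \<le> 2"
  using frag_length_add[of "frag_of x" "- frag_of y"] by simp

lemma keys_pair: "x \<in> M \<Longrightarrow> y \<in> M \<Longrightarrow> Poly_Mapping.keys (frag_of x - frag_of y) \<subseteq> M"
  using C_closed(2)[of "frag_of x" "frag_of y"] by (simp add: keys_frag_of)

text \<open>Otherwise perturbations of size \<open>1 / (j + 1)\<close> outside \<open>W\<close>
  would converge to the sum of \<open>L\<close>. The word \<open>L\<close> need not be reduced,
  which is exploited around \<open>x0\<close>.\<close>

lemma seq_open_near:
  assumes W: "seq_open n W" "signed_sum L \<in> W" "length L \<le> n"
    and L: "\<And>s p. (s, p) \<in> set L \<Longrightarrow> (s = 1 \<or> s = -1) \<and> p \<in> M"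
  shows "\<exists>r>0. \<forall>L'. near r L L' \<longrightarrow> signed_sum L' \<in> W"
proof (rule ccontr)
  assume "\<not> ?thesis"
  then have ex: "\<exists>L'. near r L L' \<and> signed_sum L' \<notin> W" if "r > 0" for r
    using that by simp
  define Ls where "Ls j = (SOME L'. near (inverse (real (Suc j))) L L' \<and> signed_sum L' \<notin> W)" for j
  have Ls: "near (inverse (real (Suc j))) L (Ls j)" "signed_sum (Ls j) \<notin> W" for j
    using someI_ex[OF ex[of "inverse (real (Suc j))"]] unfolding Ls_def by simp_all
  have el: "(s = 1 \<or> s = -1) \<and> p \<in> M" if sp: "(s, p) \<in> set (Ls j)" for s p j
  proof -
    obtain k where k: "k < length (Ls j)" "Ls j ! k = (s, p)"
      using sp by (meson in_set_conv_nth)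
    obtain s' p' where L': "L ! k = (s', p')" by fastforce
    have "s = s' \<and> p \<in> M"
      using list_all2_nthD2[OF Ls(1) k(1)] k(2) L' by simp
    moreover have "(s', p') \<in> set L"
      using L' k(1) Ls(1)[THEN list_all2_lengthD] by (metis nth_mem)
    ultimately show ?thesis using L by blast
  qed
  have "\<exists>j. signed_sum (Ls j) \<in> W"
  proof (rule seq_openD[OF W(1) _ _ limitin_signed_sum[OF Ls(1) L] W(2)])
    show "Poly_Mapping.keys (signed_sum (Ls j)) \<subseteq> M" for j
      using el by (intro keys_signed_sum) blast
    show "frag_length (signed_sum (Ls j)) \<le> n" for j
    proof -
      have "frag_length (signed_sum (Ls j)) \<le> length (Ls j)"
        using el by (intro frag_length_signed_sum) blast
      then show ?thesis
        using Ls(1)[THEN list_all2_lengthD, of j] W(3) by simp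
    qed
  qed
  then show False using Ls(2) by blast
qed

lemma finite_separation:
  assumes "finite S" "S \<subseteq> M"
  shows "\<exists>r>0. \<forall>p\<in>S. \<forall>q\<in>S. p \<noteq> q \<longrightarrow> 2 * r \<le> d p q"
proof (intro exI conjI ballI impI)
  \<comment> \<open>The 1 provides a minimum for sets with fewer than two points.\<close>
  define D where "D = insert 1 ((\<lambda>(p, q). d p q / 2) ` {(p, q) \<in> S \<times> S. p \<noteq> q})"
  have "finite {(p, q) \<in> S \<times> S. p \<noteq> q}"
    by (rule finite_subset[of _ "S \<times> S"]) (use assms(1) in auto)
  then have fin: "finite D" by (simp add: D_def)
  show "Min D > 0"
  proof (subst Min_gr_iff)
    show "\<forall>a\<in>D. 0 < a"
      using assms(2) by (auto simp: D_def subset_iff intro!: mdist_pos_less)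
  qed (use fin in \<open>auto simp: D_def\<close>)
  show "2 * Min D \<le> d p q" if "p \<in> S" "q \<in> S" "p \<noteq> q" for p q
  proof -
    have "d p q / 2 \<in> D" using that by (force simp: D_def)
    then have "Min D \<le> d p q / 2" using fin by (rule Min_le[rotated])
    then show ?thesis by simp
  qed
qed

lemma near_mono: "near r L L' \<Longrightarrow> r \<le> r' \<Longrightarrow> near r' L L'"
  by (erule list_all2_mono) auto

text \<open>The bumps at the letters of the reduced word of \<open>g\<close> already account for
  \<open>n\<close> letters of a neighbour \<open>c\<close>. Since \<open>c\<close> has no more than
  that, it is this word moved letter by letter, without room for an additional pair that nearly
  cancels.\<close>

lemma seq_open_nbhd_full_length:
  assumes W: "seq_open n W" "g \<in> W" and g: "Poly_Mapping.keys g \<subseteq> M" "frag_length g = n"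
  shows "\<exists>N. continuous_seminorm N \<and>
    (\<forall>c. Poly_Mapping.keys c \<subseteq> M \<longrightarrow> frag_length c \<le> n \<longrightarrow> N (c - g) < 1 \<longrightarrow> c \<in> W)"
proof -
  from signed_sum_exists[of g] obtain L where L: "signed_sum L = g" "length L = frag_length g"
      "\<forall>(s, p)\<in>set L. (s = 1 \<or> s = -1) \<and> p \<in> Poly_Mapping.keys g \<and> s * Poly_Mapping.lookup g p > 0"
    by (elim exE conjE)
  have L1: "(s = 1 \<or> s = -1) \<and> p \<in> M" if "(s, p) \<in> set L" for s p
    using L(3) g(1) that by auto
  have L2: "s' = s" if "(s, p) \<in> set L" "(s', p) \<in> set L" for s s' p
    using bspec[OF L(3) that(1)] bspec[OF L(3) that(2)] by auto
  have "\<exists>r>0. \<forall>L'. near r L L' \<longrightarrow> signed_sum L' \<in> W"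
    by (rule seq_open_near[OF W(1) _ _ L1]) (simp_all add: L(1,2) W(2) g(2))
  then obtain r1 where r1: "r1 > 0" "\<forall>L'. near r1 L L' \<longrightarrow> signed_sum L' \<in> W"
    by (elim exE conjE)
  have S: "finite (snd ` set L)" "snd ` set L \<subseteq> M"
    using L1 by auto
  from finite_separation[OF S] obtain r2
    where r2: "r2 > 0" "\<forall>p\<in>snd ` set L. \<forall>q\<in>snd ` set L. p \<noteq> q \<longrightarrow> 2 * r2 \<le> d p q"
    by (elim exE conjE)
  define r where "r = min r1 r2"
  have r: "r > 0" "r \<le> r1" "r \<le> r2" using r1(1) r2(1) by (auto simp: r_def)
  have sep: "2 * r \<le> d p q" if "(s, p) \<in> set L" "(s', q) \<in> set L" "q \<noteq> p" for s s' p q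
  proof -
    have "2 * r2 \<le> d p q" using that by (intro r2(2)[rule_format]) force+
    then show ?thesis using r(3) by simp
  qed
  have "\<exists>N. continuous_seminorm N \<and> (\<forall>p\<in>snd ` set L. \<forall>c. \<bar>frag_eval (bump p r) c\<bar> \<le> N c)"
    using S r(1) by (intro continuous_seminorm_finite_bound continuous_seminorm_bump) auto
  then obtain N where N: "continuous_seminorm N" "\<And>p c. p \<in> snd ` set L \<Longrightarrow> \<bar>frag_eval (bump p r) c\<bar> \<le> N c"
    by blast
  have "c \<in> W" if c: "Poly_Mapping.keys c \<subseteq> M" "frag_length c \<le> n" "N (c - g) < 1" for c
  proof -
    have "\<exists>L'. near r L L' \<and> signed_sum L' = c"
    proof (rule bump_decomposition[OF r(1) c(1) _ L1])
      show "frag_length c \<le> length L" using c(2) L(2) g(2) by simp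
      show "(q = p \<longrightarrow> s' = s) \<and> (q \<noteq> p \<longrightarrow> 2 * r \<le> d p q)"
        if "(s, p) \<in> set L" "(s', q) \<in> set L" for s p s' q
        using that L2 sep by blast
      fix s p assume sp: "(s, p) \<in> set L"
      have s: "s = 1 \<or> s = -1" and p: "p \<in> M" using L1[OF sp] by auto
      \<comment> \<open>At \<open>g\<close> the signed value equals the multiplicity, so a deviation
        below 1 is exactly the slack that \<open>bump_decomposition\<close> allows.\<close>
      have "of_int s * frag_eval (bump p r) (signed_sum L) = count_list L (s, p)"
      proof (rule frag_eval_signed_sum_count)
        show "\<forall>(s', q)\<in>set L. (q = p \<longrightarrow> s' = s) \<and> (q \<noteq> p \<longrightarrow> bump p r q = 0)"
        proof clarify
          fix s' q assume q: "(s', q) \<in> set L"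
          have "bump p r q = 0" if "q \<noteq> p"
            using sep[OF sp q that] r(1) by (intro bump_eq_0) auto
          then show "(q = p \<longrightarrow> s' = s) \<and> (q \<noteq> p \<longrightarrow> bump p r q = 0)" using L2 sp q by blast
        qed
      qed (use s p in auto)
      moreover have "p \<in> snd ` set L" using sp by force
      then have "\<bar>frag_eval (bump p r) (c - g)\<bar> < 1"
        using N(2)[of p "c - g"] c(3) by simp
      ultimately show "of_int s * frag_eval (bump p r) c > real (count_list L (s, p)) - 1"
        using s L(1) by auto
    qed
    then show ?thesis using r1(2) near_mono[OF _ r(2)] by blast
  qed
  then show ?thesis using N(1) by blast
qed


section \<open>Neighbourhoods of elements of length at most 1\<close>

lemma diagonal_nbhdI:
  assumes w: "w \<in> M"
    and P: "\<And>y z. (\<And>j. y j \<in> M) \<Longrightarrow> (\<And>j. z j \<in> M) \<Longrightarrow> limitin mtopology y w sequentially \<Longrightarrow>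
       limitin mtopology z w sequentially \<Longrightarrow> \<exists>j. P (y j) (z j)"
  shows "\<exists>e>0. \<forall>y\<in>M. \<forall>z\<in>M. d w y < e \<longrightarrow> d w z < e \<longrightarrow> P y z"
proof (rule ccontr)
  assume "\<not> ?thesis"
  then have ex: "\<exists>y z. y \<in> M \<and> z \<in> M \<and> d w y < e \<and> d w z < e \<and> \<not> P y z" if "e > 0" for e
    using that by meson
  have "\<forall>j. \<exists>p. fst p \<in> M \<and> snd p \<in> M \<and> d w (fst p) < inverse (real (Suc j)) \<and>
      d w (snd p) < inverse (real (Suc j)) \<and> \<not> P (fst p) (snd p)"
    using ex[of "inverse (real (Suc j))" for j] by simp
  then obtain p where p: "\<And>j. fst (p j) \<in> M" "\<And>j. snd (p j) \<in> M" "\<And>j. d w (fst (p j)) < inverse (real (Suc j))"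
      "\<And>j. d w (snd (p j)) < inverse (real (Suc j))" "\<And>j. \<not> P (fst (p j)) (snd (p j))"
    by metis
  have "\<exists>j. P (fst (p j)) (snd (p j))"
    by (intro P limitin_mtopology_if w p)
  then show False using p(5) by blast
qed

lemma seq_open_frag_of:
  assumes "seq_open 3 W" "frag_of x \<in> W" "x \<in> M"
  shows "\<exists>r>0. \<forall>y\<in>M. d x y < r \<longrightarrow> frag_of y \<in> W"
proof -
  \<comment> \<open>The point \<open>z\<close> is a dummy, later set to \<open>x\<close>, so that
    the criterion for pairs applies to a single sequence.\<close>
  have "\<exists>e>0. \<forall>y\<in>M. \<forall>z\<in>M. d x y < e \<longrightarrow> d x z < e \<longrightarrow> frag_of y \<in> W"
  proof (rule diagonal_nbhdI[OF assms(3)])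
    fix y :: "nat \<Rightarrow> 'a" assume y: "\<And>j. y j \<in> M" "limitin mtopology y x sequentially"
    show "\<exists>j. frag_of (y j) \<in> W"
      by (rule seq_openD[OF assms(1) _ _ limitin_frag_of[OF y(2)] assms(2)]) (use y(1) in \<open>auto simp: keys_frag_of\<close>)
  qed
  then show ?thesis
    using assms(3) by (metis mdist_zero)
qed

text \<open>The constant 1 forces a neighbour of 0 into the form x - y. On it the bump centred at y
  takes the value \<open>\<phi> y x - 1\<close>, so closeness to 0 gives
  \<open>\<phi> y x > 0\<close>, and the pair lies in the prescribed neighbourhood of the diagonal.
  As y is not known in advance, one seminorm has to control the bumps at all points.\<close>

lemma seq_open_nbhd_0:
  assumes W: "seq_open 3 W" "0 \<in> W"
  shows "\<exists>N. continuous_seminorm N \<and>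
    (\<forall>c. Poly_Mapping.keys c \<subseteq> M \<longrightarrow> frag_length c \<le> 3 \<longrightarrow> N (c - 0) < 1 \<longrightarrow> c \<in> W)"
proof -
  have "\<forall>w\<in>M. \<exists>e>0. \<forall>y\<in>M. \<forall>z\<in>M. d w y < e \<longrightarrow> d w z < e \<longrightarrow> frag_of y - frag_of z \<in> W"
  proof (intro ballI diagonal_nbhdI)
    fix w
    fix y z :: "nat \<Rightarrow> 'a"
    assume yz: "\<And>j. y j \<in> M" "\<And>j. z j \<in> M" "limitin mtopology y w sequentially" "limitin mtopology z w sequentially"
    have "limitin T (\<lambda>j. frag_of (y j) - frag_of (z j)) (frag_of w - frag_of w) sequentially"
      by (intro limitin_diff limitin_frag_of yz)
    then show "\<exists>j. frag_of (y j) - frag_of (z j) \<in> W"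
      using W(2) keys_pair[OF yz(1,2)] frag_length_pair
      by (intro seq_openD[OF seq_open_mono[OF W(1), of 2]]) auto
  qed
  from diagonal_bumps[of "\<lambda>x w. frag_of x - frag_of w \<in> W", OF this] obtain \<phi> N where \<phi>N: "continuous_seminorm N" "\<forall>w\<in>M. \<phi> w w = (1::real) \<and>
      (\<forall>x. 0 \<le> \<phi> w x) \<and> (\<forall>x\<in>M. \<phi> w x > 0 \<longrightarrow> frag_of x - frag_of w \<in> W) \<and> (\<forall>c. \<bar>frag_eval (\<phi> w) c\<bar> \<le> N c)"
    by (elim exE conjE)
  have N: "\<phi> w w = 1" "\<phi> w x \<ge> 0" "\<bar>frag_eval (\<phi> w) c\<bar> \<le> N c" if "w \<in> M" for w x c
    using \<phi>N(2) that by simp_all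
  have NP: "frag_of x - frag_of w \<in> W" if "w \<in> M" "x \<in> M" "\<phi> w x > 0" for w x
    using \<phi>N(2) that by simp
  define N' where "N' = (\<lambda>c. max (N c) \<bar>frag_eval (\<lambda>_. 1) c\<bar>)"
  have "continuous_seminorm N'"
    unfolding N'_def by (intro continuous_seminorm_max \<phi>N(1) continuous_seminorm_frag_eval) simp
  moreover have "c \<in> W" if c: "Poly_Mapping.keys c \<subseteq> M" "frag_length c \<le> 3" "N' (c - 0) < 1" for c
  proof -
    have "\<bar>frag_eval (\<lambda>_. 1) c\<bar> < 1" using c(3) by (simp add: N'_def)
    then consider "c = 0" | x y where "x \<in> M" "y \<in> M" "c = frag_of x - frag_of y"
      using frag_decomposition_0[OF c(1,2)] by blast
    then show ?thesis
    proof cases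
      case 2
      have "\<bar>frag_eval (\<phi> y) c\<bar> < 1" using N(3)[OF 2(2), of c] c(3) by (simp add: N'_def)
      then have "\<phi> y x > 0" using 2 N(1)[OF 2(2)] by simp
      then show ?thesis using NP 2 by simp
    qed (use W(2) in simp)
  qed
  ultimately show ?thesis by blast
qed

text \<open>The radius around \<open>x0\<close> does not depend on \<open>w\<close>: this is where condition (3) enters.\<close>

definition tube :: "('a \<Rightarrow>\<^sub>0 int) set \<Rightarrow> 'a \<Rightarrow> bool" where
  "tube W x0 \<longleftrightarrow> (\<exists>r>0. \<forall>w\<in>M. \<exists>e>0. \<forall>y\<in>M. \<forall>z\<in>M. d w y < e \<longrightarrow> d w z < e \<longrightarrow>
     (\<forall>x\<in>M. d x0 x < r \<longrightarrow> frag_of x + frag_of y - frag_of z \<in> W))"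

text \<open>In x + y - z with x near \<open>x0\<close>, the bump at z is meant to detect y, but it
  may see x or \<open>x0\<close> instead if z is close to them. Hence two cases: if z is near
  \<open>x0\<close>, then so is y, and a small perturbation of x0 + x0 - x0 stays in
  \<open>W\<close>; if z is far from \<open>x0\<close>, its bump sees only y, and the tube
  applies.\<close>

lemma seq_open_nbhd_frag_of:
  assumes W: "seq_open 3 W" "frag_of x0 \<in> W" and x0: "x0 \<in> M" and "tube W x0"
  shows "\<exists>N. continuous_seminorm N \<and>
    (\<forall>c. Poly_Mapping.keys c \<subseteq> M \<longrightarrow> frag_length c \<le> 3 \<longrightarrow> N (c - frag_of x0) < 1 \<longrightarrow> c \<in> W)"
proof -
  obtain r where r: "r > 0" "\<And>w. w \<in> M \<Longrightarrow> \<exists>e>0. \<forall>y\<in>M. \<forall>z\<in>M. d w y < e \<longrightarrow> d w z < e \<longrightarrow>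
     (\<forall>x\<in>M. d x0 x < r \<longrightarrow> frag_of x + frag_of y - frag_of z \<in> W)"
    using \<open>tube W x0\<close> unfolding tube_def by metis
  \<comment> \<open>This word for \<open>x0\<close> is deliberately unreduced, so that its three
    letters can move independently.\<close>
  let ?L = "[(1::int, x0), (1, x0), (-1, x0)]"
  have "\<exists>r>0. \<forall>L'. near r ?L L' \<longrightarrow> signed_sum L' \<in> W"
    by (rule seq_open_near[OF W(1)]) (use W(2) x0 in auto)
  then obtain R where R: "R > 0" "\<forall>L'. near R ?L L' \<longrightarrow> signed_sum L' \<in> W"
    by (elim exE conjE)
  have RW: "frag_of x + frag_of y - frag_of z \<in> W"
    if "x \<in> M" "y \<in> M" "z \<in> M" "d x0 x < R" "d x0 y < R" "d x0 z < R" for x y z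
    using R(2)[rule_format, of "[(1, x), (1, y), (-1, z)]"] that by (simp add: add_diff_eq)
  \<comment> \<open>The bound by \<open>r\<close> places x in the tube; \<open>4 * \<rho>\<close>
    \<le> \<open>R\<close> leaves room for y when z is near \<open>x0\<close>.\<close>
  define \<rho> where "\<rho> = min r (R / 4)"
  have \<rho>: "\<rho> > 0" "\<rho> \<le> r" "4 * \<rho> \<le> R" using r(1) R(1) by (auto simp: \<rho>_def)
  \<comment> \<open>The last clause confines the bump at z to distance \<open>\<rho>\<close> from z.
    It therefore misses x and \<open>x0\<close> once z is at distance at least
    \<open>2 * \<rho>\<close> from \<open>x0\<close>.\<close>
  define P where "P y z \<longleftrightarrow> (\<forall>x\<in>M. d x0 x < r \<longrightarrow> frag_of x + frag_of y - frag_of z \<in> W) \<and> d y z < \<rho>" for y z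
  have "\<forall>w\<in>M. \<exists>e>0. \<forall>y\<in>M. \<forall>z\<in>M. d w y < e \<longrightarrow> d w z < e \<longrightarrow> P y z"
  proof
    fix w assume w: "w \<in> M"
    from r(2)[OF w] obtain e where e: "e > 0" "\<forall>y\<in>M. \<forall>z\<in>M. d w y < e \<longrightarrow> d w z < e \<longrightarrow>
        (\<forall>x\<in>M. d x0 x < r \<longrightarrow> frag_of x + frag_of y - frag_of z \<in> W)"
      by (elim exE conjE)
    have "P y z" if yz: "y \<in> M" "z \<in> M" "d w y < min e (\<rho> / 2)" "d w z < min e (\<rho> / 2)" for y z
    proof -
      have "d y z < \<rho>" using triangle[OF yz(1) w yz(2)] yz(3,4) commute[of y w] by simp
      then show ?thesis unfolding P_def using e(2) yz by simp
    qed
    then show "\<exists>e>0. \<forall>y\<in>M. \<forall>z\<in>M. d w y < e \<longrightarrow> d w z < e \<longrightarrow> P y z"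
      using e(1) \<rho>(1) by (intro exI[of _ "min e (\<rho> / 2)"]) simp
  qed
  from diagonal_bumps[of P, OF this] obtain \<phi> N where \<phi>N: "continuous_seminorm N" "\<forall>w\<in>M. \<phi> w w = (1::real) \<and>
      (\<forall>x. 0 \<le> \<phi> w x) \<and> (\<forall>x\<in>M. \<phi> w x > 0 \<longrightarrow> P x w) \<and> (\<forall>c. \<bar>frag_eval (\<phi> w) c\<bar> \<le> N c)"
    by (elim exE conjE)
  have N: "\<phi> w w = 1" "\<phi> w x \<ge> 0" "\<bar>frag_eval (\<phi> w) c\<bar> \<le> N c" if "w \<in> M" for w x c
    using \<phi>N(2) that by simp_all
  have NP: "P x w" if "w \<in> M" "x \<in> M" "\<phi> w x > 0" for w x
    using \<phi>N(2) that by simp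
  define \<beta> where "\<beta> = bump x0 \<rho>"
  \<comment> \<open>This is 1 up to distance \<open>2 * \<rho>\<close> from \<open>x0\<close> and 0
    from \<open>4 * \<rho>\<close> on. With x, z and \<open>x0\<close> on the plateau its value at
    \<open>c - frag_of x0\<close> is \<open>\<gamma> y - 1\<close>, which forces y into the larger
    ball.\<close>
  define \<gamma> where "\<gamma> = (\<lambda>x. min 1 (2 * bump x0 (4 * \<rho>) x))"
  define N' where "N' = (\<lambda>c. max (max (N c) \<bar>frag_eval (\<lambda>_. 1) c\<bar>) (max \<bar>frag_eval \<beta> c\<bar> \<bar>frag_eval \<gamma> c\<bar>))"
  have "continuous_map mtopology euclideanreal (bump x0 (4 * \<rho>))"
    using x0 \<rho>(1) by (intro continuous_bump) auto
  then have "continuous_map mtopology euclideanreal (\<lambda>x. 2 * bump x0 (4 * \<rho>) x)"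
    by (rule continuous_map_real_mult_left)
  then have "continuous_map mtopology euclideanreal \<gamma>"
    unfolding \<gamma>_def by (rule continuous_map_real_min[rotated]) simp
  then have "continuous_seminorm (\<lambda>c. \<bar>frag_eval \<gamma> c\<bar>)"
    by (rule continuous_seminorm_frag_eval)
  moreover have "continuous_seminorm (\<lambda>c. \<bar>frag_eval \<beta> c\<bar>)"
    unfolding \<beta>_def by (rule continuous_seminorm_bump[OF x0 \<rho>(1)])
  moreover have "continuous_seminorm (\<lambda>c. \<bar>frag_eval (\<lambda>_. 1) c\<bar>)"
    by (rule continuous_seminorm_frag_eval) simp
  ultimately have "continuous_seminorm N'"
    unfolding N'_def by (intro continuous_seminorm_max \<phi>N(1))
  moreover have "c \<in> W" if c: "Poly_Mapping.keys c \<subseteq> M" "frag_length c \<le> 3" "N' (c - frag_of x0) < 1" for c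
  proof -
    have ev: "N (c - frag_of x0) < 1" "\<bar>frag_eval (\<lambda>_. 1) (c - frag_of x0)\<bar> < 1"
        "\<bar>frag_eval \<beta> (c - frag_of x0)\<bar> < 1" "\<bar>frag_eval \<gamma> (c - frag_of x0)\<bar> < 1"
      using c(3) by (simp_all add: N'_def)
    have "\<bar>frag_eval (\<lambda>_. 1) c - 1\<bar> < 1" using ev(2) by simp
    then obtain u v z where uvz: "u \<in> M" "v \<in> M" "z \<in> M" "c = frag_of u + frag_of v - frag_of z"
      using frag_decomposition_1[OF c(1,2)] by blast
    \<comment> \<open>Otherwise the value of \<open>\<beta>\<close> at \<open>c - frag_of x0\<close>
      would be at most -1.\<close>
    have "\<beta> u > 0 \<or> \<beta> v > 0"
    proof (rule ccontr)
      assume "\<not> (\<beta> u > 0 \<or> \<beta> v > 0)"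
      moreover have "\<beta> x0 = 1" "\<beta> z \<ge> 0" using x0 by (simp_all add: \<beta>_def)
      ultimately show False using ev(3) uvz(4) by simp
    qed
    then obtain x y where xy: "x \<in> M" "y \<in> M" "\<beta> x > 0" and ceq: "c = frag_of x + frag_of y - frag_of z"
      using uvz by (metis add.commute)
    have dx: "d x0 x < \<rho>" using xy(3) \<rho>(1) by (simp add: \<beta>_def bump_pos_iff)
    have \<gamma>1: "\<gamma> p = 1" if "d x0 p < 2 * \<rho>" for p
    proof -
      have "d x0 p / (4 * \<rho>) \<le> 1 / 2" using that \<rho>(1) by (simp add: field_simps)
      then show ?thesis by (simp add: \<gamma>_def bump_def)
    qed
    show "c \<in> W"
    proof (cases "d x0 z < 2 * \<rho>")
      case True
      have "\<gamma> x = 1" "\<gamma> z = 1" "\<gamma> x0 = 1" using \<gamma>1 dx True x0 \<rho>(1) by simp_all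
      then have "\<gamma> y > 0" using ev(4) ceq by simp
      then have "bump x0 (4 * \<rho>) y > 0" by (simp add: \<gamma>_def)
      then have "d x0 y < 4 * \<rho>" using \<rho>(1) by (simp add: bump_pos_iff)
      then show ?thesis
        unfolding ceq using xy uvz(3) dx True \<rho> by (intro RW) simp_all
    next
      case False
      have far: "\<phi> z p = 0" if "p \<in> M" "d x0 p < \<rho>" for p
      proof (rule ccontr)
        assume "\<phi> z p \<noteq> 0"
        then have "P p z" using NP[OF uvz(3) that(1)] N(2)[OF uvz(3), of p] by simp
        then show False
          using triangle[OF x0 that(1) uvz(3)] that(2) False unfolding P_def by linarith
      qed
      have "\<bar>frag_eval (\<phi> z) (c - frag_of x0)\<bar> < 1"
        using N(3)[OF uvz(3), of "c - frag_of x0"] ev(1) by simp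
      then have "\<phi> z y > 0"
        using far[OF xy(1) dx] far[OF x0] x0 \<rho>(1) N(1)[OF uvz(3)] ceq by simp
      then have "P y z" using NP[OF uvz(3) xy(2)] by simp
      then show ?thesis unfolding P_def ceq using xy(1) dx \<rho>(2) by simp
    qed
  qed
  ultimately show ?thesis by blast
qed

text \<open>The radius is fixed before \<open>w\<close>. If it failed at some \<open>w\<close>, the
  points x of a sequence of counterexamples would stay in a compact ball and accumulate at some
  \<open>l\<close> there. The pairs cancel in the limit, which is \<open>frag_of l\<close> and lies
  in \<open>W\<close>.\<close>

lemma tube_locally_compact:
  assumes "locally_compact_space mtopology" and W: "seq_open 3 W" "frag_of x0 \<in> W" and x0: "x0 \<in> M"
  shows "tube W x0"
proof -
  obtain U K where UK: "openin mtopology U" "compactin mtopology K" "x0 \<in> U" "U \<subseteq> K"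
    using assms(1) x0 unfolding locally_compact_space_def by (metis topspace_mtopology)
  obtain r2 where r2: "r2 > 0" "mball x0 r2 \<subseteq> U"
    using UK(1,3) unfolding openin_mtopology by meson
  obtain r1 where r1: "r1 > 0" "\<forall>y\<in>M. d x0 y < r1 \<longrightarrow> frag_of y \<in> W"
    using seq_open_frag_of[OF W x0] by meson
  \<comment> \<open>Halving is needed because limits of points of the open ball lie only in the
    closed one.\<close>
  define r where "r = min r1 r2 / 2"
  have r: "r > 0" "r < r1" "r < r2" using r1(1) r2(1) by (auto simp: r_def)
  let ?K = "mcball x0 r \<inter> K"
  have cK: "compactin mtopology ?K"
    by (intro closed_Int_compactin UK(2)) simp
  have "\<exists>e>0. \<forall>y\<in>M. \<forall>z\<in>M. d w y < e \<longrightarrow> d w z < e \<longrightarrow>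
     (\<forall>x\<in>M. d x0 x < r \<longrightarrow> frag_of x + frag_of y - frag_of z \<in> W)" if w: "w \<in> M" for w
  proof (rule diagonal_nbhdI[OF w])
    fix y z :: "nat \<Rightarrow> 'a"
    assume yz: "\<And>j. y j \<in> M" "\<And>j. z j \<in> M" "limitin mtopology y w sequentially" "limitin mtopology z w sequentially"
    show "\<exists>j. \<forall>x\<in>M. d x0 x < r \<longrightarrow> frag_of x + frag_of (y j) - frag_of (z j) \<in> W"
    proof (rule ccontr)
      assume "\<not> ?thesis"
      then obtain x where x: "\<And>j. x j \<in> M" "\<And>j. d x0 (x j) < r" "\<And>j. frag_of (x j) + frag_of (y j) - frag_of (z j) \<notin> W"
        by metis
      have "x j \<in> ?K" for j
        using x(1,2)[of j] x0 r(3) r2(2) UK(4) by (auto simp: subset_iff)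
      then have "range x \<subseteq> ?K" by blast
      then obtain l \<sigma> where l: "l \<in> ?K" "strict_mono \<sigma>" "limitin mtopology (x \<circ> \<sigma>) l sequentially"
        using cK unfolding compactin_sequentially by meson
      have lim: "limitin T (\<lambda>j. frag_of ((x \<circ> \<sigma>) j) + frag_of ((y \<circ> \<sigma>) j) - frag_of ((z \<circ> \<sigma>) j))
          (frag_of l + frag_of w - frag_of w) sequentially"
        by (intro limitin_diff limitin_add limitin_frag_of l(3) limitin_subsequence[OF l(2)] yz)
      have "frag_of l + frag_of w - frag_of w \<in> W"
        using r1(2) l(1) r(2) by simp
      then have "\<exists>j. frag_of ((x \<circ> \<sigma>) j) + frag_of ((y \<circ> \<sigma>) j) - frag_of ((z \<circ> \<sigma>) j) \<in> W"
        using x(1) yz(1,2) frag_length_triple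
        by (intro seq_openD[OF W(1) _ _ lim] keys_triple) simp_all
      then show False using x(3) by auto
    qed
  qed
  then show ?thesis using r(1) unfolding tube_def by blast
qed

text \<open>Compactness is applied to \<open>w\<close> instead of x: one \<open>e\<close> serves for
  all non-isolated \<open>w\<close> and at the same time as a radius around \<open>x0\<close>. At an
  isolated \<open>w\<close> a small ball forces y = z = w, so the pair cancels exactly and only x is
  left.\<close>

lemma tube_compact_non_isolated:
  assumes NI: "compactin mtopology (non_isolated_points mtopology)"
    and W: "seq_open 3 W" "frag_of x0 \<in> W" and x0: "x0 \<in> M"
  shows "tube W x0"
proof -
  let ?A = "non_isolated_points mtopology"
  have AM: "w \<in> M" if "w \<in> ?A" for w using that by (simp add: non_isolated_points_def)
  obtain r1 where r1: "r1 > 0" "\<forall>y\<in>M. d x0 y < r1 \<longrightarrow> frag_of y \<in> W"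
    using seq_open_frag_of[OF W x0] by meson
  have "\<exists>e>0. \<forall>w\<in>?A. \<forall>y\<in>M. \<forall>z\<in>M. \<forall>x\<in>M. d w y < e \<longrightarrow> d w z < e \<longrightarrow> d x0 x < e \<longrightarrow>
      frag_of x + frag_of y - frag_of z \<in> W"
  proof (rule ccontr)
    assume "\<not> ?thesis"
    then have ex: "\<exists>w y z x. w \<in> ?A \<and> y \<in> M \<and> z \<in> M \<and> x \<in> M \<and> d w y < e \<and> d w z < e \<and> d x0 x < e \<and>
        frag_of x + frag_of y - frag_of z \<notin> W" if "e > 0" for e
      using that by meson
    have "\<forall>j. \<exists>w y z x. w \<in> ?A \<and> y \<in> M \<and> z \<in> M \<and> x \<in> M \<and> d w y < inverse (real (Suc j)) \<and>
        d w z < inverse (real (Suc j)) \<and> d x0 x < inverse (real (Suc j)) \<and>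
        frag_of x + frag_of y - frag_of z \<notin> W"
      by (intro allI ex) simp
    then obtain w y z x where s: "\<And>j. w j \<in> ?A" "\<And>j. y j \<in> M" "\<And>j. z j \<in> M" "\<And>j. x j \<in> M"
        "\<And>j. d (w j) (y j) < inverse (real (Suc j))" "\<And>j. d (w j) (z j) < inverse (real (Suc j))"
        "\<And>j. d x0 (x j) < inverse (real (Suc j))" "\<And>j. frag_of (x j) + frag_of (y j) - frag_of (z j) \<notin> W"
      by metis
    have "range w \<subseteq> ?A" using s(1) by blast
    then obtain l \<sigma> where l: "l \<in> ?A" "strict_mono \<sigma>" "limitin mtopology (w \<circ> \<sigma>) l sequentially"
      using NI unfolding compactin_sequentially by meson
    \<comment> \<open>The sequences \<open>y\<close> and \<open>z\<close> stay within
      \<open>1 / (j + 1)\<close> of the varying \<open>w\<close>, so they inherit its limit along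
      the subsequence.\<close>
    have close: "limitin mtopology (u \<circ> \<sigma>) l sequentially"
      if u: "\<And>j. u j \<in> M" "\<And>j. d (w j) (u j) < inverse (real (Suc j))" for u
    proof -
      have "(\<lambda>j. d ((w \<circ> \<sigma>) j) l) \<longlonglongrightarrow> 0"
        using l(3) by (simp add: limitin_metric_dist_null)
      moreover have "(\<lambda>j. inverse (real (Suc (\<sigma> j)))) \<longlonglongrightarrow> 0"
        using LIMSEQ_subseq_LIMSEQ[OF LIMSEQ_inverse_real_of_nat l(2)] by (simp add: o_def)
      ultimately have lim0: "(\<lambda>j. d ((w \<circ> \<sigma>) j) l + inverse (real (Suc (\<sigma> j)))) \<longlonglongrightarrow> 0"
        using tendsto_add[of "\<lambda>j. d ((w \<circ> \<sigma>) j) l" 0] by fastforce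
      have "d ((u \<circ> \<sigma>) j) l \<le> d ((w \<circ> \<sigma>) j) l + inverse (real (Suc (\<sigma> j)))" for j
        using triangle[OF u(1)[of "\<sigma> j"] AM[OF s(1)[of "\<sigma> j"]] AM[OF l(1)]] u(2)[of "\<sigma> j"]
        by (simp add: commute[of "u (\<sigma> j)"])
      then have "(\<lambda>j. d ((u \<circ> \<sigma>) j) l) \<longlonglongrightarrow> 0"
        by (intro tendsto_sandwich[OF always_eventually always_eventually tendsto_const lim0]) simp_all
      then show ?thesis using u(1) AM[OF l(1)] by (simp add: limitin_metric_dist_null)
    qed
    have x: "limitin mtopology (x \<circ> \<sigma>) x0 sequentially"
      by (intro limitin_subsequence[OF l(2)] limitin_mtopology_if s x0)
    have lim: "limitin T (\<lambda>j. frag_of ((x \<circ> \<sigma>) j) + frag_of ((y \<circ> \<sigma>) j) - frag_of ((z \<circ> \<sigma>) j))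
        (frag_of x0 + frag_of l - frag_of l) sequentially"
      by (intro limitin_diff limitin_add limitin_frag_of close x s)
    have "\<exists>j. frag_of ((x \<circ> \<sigma>) j) + frag_of ((y \<circ> \<sigma>) j) - frag_of ((z \<circ> \<sigma>) j) \<in> W"
      using s(2,3,4) frag_length_triple W(2)
      by (intro seq_openD[OF W(1) _ _ lim] keys_triple) simp_all
    then show False using s(8) by auto
  qed
  then obtain e where e: "e > 0" "\<forall>w\<in>?A. \<forall>y\<in>M. \<forall>z\<in>M. \<forall>x\<in>M. d w y < e \<longrightarrow> d w z < e \<longrightarrow> d x0 x < e \<longrightarrow>
      frag_of x + frag_of y - frag_of z \<in> W"
    by (elim exE conjE)
  have "\<exists>e'>0. \<forall>y\<in>M. \<forall>z\<in>M. d w y < e' \<longrightarrow> d w z < e' \<longrightarrow>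
     (\<forall>x\<in>M. d x0 x < min e r1 \<longrightarrow> frag_of x + frag_of y - frag_of z \<in> W)" if w: "w \<in> M" for w
  proof (cases "w \<in> ?A")
    case True
    then show ?thesis using e by (intro exI[of _ e]) simp
  next
    case False
    then have "openin mtopology {w}" using w by (simp add: non_isolated_points_def)
    then obtain e' where e': "e' > 0" "mball w e' \<subseteq> {w}"
      unfolding openin_mtopology by auto
    have "frag_of x + frag_of y - frag_of z \<in> W"
      if "y \<in> M" "z \<in> M" "d w y < e'" "d w z < e'" "x \<in> M" "d x0 x < min e r1" for x y z
    proof -
      have "y = w" "z = w" using that e'(2) w by (auto simp: subset_iff)
      then show ?thesis using r1(2) that(5,6) by simp
    qed
    then show ?thesis using e'(1) by blast
  qed
  then show ?thesis
    unfolding tube_def using e(1) r1(1) by (intro exI[of _ "min e r1"]) simp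
qed


text \<open>Reduces neighbourhoods of \<open>- frag_of p\<close> to those of
  \<open>frag_of p\<close>.\<close>

lemma seq_open_uminus:
  assumes "seq_open n W"
  shows "seq_open n {c. - c \<in> W}"
  unfolding seq_open_def
proof (intro allI impI)
  fix s g assume s: "\<forall>j. s j \<in> C \<and> frag_length (s j) \<le> n" "limitin T s g sequentially" "g \<in> {c. - c \<in> W}"
  have "\<exists>j. - s j \<in> W"
    by (rule seq_openD[OF assms _ _ limitin_uminus[OF s(2)]]) (use s in auto)
  then show "\<exists>j. s j \<in> {c. - c \<in> W}" by simp
qed

lemma seq_open_nbhd:
  assumes tubes: "\<And>W x. x \<in> M \<Longrightarrow> seq_open 3 W \<Longrightarrow> frag_of x \<in> W \<Longrightarrow> tube W x"
    and W: "seq_open 3 W" "g \<in> W" and g: "Poly_Mapping.keys g \<subseteq> M" "frag_length g \<le> 3"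
  shows "\<exists>N. continuous_seminorm N \<and>
    (\<forall>c. Poly_Mapping.keys c \<subseteq> M \<longrightarrow> frag_length c \<le> 3 \<longrightarrow> N (c - g) < 1 \<longrightarrow> c \<in> W)"
proof -
  consider "frag_length g = 0" | "frag_length g = 1" | "frag_length g = 2" | "frag_length g = 3"
    using g(2) by linarith
  then show ?thesis
  proof cases
    case 1
    then have "g = 0" by simp
    then show ?thesis using seq_open_nbhd_0[OF W(1)] W(2) by simp
  next
    case 2
    from signed_sum_exists[of g] obtain L where L: "signed_sum L = g" "length L = frag_length g"
        "\<forall>(s, p)\<in>set L. (s = 1 \<or> s = -1) \<and> p \<in> Poly_Mapping.keys g \<and> s * Poly_Mapping.lookup g p > 0"
      by (elim exE conjE)
    obtain s p where "L = [(s, p)]"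
      using L(2) 2 by (cases L) auto
    then have p: "p \<in> M" and "g = frag_of p \<or> g = - frag_of p"
      using L(1,3) g(1) by auto
    then show ?thesis
    proof (elim disjE)
      assume "g = frag_of p"
      then show ?thesis using seq_open_nbhd_frag_of[OF W(1) _ p] tubes[OF p W(1)] W(2) by simp
    next
      assume gp: "g = - frag_of p"
      let ?W = "{c. - c \<in> W}"
      have W': "seq_open 3 ?W" by (rule seq_open_uminus[OF W(1)])
      have "frag_of p \<in> ?W" using W(2) gp by simp
      then obtain N where N: "continuous_seminorm N"
        "\<And>c. Poly_Mapping.keys c \<subseteq> M \<Longrightarrow> frag_length c \<le> 3 \<Longrightarrow> N (c - frag_of p) < 1 \<Longrightarrow> c \<in> ?W"
        using seq_open_nbhd_frag_of[OF W' _ p tubes[OF p W']] by meson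
      have "c \<in> W" if c: "Poly_Mapping.keys c \<subseteq> M" "frag_length c \<le> 3" "N (c - g) < 1" for c
      proof -
        have "- (c - g) = - c - frag_of p" using gp by simp
        then have "N (- c - frag_of p) < 1"
          using c(3) N(1) unfolding continuous_seminorm_def by metis
        then show ?thesis using N(2)[of "- c"] c(1,2) by simp
      qed
      then show ?thesis using N(1) by meson
    qed
  next
    case 3
    obtain N where N: "continuous_seminorm N"
      "\<And>c. Poly_Mapping.keys c \<subseteq> M \<Longrightarrow> frag_length c \<le> 2 \<Longrightarrow> N (c - g) < 1 \<Longrightarrow> c \<in> W"
      using seq_open_nbhd_full_length[OF seq_open_mono[OF W(1)] W(2) g(1) 3] by auto
    \<comment> \<open>The coefficient sum makes the length of a neighbour even. This excludes length
      3, and the case of full length applies with \<open>n = 2\<close>.\<close>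
    let ?N = "\<lambda>c. max (N c) \<bar>frag_eval (\<lambda>_. 1) c\<bar>"
    have "continuous_seminorm ?N"
      by (intro continuous_seminorm_max N continuous_seminorm_frag_eval) simp
    moreover have "c \<in> W" if c: "Poly_Mapping.keys c \<subseteq> M" "frag_length c \<le> 3" "?N (c - g) < 1" for c
    proof (rule N(2)[OF c(1)])
      obtain k k' where "frag_eval (\<lambda>_. 1) c = of_int (int (frag_length c) + 2 * k)"
          "frag_eval (\<lambda>_. 1) g = of_int (int (frag_length g) + 2 * k')"
        using frag_length_parity by metis
      moreover have "\<bar>frag_eval (\<lambda>_. 1) c - frag_eval (\<lambda>_. 1) g\<bar> < 1" using c(3) by simp
      ultimately have "\<bar>(int (frag_length c) + 2 * k) - (2 + 2 * k')\<bar> < 1" using 3 by linarith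
      then have "frag_length c \<noteq> 3" by presburger
      then show "frag_length c \<le> 2" using c(2) by linarith
      show "N (c - g) < 1" using c(3) by simp
    qed
    ultimately show ?thesis by (intro exI[of _ ?N]) simp
  next
    case 4
    then show ?thesis using seq_open_nbhd_full_length[OF W g(1)] by simp
  qed
qed

section \<open>The space A_3(X) under condition (3)\<close>

abbreviation "ball3 \<equiv> {c. Poly_Mapping.keys c \<subseteq> M \<and> frag_length c \<le> 3}"

abbreviation "A3 \<equiv> subtopology T ball3"

lemma topspace_A3 [simp]: "topspace A3 = ball3"
  by auto

text \<open>A convergent sequence together with its limit is compact; openness on these compact sets
  is enough.\<close>

lemma k_open_imp_seq_open:
  assumes W: "W \<subseteq> ball3" "\<And>K. compactin A3 K \<Longrightarrow> openin (subtopology A3 K) (K \<inter> W)"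
  shows "seq_open 3 W"
  unfolding seq_open_def
proof (intro allI impI)
  fix s g assume s: "\<forall>j. s j \<in> C \<and> frag_length (s j) \<le> 3" "limitin T s g sequentially" "g \<in> W"
  let ?K = "insert g (range s)"
  have lim: "limitin A3 s g sequentially"
    using s W(1) by (auto simp: limitin_subtopology)
  have K: "compactin A3 ?K"
    by (rule compactin_sequence_with_limit[OF lim subset_refl]) (use s(1) in auto)
  have "limitin (subtopology A3 ?K) s g sequentially"
    using lim by (simp add: limitin_subtopology)
  then have "\<forall>\<^sub>F j in sequentially. s j \<in> ?K \<inter> W"
    using W(2)[OF K] s(3) by (auto simp: limitin_def)
  then show "\<exists>j. s j \<in> W"
    by (metis (mono_tags, lifting) Int_iff eventually_happens' sequentially_bot)
qed

lemma openin_A3_if_nbhd: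
  assumes W: "W \<subseteq> ball3" and nb: "\<And>g. g \<in> W \<Longrightarrow> \<exists>N. continuous_seminorm N \<and>
    (\<forall>c. Poly_Mapping.keys c \<subseteq> M \<longrightarrow> frag_length c \<le> 3 \<longrightarrow> N (c - g) < 1 \<longrightarrow> c \<in> W)"
  shows "openin A3 W"
proof (subst openin_subopen, intro ballI)
  fix g assume g: "g \<in> W"
  obtain N where N: "continuous_seminorm N"
      "\<And>c. Poly_Mapping.keys c \<subseteq> M \<Longrightarrow> frag_length c \<le> 3 \<Longrightarrow> N (c - g) < 1 \<Longrightarrow> c \<in> W"
    using nb[OF g] by meson
  have "continuous_map A3 euclideanreal (\<lambda>c. N (c - g))"
    by (rule continuous_map_from_subtopology[OF continuous_map_seminorm_diff[OF N(1)]])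
  from openin_continuous_map_preimage[OF this, of "{..<1}"]
  have "openin A3 {c \<in> topspace A3. N (c - g) \<in> {..<1}}" by simp
  moreover have "g \<in> {c \<in> topspace A3. N (c - g) \<in> {..<1}}"
    using g W N(1) by (auto simp: continuous_seminorm_def)
  moreover have "{c \<in> topspace A3. N (c - g) \<in> {..<1}} \<subseteq> W"
    using N(2) by auto
  ultimately show "\<exists>V. openin A3 V \<and> g \<in> V \<and> V \<subseteq> W" by blast
qed

text \<open>Take a point \<open>p\<close> of \<open>b - c\<close> and a bump at \<open>p\<close> too
  narrow to reach the other points of \<open>b - c\<close>. Its extension has the nonzero
  coefficient of \<open>p\<close> as value at \<open>b - c\<close>, so it separates \<open>b\<close>
  from \<open>c\<close>.\<close>

lemma Hausdorff_T: "Hausdorff_space T"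
  unfolding Hausdorff_space_def
proof (intro allI impI, elim conjE)
  fix b c assume bc: "b \<in> topspace T" "c \<in> topspace T" "b \<noteq> c"
  let ?a = "b - c"
  have "?a \<noteq> 0" using bc(3) by simp
  then obtain p where p: "p \<in> Poly_Mapping.keys ?a" by (meson ex_in_conv keys_eq_empty)
  have sub: "Poly_Mapping.keys ?a \<subseteq> M" using C_closed(2)[of b c] bc by simp
  from finite_separation[OF finite_keys sub] obtain r
    where r: "r > 0" "\<forall>p\<in>Poly_Mapping.keys ?a. \<forall>q\<in>Poly_Mapping.keys ?a. p \<noteq> q \<longrightarrow> 2 * r \<le> d p q"
    by (elim exE conjE)
  have pM: "p \<in> M" using p sub by auto
  let ?f = "frag_eval (bump p r)"
  have "bump p r q = 0" if "q \<in> Poly_Mapping.keys ?a" "q \<noteq> p" for q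
    using r(2)[rule_format, OF p that(1)] that(2) r(1) by (intro bump_eq_0) auto
  then have "?f ?a = (\<Sum>q\<in>Poly_Mapping.keys ?a. if q = p then of_int (Poly_Mapping.lookup ?a p) else 0)"
    unfolding frag_eval_def using pM by (intro sum.cong) auto
  also have "\<dots> = of_int (Poly_Mapping.lookup ?a p)" using p by simp
  finally have "?f ?a \<noteq> 0" using p by (metis not_in_keys_iff_lookup_eq_zero of_int_eq_0_iff)
  then have ne: "?f b \<noteq> ?f c" by simp
  have cont: "continuous_map T euclideanreal ?f"
    by (rule continuous_map_frag_eval[OF continuous_bump[OF pM r(1)]])
  obtain U V where UV: "open U" "open V" "?f b \<in> U" "?f c \<in> V" "U \<inter> V = {}"
    using hausdorff[OF ne] by blast
  have "openin T {x \<in> topspace T. ?f x \<in> U}" "openin T {x \<in> topspace T. ?f x \<in> V}"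
    by (rule openin_continuous_map_preimage[OF cont]; use UV in simp)+
  moreover have "disjnt {x \<in> topspace T. ?f x \<in> U} {x \<in> topspace T. ?f x \<in> V}"
    using UV(5) by (auto simp: disjnt_def)
  ultimately show "\<exists>U V. openin T U \<and> openin T V \<and> b \<in> U \<and> c \<in> V \<and> disjnt U V"
    using bc(1,2) UV(3,4) by (intro exI conjI) (assumption | simp)+
qed

lemma k_space_and_k_R_space_A3:
  assumes "locally_compact_space mtopology \<or> compactin mtopology (non_isolated_points mtopology)"
  shows "k_space A3" and "k_R_space A3"
proof -
  have tubes: "tube W x" if "x \<in> M" "seq_open 3 W" "frag_of x \<in> W" for W x
    using assms tube_locally_compact[OF _ that(2,3,1)] tube_compact_non_isolated[OF _ that(2,3,1)] by blast
  have nb: "\<exists>N. continuous_seminorm N \<and>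
      (\<forall>c. Poly_Mapping.keys c \<subseteq> M \<longrightarrow> frag_length c \<le> 3 \<longrightarrow> N (c - g) < 1 \<longrightarrow> c \<in> W)"
    if "W \<subseteq> ball3" "\<And>K. compactin A3 K \<Longrightarrow> openin (subtopology A3 K) (K \<inter> W)" "g \<in> W" for W g
    by (rule seq_open_nbhd[OF tubes k_open_imp_seq_open[OF that(1,2)] that(3)]) (use that(1,3) in auto)
  show k: "k_space A3"
    unfolding k_space_open
  proof (intro allI impI, elim conjE)
    fix W assume W: "W \<subseteq> topspace A3" "\<forall>K. compactin A3 K \<longrightarrow> openin (subtopology A3 K) (K \<inter> W)"
    show "openin A3 W"
    proof (rule openin_A3_if_nbhd)
      show W3: "W \<subseteq> ball3" using W(1) by simp
      show "\<exists>N. continuous_seminorm N \<and>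
          (\<forall>c. Poly_Mapping.keys c \<subseteq> M \<longrightarrow> frag_length c \<le> 3 \<longrightarrow> N (c - g) < 1 \<longrightarrow> c \<in> W)" if "g \<in> W" for g
        by (rule nb[OF W3 _ that]) (use W(2) in simp)
    qed
  qed
  have "completely_regular_space A3"
    unfolding completely_regular_space_alt'
  proof (intro allI impI)
    fix W g assume W: "openin A3 W" "g \<in> W"
    have W3: "W \<subseteq> ball3" using openin_subset[OF W(1)] by simp
    \<comment> \<open>An open set is in particular open on compact sets, so it too contains seminorm
      balls around its elements.\<close>
    obtain N where N: "continuous_seminorm N"
        "\<And>c. Poly_Mapping.keys c \<subseteq> M \<Longrightarrow> frag_length c \<le> 3 \<Longrightarrow> N (c - g) < 1 \<Longrightarrow> c \<in> W"
      using nb[OF W3 openin_subtopology_Int2[OF W(1)] W(2)] by meson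
    have "continuous_map A3 euclideanreal (\<lambda>c. N (c - g))"
      by (rule continuous_map_from_subtopology[OF continuous_map_seminorm_diff[OF N(1)]])
    then have "continuous_map A3 euclideanreal (\<lambda>c. min 1 (N (c - g)))"
      by (rule continuous_map_real_min[rotated]) simp
    moreover have "min 1 (N (g - g)) = 0" using N(1) by (simp add: continuous_seminorm_def)
    moreover have "(\<lambda>c. min 1 (N (c - g))) ` (topspace A3 - W) \<subseteq> {1}"
    proof (intro image_subsetI)
      fix c assume "c \<in> topspace A3 - W"
      then have "\<not> N (c - g) < 1" using N(2)[of c] by auto
      then show "min 1 (N (c - g)) \<in> {1}" by simp
    qed
    ultimately show "\<exists>f. continuous_map A3 euclideanreal f \<and> f g = 0 \<and> f ` (topspace A3 - W) \<subseteq> {1}"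
      by (intro exI[of _ "\<lambda>c. min 1 (N (c - g))"] conjI)
  qed
  moreover have "continuous_map A3 euclideanreal f"
    if "\<forall>K. compactin A3 K \<longrightarrow> continuous_map (subtopology A3 K) euclideanreal f" for f
    by (rule continuous_map_from_k_space[OF k]) (use that in simp)
  ultimately show "k_R_space A3"
    unfolding k_R_space_def tychonoff_space_def
    using Hausdorff_space_subtopology[OF Hausdorff_T] by simp
qed


section \<open>The obstruction outside condition (3)\<close>

text \<open>Members are distinguished by their index, so no set that meets \<open>M\<close> can
  occur twice; \<open>i0\<close> is arbitrary where the ball meets no member.\<close>

definition discrete_family :: "(nat \<Rightarrow> 'a set) \<Rightarrow> bool" where
  "discrete_family U \<longleftrightarrow> (\<forall>x\<in>M. \<exists>t>0. \<exists>i0. \<forall>i. \<forall>y\<in>M. y \<in> U i \<longrightarrow> d x y < t \<longrightarrow> i = i0)"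

lemma discrete_family_disjoint:
  assumes "discrete_family U" "x \<in> M" "x \<in> U i" "x \<in> U j"
  shows "i = j"
proof -
  obtain t i0 where "t > 0" "\<forall>i. \<forall>y\<in>M. y \<in> U i \<longrightarrow> d x y < t \<longrightarrow> i = i0"
    using assms(1,2) unfolding discrete_family_def by meson
  moreover have "d x x = 0" using assms(2) by simp
  ultimately show ?thesis using assms(2-4) by metis
qed

text \<open>Near each point the sum reduces to a single \<open>b i0\<close>. Summing over the
  nonzero terms only makes it a finite sum at every point of \<open>M\<close>.\<close>

lemma continuous_discrete_sum:
  assumes U: "discrete_family U"
    and b: "\<And>i. continuous_map mtopology euclideanreal (b i)"
    and b0: "\<And>i x. x \<in> M \<Longrightarrow> x \<notin> U i \<Longrightarrow> b i x = 0"
  shows "continuous_map mtopology euclideanreal (\<lambda>x. \<Sum>i\<in>{i. b i x \<noteq> 0}. b i x)"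
proof (rule continuous_map_real_if)
  fix x e assume x: "x \<in> M" and e: "(e::real) > 0"
  obtain t i0 where t: "t > 0" "\<forall>i. \<forall>y\<in>M. y \<in> U i \<longrightarrow> d x y < t \<longrightarrow> i = i0"
    using U x unfolding discrete_family_def by meson
  have sum: "(\<Sum>i\<in>{i. b i y \<noteq> 0}. b i y) = b i0 y" if y: "y \<in> M" "d x y < t" for y
  proof -
    have "{i. b i y \<noteq> 0} \<subseteq> {i0}"
      using b0[OF y(1)] t(2) y by auto
    then have "(\<Sum>i\<in>{i. b i y \<noteq> 0}. b i y) = (\<Sum>i\<in>{i0}. b i y)"
      by (intro sum.mono_neutral_left) auto
    then show ?thesis by simp
  qed
  have "openin mtopology {y \<in> topspace mtopology. b i0 y \<in> ball (b i0 x) e}"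
    by (intro openin_continuous_map_preimage[OF b]) simp
  then obtain r where r: "r > 0" "mball x r \<subseteq> {y \<in> topspace mtopology. b i0 y \<in> ball (b i0 x) e}"
    using x e unfolding openin_mtopology by (metis (no_types, lifting) centre_in_ball mem_Collect_eq topspace_mtopology)
  have "\<bar>(\<Sum>i\<in>{i. b i y \<noteq> 0}. b i y) - (\<Sum>i\<in>{i. b i x \<noteq> 0}. b i x)\<bar> < e"
    if y: "y \<in> M" "d x y < min r t" for y
  proof -
    have "y \<in> mball x r" using y x by simp
    then have "\<bar>b i0 y - b i0 x\<bar> < e" using r(2) by (auto simp: dist_real_def abs_minus_commute)
    then show ?thesis using sum[of y] sum[OF x] x y t(1) by simp
  qed
  then show "\<exists>r>0. \<forall>y\<in>M. d x y < r \<longrightarrow>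
      \<bar>(\<Sum>i\<in>{i. b i y \<noteq> 0}. b i y) - (\<Sum>i\<in>{i. b i x \<noteq> 0}. b i x)\<bar> < e"
    using r(1) t(1) by (intro exI[of _ "min r t"]) simp
qed

lemma compactin_frag_eval_bounded:
  assumes "compactin T K" "continuous_map mtopology euclideanreal F"
  shows "\<exists>B. \<forall>c\<in>K. \<bar>frag_eval F c\<bar> \<le> B"
proof -
  have "compact (frag_eval F ` K)"
    using image_compactin[OF assms(1) continuous_map_frag_eval[OF assms(2)]] by simp
  then show ?thesis
    by (auto dest!: compact_imp_bounded simp: bounded_iff)
qed

text \<open>If \<open>K\<close> contained an element detected in \<open>U n\<close> for infinitely many \<open>n\<close>, then gluing the
  functions \<open>n \<cdot> b n\<close> would give a continuous function whose extension is unbounded on \<open>K\<close>.\<close>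

lemma compactin_meets_finitely_many:
  assumes K: "compactin T K" and U: "discrete_family U"
    and J: "\<And>n. n \<in> J \<Longrightarrow> \<exists>b c. c \<in> K \<and> continuous_map mtopology euclideanreal b \<and>
      (\<forall>q\<in>M. q \<notin> U n \<longrightarrow> b q = 0) \<and>
      (\<forall>F. (\<forall>q\<in>M. q \<in> U n \<longrightarrow> F q = real n * b q) \<longrightarrow> (\<forall>q\<in>M. (\<forall>m. q \<notin> U m) \<longrightarrow> F q = 0) \<longrightarrow>
         real n \<le> \<bar>frag_eval F c\<bar>)"
  shows "finite J"
proof -
  define Q where "Q n b c \<longleftrightarrow> c \<in> K \<and> continuous_map mtopology euclideanreal b \<and>
      (\<forall>q\<in>M. q \<notin> U n \<longrightarrow> b q = 0) \<and>
      (\<forall>F. (\<forall>q\<in>M. q \<in> U n \<longrightarrow> F q = real n * b q) \<longrightarrow> (\<forall>q\<in>M. (\<forall>m. q \<notin> U m) \<longrightarrow> F q = 0) \<longrightarrow>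
         real n \<le> \<bar>frag_eval F c\<bar>)" for n b c
  have "\<exists>b c. Q n b c" if "n \<in> J" for n
    unfolding Q_def by (rule J[OF that])
  then obtain b c where Q: "\<And>n. n \<in> J \<Longrightarrow> Q n (b n) (c n)"
    by metis
  have b: "c n \<in> K" "continuous_map mtopology euclideanreal (b n)"
      "\<And>q. q \<in> M \<Longrightarrow> q \<notin> U n \<Longrightarrow> b n q = 0"
      "\<And>F. (\<And>q. q \<in> M \<Longrightarrow> q \<in> U n \<Longrightarrow> F q = real n * b n q) \<Longrightarrow>
         (\<And>q. q \<in> M \<Longrightarrow> (\<forall>m. q \<notin> U m) \<Longrightarrow> F q = 0) \<Longrightarrow> real n \<le> \<bar>frag_eval F (c n)\<bar>"
    if "n \<in> J" for n
    using Q[OF that] unfolding Q_def by simp_all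
  \<comment> \<open>No function has been chosen for the indices outside \<open>J\<close>; they
    contribute 0.\<close>
  define b' where "b' n q = (if n \<in> J then real n * b n q else 0)" for n q
  define F where "F q = (\<Sum>i\<in>{i. b' i q \<noteq> 0}. b' i q)" for q
  have b'0: "b' i q = 0" if "q \<in> M" "q \<notin> U i" for i q
    using b(3)[of i q] that by (simp add: b'_def)
  have "continuous_map mtopology euclideanreal (b' n)" for n
  proof (cases "n \<in> J")
    case True
    then have "continuous_map mtopology euclideanreal (\<lambda>q. real n * b n q)"
      by (intro continuous_map_real_mult_left b(2))
    then show ?thesis using True by (simp add: b'_def[abs_def])
  qed (simp add: b'_def[abs_def])
  then have "continuous_map mtopology euclideanreal F"
    unfolding F_def[abs_def] by (intro continuous_discrete_sum[OF U] b'0)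
  from compactin_frag_eval_bounded[OF K this] obtain B where B: "\<And>c. c \<in> K \<Longrightarrow> \<bar>frag_eval F c\<bar> \<le> B"
    by blast
  have FU: "F q = b' n q" if "q \<in> M" "q \<in> U n" for q n
  proof -
    have "{i. b' i q \<noteq> 0} \<subseteq> {n}"
      using b'0[OF that(1)] discrete_family_disjoint[OF U that(1) _ that(2)] by auto
    then have "F q = (\<Sum>i\<in>{n}. b' i q)"
      unfolding F_def by (intro sum.mono_neutral_left) auto
    then show ?thesis by simp
  qed
  have F0: "F q = 0" if "q \<in> M" "\<forall>m. q \<notin> U m" for q
    using b'0[OF that(1)] that(2) by (simp add: F_def)
  have "real n \<le> B" if n: "n \<in> J" for n
  proof -
    have "real n \<le> \<bar>frag_eval F (c n)\<bar>"
      by (rule b(4)[OF n]) (use FU F0 n in \<open>simp_all add: b'_def\<close>)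
    then show ?thesis using B[OF b(1)[OF n]] by simp
  qed
  then have "J \<subseteq> {..nat \<lfloor>B\<rfloor>}" by (auto simp: le_nat_floor)
  then show ?thesis by (rule finite_subset) simp
qed

text \<open>Some infinite subset of \<open>S\<close> has no accumulation point in \<open>S\<close>,
  hence none in the whole space, since \<open>S\<close> is closed. Every point of the space then has
  a ball with no other point of that subset, and small balls around its points form a discrete
  family.\<close>

lemma noncompact_imp_discrete_family:
  assumes S: "closedin mtopology S" "\<not> compactin mtopology S" and R: "R > 0"
  shows "\<exists>a \<rho>. (\<forall>k::nat. a k \<in> S \<and> 0 < \<rho> k \<and> \<rho> k \<le> R) \<and> discrete_family (\<lambda>k. mball (a k) (\<rho> k))"
proof -
  have SM: "S \<subseteq> M" using closedin_subset[OF S(1)] by simp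
  obtain A where A: "A \<subseteq> S" "infinite A" "S \<inter> mtopology derived_set_of A = {}"
    using S(2) SM unfolding compactin_eq_Bolzano_Weierstrass by meson
  have "mtopology derived_set_of A \<subseteq> S"
    using closedin_contains_derived_set[of mtopology S] S(1) derived_set_of_mono[OF A(1)] by blast
  then have der: "mtopology derived_set_of A = {}" using A(3) by blast
  have iso: "\<exists>s>0. \<forall>y\<in>A. d x y < s \<longrightarrow> y = x" if x: "x \<in> M" for x
  proof (rule ccontr)
    assume "\<not> ?thesis"
    then have "\<forall>r>0. \<exists>y\<in>A. y \<noteq> x \<and> y \<in> mball x r" using x A(1) SM by fastforce
    then have "x \<in> mtopology derived_set_of A"
      using x unfolding metric_derived_set_of by blast
    then show False using der by simp
  qed
  obtain a :: "nat \<Rightarrow> 'a" where a: "inj a" "range a \<subseteq> A"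
    using infinite_countable_subset[OF A(2)] by blast
  have aM: "a k \<in> M" "a k \<in> A" for k using a(2) A(1) SM by auto
  have "\<forall>k. \<exists>s>0. \<forall>y\<in>A. d (a k) y < s \<longrightarrow> y = a k" using iso aM by simp
  then obtain s where s: "\<And>k. s k > 0" "\<And>k y. y \<in> A \<Longrightarrow> d (a k) y < s k \<Longrightarrow> y = a k"
    by metis
  \<comment> \<open>With a third of the isolation radius, each of two radii is at most a third of
    the distance between their centres.\<close>
  define \<rho> where "\<rho> k = min R (s k) / 3" for k
  have \<rho>: "\<rho> k > 0" "\<rho> k \<le> R" "3 * \<rho> k \<le> s k" for k
    using s(1)[of k] R by (auto simp: \<rho>_def)
  have sep: "s k \<le> d (a k) (a l)" "s l \<le> d (a k) (a l)" if "k \<noteq> l" for k l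
    using s(2)[OF aM(2)[of l], of k] s(2)[OF aM(2)[of k], of l] that injD[OF a(1)]
    by (metis commute not_le)+
  have "discrete_family (\<lambda>k. mball (a k) (\<rho> k))"
    unfolding discrete_family_def
  proof
    fix x assume x: "x \<in> M"
    obtain e where e: "e > 0" "\<forall>y\<in>A. d x y < e \<longrightarrow> y = x" using iso[OF x] by meson
    \<comment> \<open>Let D be \<open>d x (a k) + d x (a l)\<close>, an upper bound for the distance
      of the centres. Each summand is below \<open>e / 4\<close> + D / 3, whence D < 3
      \<open>e\<close> / 2 and each summand is below \<open>e\<close>. But only \<open>x\<close>
      itself can be a point of \<open>A\<close> that close.\<close>
    have uniq: "k = l"
      if y: "y \<in> mball (a k) (\<rho> k)" "d x y < e / 4" and z: "z \<in> mball (a l) (\<rho> l)" "d x z < e / 4" for k l y z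
    proof (rule ccontr)
      assume "k \<noteq> l"
      have yz: "y \<in> M" "z \<in> M" "d (a k) y < \<rho> k" "d (a l) z < \<rho> l" using y z by auto
      have k: "d x (a k) \<le> d x y + d (a k) y"
        using triangle[OF x yz(1) aM(1)[of k]] commute[of y "a k"] by simp
      have l: "d x (a l) \<le> d x z + d (a l) z"
        using triangle[OF x yz(2) aM(1)[of l]] commute[of z "a l"] by simp
      have "d (a k) (a l) \<le> d x (a k) + d x (a l)"
        using triangle[OF aM(1)[of k] x aM(1)[of l]] commute[of x "a k"] by simp
      then have "d x (a k) < e" "d x (a l) < e"
        using k l y(2) z(2) yz(3,4) sep[OF \<open>k \<noteq> l\<close>] \<rho>(3)[of k] \<rho>(3)[of l] e(1) by linarith+
      then have "a k = a l" using e(2) aM(2) by metis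
      then show False using \<open>k \<noteq> l\<close> a(1) by (simp add: inj_eq)
    qed
    show "\<exists>t>0. \<exists>i0. \<forall>i. \<forall>y\<in>M. y \<in> mball (a i) (\<rho> i) \<longrightarrow> d x y < t \<longrightarrow> i = i0"
    proof (cases "\<exists>k. \<exists>y\<in>mball (a k) (\<rho> k). d x y < e / 4")
      case True
      then obtain k y where "y \<in> mball (a k) (\<rho> k)" "d x y < e / 4" by blast
      then show ?thesis using uniq e(1) by (intro exI[of _ "e / 4"] conjI exI[of _ k]) auto
    next
      case False
      then show ?thesis using e(1) by (intro exI[of _ "e / 4"] conjI) auto
    qed
  qed
  then show ?thesis using \<rho> aM(2) A(1) by blast
qed

end

section \<open>The double sequence accumulating at x0\<close>

lemma frag_triple_witness:
  assumes pos: "frag_eval F c > 0" "frag_eval G c > 0" "frag_eval H c < 0"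
    and nonneg: "\<And>x. F x \<ge> 0" "\<And>x. G x \<ge> 0" "\<And>x. H x \<ge> 0"
    and disj: "\<And>x. x \<in> S \<Longrightarrow> F x > 0 \<Longrightarrow> G x = 0 \<and> H x = 0" "\<And>x. x \<in> S \<Longrightarrow> G x > 0 \<Longrightarrow> H x = 0"
    and c: "Poly_Mapping.keys c \<subseteq> S" "frag_length c \<le> 3"
  shows "\<exists>x\<in>S. \<exists>y\<in>S. \<exists>z\<in>S. F x > 0 \<and> G y > 0 \<and> H z > 0 \<and> c = frag_of x + frag_of y - frag_of z"
proof -
  obtain x where x: "x \<in> Poly_Mapping.keys c" "F x > 0" "1 * Poly_Mapping.lookup c x > 0"
    by (rule frag_eval_pos_witness[of F 1 c, OF nonneg(1)]) (use pos in auto)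
  have xS: "x \<in> S" using x(1) c(1) by auto
  let ?c1 = "c - frag_cmul 1 (frag_of x)"
  have c1: "Poly_Mapping.keys ?c1 \<subseteq> S" by (rule keys_peel[OF c(1) xS])
  have l1: "frag_length c = Suc (frag_length ?c1)" by (rule frag_length_peel) (use x in auto)
  \<comment> \<open>\<open>G\<close> and \<open>H\<close> vanish at \<open>x\<close>, so their
    extensions take the same values on the remainder as on \<open>c\<close>.\<close>
  obtain y where y: "y \<in> Poly_Mapping.keys ?c1" "G y > 0" "1 * Poly_Mapping.lookup ?c1 y > 0"
    by (rule frag_eval_pos_witness[of G 1 ?c1, OF nonneg(2)]) (use pos disj(1)[OF xS x(2)] in auto)
  have yS: "y \<in> S" using y(1) c1 by blast
  let ?c2 = "?c1 - frag_cmul 1 (frag_of y)"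
  have c2: "Poly_Mapping.keys ?c2 \<subseteq> S" by (rule keys_peel[OF c1 yS])
  have l2: "frag_length ?c1 = Suc (frag_length ?c2)" by (rule frag_length_peel) (use y in auto)
  obtain z where z: "z \<in> Poly_Mapping.keys ?c2" "H z > 0" "-1 * Poly_Mapping.lookup ?c2 z > 0"
    by (rule frag_eval_pos_witness[of H "-1" ?c2, OF nonneg(3)])
       (use pos disj(1)[OF xS x(2)] disj(2)[OF yS y(2)] in auto)
  have zS: "z \<in> S" using z(1) c2 by blast
  \<comment> \<open>The third point split off exhausts an element of length at most 3.\<close>
  have "frag_length ?c2 = Suc (frag_length (?c2 - frag_cmul (-1) (frag_of z)))"
    by (rule frag_length_peel) (use z in auto)
  then have "?c2 - frag_cmul (-1) (frag_of z) = 0" using l1 l2 c(2) by (simp flip: frag_length_eq_0)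
  then have "c = frag_of x + frag_of y - frag_of z" by (simp add: algebra_simps eq_neg_iff_add_eq_0)
  then show ?thesis using xS yS zS x(2) y(2) z(2) by blast
qed

text \<open>The balls about the \<open>y n\<close> stay at distance at least \<open>t\<close> from
  \<open>x0\<close>, whereas those about the \<open>x n k\<close> lie within
  \<open>t / 2 + t / 4\<close>. Discreteness of the \<open>x n k\<close> is required only inside a
  row \<open>n\<close>, because over all rows they accumulate at \<open>x0\<close>: the factor
  \<open>inverse (real (Suc n))\<close> draws whole rows there.\<close>

locale free_metric_fan = free_metric M d T for M :: "'a set" and d T +
  fixes x0 :: 'a and t :: real and y :: "nat \<Rightarrow> 'a" and \<rho> :: "nat \<Rightarrow> real"
    and x :: "nat \<Rightarrow> nat \<Rightarrow> 'a" and \<sigma> :: "nat \<Rightarrow> nat \<Rightarrow> real" and u :: "nat \<Rightarrow> nat \<Rightarrow> 'a"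
  assumes x0: "x0 \<in> M" and t: "t > 0"
    and y: "y n \<in> M" and y_far: "z \<in> mball (y n) (\<rho> n) \<Longrightarrow> t \<le> d x0 z"
    and y_discrete: "discrete_family (\<lambda>n. mball (y n) (\<rho> n))"
    and x: "x n k \<in> M" "\<sigma> n k > 0" "d x0 (x n k) \<le> t / 2 * inverse (real (Suc n))" "\<sigma> n k \<le> t / 4"
    and x_discrete: "discrete_family (\<lambda>k. mball (x n k) (\<sigma> n k))"
    and u: "u n k \<in> M" "u n k \<noteq> y n" "d (y n) (u n k) < \<rho> n / 2" "d (y n) (u n k) < inverse (real (Suc k))"
begin

text \<open>Half the distance of the centres makes the tents at \<open>u n k\<close> and
  \<open>y n\<close> disjoint. Since \<open>u n k\<close> is within \<open>\<rho> n / 2\<close> of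
  \<open>y n\<close>, both tents stay inside the ball about \<open>y n\<close>.\<close>

definition "\<eta> n k = d (y n) (u n k) / 2"
definition "\<xi> n k = bump (x n k) (\<sigma> n k)"
definition "\<upsilon> n k = bump (u n k) (\<eta> n k)"
definition "\<zeta> n k = bump (y n) (\<eta> n k)"

definition "fan_point n k = frag_of (x n k) + frag_of (u n k) - frag_of (y n)"

text \<open>Positivity needs a positive letter near \<open>x n k\<close>, another near
  \<open>u n k\<close> and a negative one near \<open>y n\<close>; within length 3 these three
  letters are the whole element.\<close>

definition fan_bump :: "nat \<times> nat \<Rightarrow> ('a \<Rightarrow>\<^sub>0 int) \<Rightarrow> real" where
  "fan_bump = (\<lambda>(n, k) c. max 0 (min (frag_eval (\<xi> n k) c) (min (frag_eval (\<upsilon> n k) c) (- frag_eval (\<zeta> n k) c))))"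

definition fan_function :: "('a \<Rightarrow>\<^sub>0 int) \<Rightarrow> real" where
  "fan_function c = (\<Sum>p\<in>{p. fan_bump p c \<noteq> 0}. fan_bump p c)"

lemma \<eta>_pos: "\<eta> n k > 0"
  unfolding \<eta>_def using u(1,2)[of n k] y[of n] mdist_pos_less by fastforce

lemma \<xi>_support: "z \<in> M \<Longrightarrow> \<xi> n k z > 0 \<longleftrightarrow> z \<in> mball (x n k) (\<sigma> n k)"
  unfolding \<xi>_def using x(1,2)[of n k] by (simp add: bump_pos_iff)

lemma \<upsilon>_support:
  assumes "z \<in> M" "\<upsilon> n k z > 0"
  shows "z \<in> mball (y n) (\<rho> n)"
proof -
  have "d (u n k) z < \<eta> n k"
    using assms(2) by (simp add: \<upsilon>_def bump_pos_iff[OF \<eta>_pos])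
  then have "d (y n) z < \<rho> n"
    using triangle[OF y[of n] u(1)[of n k] assms(1)] u(3)[of n k] nonneg[of "y n" "u n k"]
    unfolding \<eta>_def by linarith
  then show ?thesis using y assms(1) by simp
qed

lemma \<zeta>_support:
  assumes "z \<in> M" "\<zeta> n k z > 0"
  shows "z \<in> mball (y n) (\<rho> n)"
proof -
  have "d (y n) z < \<eta> n k"
    using assms(2) by (simp add: \<zeta>_def bump_pos_iff[OF \<eta>_pos])
  then have "d (y n) z < \<rho> n"
    using u(3)[of n k] nonneg[of "y n" "u n k"] unfolding \<eta>_def by linarith
  then show ?thesis using y assms(1) by simp
qed

lemma \<upsilon>\<zeta>_disjoint: "z \<in> M \<Longrightarrow> \<upsilon> n k z > 0 \<Longrightarrow> \<zeta> n k z = 0"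
  unfolding \<upsilon>_def \<zeta>_def using \<eta>_pos[of n k] triangle[OF y[of n] _ u(1)[of n k], of z] commute[of z "u n k"]
  by (intro bump_eq_0) (simp_all add: bump_pos_iff \<eta>_def)

lemma x_ball_near: "z \<in> mball (x n k) (\<sigma> n k) \<Longrightarrow> d x0 z < t"
proof -
  assume z: "z \<in> mball (x n k) (\<sigma> n k)"
  have "inverse (real (Suc n)) \<le> 1" by (simp add: inverse_le_1_iff)
  then have "t / 2 * inverse (real (Suc n)) \<le> t / 2 * 1" using t by (intro mult_left_mono) auto
  moreover have "d x0 z \<le> d x0 (x n k) + d (x n k) z" "d (x n k) z < \<sigma> n k"
    using triangle[OF x0 x(1)[of n k], of z] z by simp_all
  ultimately show ?thesis
    using x(3,4)[of n k] t by linarith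
qed

lemma x_ball_y_ball_disjoint: "z \<in> mball (x n k) (\<sigma> n k) \<Longrightarrow> z \<notin> mball (y m) (\<rho> m)"
  using x_ball_near y_far by fastforce

lemma nonneg_bumps: "\<xi> n k z \<ge> 0" "\<upsilon> n k z \<ge> 0" "\<zeta> n k z \<ge> 0"
  by (simp_all add: \<xi>_def \<upsilon>_def \<zeta>_def)

lemma zero_on_x_ball:
  assumes "z \<in> M" "\<xi> n k z > 0"
  shows "\<upsilon> m l z = 0" "\<zeta> m l z = 0"
proof -
  have z: "z \<notin> mball (y m) (\<rho> m)" for m
    using assms \<xi>_support x_ball_y_ball_disjoint by blast
  show "\<upsilon> m l z = 0"
    using z[of m] \<upsilon>_support[OF assms(1), of m l] nonneg_bumps(2)[of m l z] by linarith
  show "\<zeta> m l z = 0"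
    using z[of m] \<zeta>_support[OF assms(1), of m l] nonneg_bumps(3)[of m l z] by linarith
qed

lemma fan_bump_witness:
  assumes "c \<in> ball3" "fan_bump (n, k) c \<noteq> 0"
  shows "\<exists>a\<in>M. \<exists>b\<in>M. \<exists>z\<in>M. \<xi> n k a > 0 \<and> \<upsilon> n k b > 0 \<and> \<zeta> n k z > 0 \<and> c = frag_of a + frag_of b - frag_of z"
proof (rule frag_triple_witness)
  have "fan_bump (n, k) c > 0" using assms(2) by (auto simp: fan_bump_def)
  then show "frag_eval (\<xi> n k) c > 0" "frag_eval (\<upsilon> n k) c > 0" "frag_eval (\<zeta> n k) c < 0"
    by (auto simp: fan_bump_def less_max_iff_disj)
qed (use assms nonneg_bumps zero_on_x_ball \<upsilon>\<zeta>_disjoint in auto)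

lemma continuous_fan_bump: "continuous_map T euclideanreal (fan_bump p)"
proof -
  obtain n k where p: "p = (n, k)" by fastforce
  have "continuous_map T euclideanreal (frag_eval (\<xi> n k))"
    unfolding \<xi>_def by (intro continuous_map_frag_eval continuous_bump x)
  moreover have "continuous_map T euclideanreal (frag_eval (\<upsilon> n k))"
    unfolding \<upsilon>_def by (intro continuous_map_frag_eval continuous_bump u \<eta>_pos)
  moreover have "continuous_map T euclideanreal (frag_eval (\<zeta> n k))"
    unfolding \<zeta>_def by (intro continuous_map_frag_eval continuous_bump y \<eta>_pos)
  ultimately show ?thesis
    unfolding p fan_bump_def prod.case
    by (intro continuous_map_real_max continuous_map_real_min continuous_map_minus) auto
qed

text \<open>The letters \<open>b\<close> and \<open>z\<close> lie in the same ball and have opposite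
  signs, so a function on the ball could take nearly equal values at them. A tent at
  \<open>z\<close> that vanishes at \<open>b\<close> avoids this cancellation, and the letter
  \<open>a\<close> lies outside all balls about the \<open>y m\<close>.\<close>

lemma finite_rows:
  assumes K: "compactin T K" "K \<subseteq> ball3"
  shows "finite {n. \<exists>k. \<exists>c\<in>K. fan_bump (n, k) c \<noteq> 0}"
proof (rule compactin_meets_finitely_many[OF K(1) y_discrete])
  fix n assume "n \<in> {n. \<exists>k. \<exists>c\<in>K. fan_bump (n, k) c \<noteq> 0}"
  then obtain k c where c: "c \<in> K" "fan_bump (n, k) c \<noteq> 0" by blast
  then have "c \<in> ball3" using K(2) by blast
  from fan_bump_witness[OF this c(2)] obtain a b z
    where abz: "a \<in> M" "b \<in> M" "z \<in> M" "\<xi> n k a > 0" "\<upsilon> n k b > 0" "\<zeta> n k z > 0"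
      "c = frag_of a + frag_of b - frag_of z"
    by blast
  have B: "b \<in> mball (y n) (\<rho> n)" "z \<in> mball (y n) (\<rho> n)"
    using \<upsilon>_support \<zeta>_support abz by blast+
  have "z \<noteq> b" using \<upsilon>\<zeta>_disjoint[OF abz(2,5)] abz(6) by auto
  then have zb: "0 < d z b" using abz(2,3) by simp
  \<comment> \<open>The first bound makes the tent vanish at \<open>b\<close>, the second keeps it
    inside the ball about \<open>y n\<close>.\<close>
  define e where "e = min (d z b) (\<rho> n - d (y n) z)"
  have e: "e > 0" "e \<le> d z b" using zb B by (auto simp: e_def)
  have a_out: "a \<notin> mball (y m) (\<rho> m)" for m
    using abz(1,4) \<xi>_support x_ball_y_ball_disjoint by blast
  show "\<exists>b c. c \<in> K \<and> continuous_map mtopology euclideanreal b \<and>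
      (\<forall>q\<in>M. q \<notin> mball (y n) (\<rho> n) \<longrightarrow> b q = 0) \<and>
      (\<forall>F. (\<forall>q\<in>M. q \<in> mball (y n) (\<rho> n) \<longrightarrow> F q = real n * b q) \<longrightarrow>
         (\<forall>q\<in>M. (\<forall>m. q \<notin> mball (y m) (\<rho> m)) \<longrightarrow> F q = 0) \<longrightarrow> real n \<le> \<bar>frag_eval F c\<bar>)"
  proof (intro exI conjI ballI impI allI)
    show "c \<in> K" by (rule c(1))
    show "continuous_map mtopology euclideanreal (bump z e)" by (rule continuous_bump[OF abz(3) e(1)])
    fix q assume q: "q \<in> M" "q \<notin> mball (y n) (\<rho> n)"
    have "e \<le> d z q"
      using triangle[OF y[of n] abz(3) q(1)] q y[of n] by (simp add: e_def)
    then show "bump z e q = 0" by (rule bump_eq_0[OF e(1)])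
  next
    fix F :: "'a \<Rightarrow> real"
    assume F: "\<forall>q\<in>M. q \<in> mball (y n) (\<rho> n) \<longrightarrow> F q = real n * bump z e q"
      "\<forall>q\<in>M. (\<forall>m. q \<notin> mball (y m) (\<rho> m)) \<longrightarrow> F q = 0"
    have "F a = 0" using F(2) abz(1) a_out by blast
    moreover have "F b = 0" using F(1) abz(2) B(1) bump_eq_0[OF e] by simp
    moreover have "F z = real n" using F(1) abz(3) B(2) by simp
    ultimately show "real n \<le> \<bar>frag_eval F c\<bar>" by (simp add: abz(7))
  qed
qed

text \<open>Inside one row the letter \<open>a\<close> identifies the column, while \<open>b\<close>
  and \<open>z\<close> lie outside all balls about the \<open>x n l\<close>; no cancellation can
  occur.\<close>

lemma finite_columns:
  assumes K: "compactin T K" "K \<subseteq> ball3"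
  shows "finite {k. \<exists>c\<in>K. fan_bump (n, k) c \<noteq> 0}"
proof (rule compactin_meets_finitely_many[OF K(1) x_discrete[of n]])
  fix k assume "k \<in> {k. \<exists>c\<in>K. fan_bump (n, k) c \<noteq> 0}"
  then obtain c where c: "c \<in> K" "fan_bump (n, k) c \<noteq> 0" by blast
  then have "c \<in> ball3" using K(2) by blast
  from fan_bump_witness[OF this c(2)] obtain a b z
    where abz: "a \<in> M" "b \<in> M" "z \<in> M" "\<xi> n k a > 0" "\<upsilon> n k b > 0" "\<zeta> n k z > 0"
      "c = frag_of a + frag_of b - frag_of z"
    by blast
  have A: "a \<in> mball (x n k) (\<sigma> n k)" using \<xi>_support abz by blast
  have out: "b \<notin> mball (x n l) (\<sigma> n l)" "z \<notin> mball (x n l) (\<sigma> n l)" for l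
    using \<upsilon>_support[OF abz(2,5)] \<zeta>_support[OF abz(3,6)] x_ball_y_ball_disjoint by blast+
  define e where "e = \<sigma> n k - d (x n k) a"
  have e: "e > 0" using A by (simp add: e_def)
  show "\<exists>b c. c \<in> K \<and> continuous_map mtopology euclideanreal b \<and>
      (\<forall>q\<in>M. q \<notin> mball (x n k) (\<sigma> n k) \<longrightarrow> b q = 0) \<and>
      (\<forall>F. (\<forall>q\<in>M. q \<in> mball (x n k) (\<sigma> n k) \<longrightarrow> F q = real k * b q) \<longrightarrow>
         (\<forall>q\<in>M. (\<forall>m. q \<notin> mball (x n m) (\<sigma> n m)) \<longrightarrow> F q = 0) \<longrightarrow> real k \<le> \<bar>frag_eval F c\<bar>)"
  proof (intro exI conjI ballI impI allI)
    show "c \<in> K" by (rule c(1))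
    show "continuous_map mtopology euclideanreal (bump a e)" by (rule continuous_bump[OF abz(1) e])
    fix q assume q: "q \<in> M" "q \<notin> mball (x n k) (\<sigma> n k)"
    have "e \<le> d a q"
      using triangle[OF x(1)[of n k] abz(1) q(1)] q x(1)[of n k] by (simp add: e_def)
    then show "bump a e q = 0" by (rule bump_eq_0[OF e])
  next
    fix F :: "'a \<Rightarrow> real"
    assume F: "\<forall>q\<in>M. q \<in> mball (x n k) (\<sigma> n k) \<longrightarrow> F q = real k * bump a e q"
      "\<forall>q\<in>M. (\<forall>m. q \<notin> mball (x n m) (\<sigma> n m)) \<longrightarrow> F q = 0"
    have "F b = 0" "F z = 0" using F(2) abz(2,3) out by blast+
    moreover have "F a = real k" using F(1) abz(1) A by simp
    ultimately show "real k \<le> \<bar>frag_eval F c\<bar>" by (simp add: abz(7))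
  qed
qed

text \<open>Rows and columns are bounded separately because the balls about all \<open>x n k\<close>
  together do not form a discrete family.\<close>

lemma finite_fan_bumps:
  assumes "compactin T K" "K \<subseteq> ball3"
  shows "finite {p. \<exists>c\<in>K. fan_bump p c \<noteq> 0}"
proof (rule finite_subset)
  show "{p. \<exists>c\<in>K. fan_bump p c \<noteq> 0} \<subseteq>
      Sigma {n. \<exists>k. \<exists>c\<in>K. fan_bump (n, k) c \<noteq> 0} (\<lambda>n. {k. \<exists>c\<in>K. fan_bump (n, k) c \<noteq> 0})"
    by auto
  show "finite (Sigma {n. \<exists>k. \<exists>c\<in>K. fan_bump (n, k) c \<noteq> 0} (\<lambda>n. {k. \<exists>c\<in>K. fan_bump (n, k) c \<noteq> 0}))"
    using finite_rows[OF assms] finite_columns[OF assms] by (intro finite_SigmaI)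
qed

lemma fan_function_eq_sum:
  assumes "compactin T K" "K \<subseteq> ball3" "c \<in> K"
  shows "fan_function c = (\<Sum>p\<in>{p. \<exists>c\<in>K. fan_bump p c \<noteq> 0}. fan_bump p c)"
  unfolding fan_function_def
  by (rule sum.mono_neutral_left[OF finite_fan_bumps[OF assms(1,2)]]) (use assms(3) in auto)

lemma fan_function_k_continuous:
  assumes "compactin A3 K"
  shows "continuous_map (subtopology A3 K) euclideanreal fan_function"
proof -
  have K: "compactin T K" "K \<subseteq> ball3"
    using assms by (auto simp: compactin_subtopology)
  let ?P = "{p. \<exists>c\<in>K. fan_bump p c \<noteq> 0}"
  have "continuous_map (subtopology A3 K) euclideanreal (\<lambda>c. \<Sum>p\<in>?P. fan_bump p c)"
    by (intro continuous_map_sum finite_fan_bumps[OF K] continuous_map_from_subtopology continuous_fan_bump)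
  then show ?thesis
    by (rule continuous_map_eq) (use fan_function_eq_sum[OF K] in auto)
qed

lemma fan_point_mem: "fan_point n k \<in> ball3"
  unfolding fan_point_def using keys_triple frag_length_triple x(1) u(1) y by simp

lemma fan_function_fan_point: "fan_function (fan_point n k) \<ge> 1"
proof -
  let ?c = "fan_point n k" and ?P = "{p. fan_bump p (fan_point n k) \<noteq> 0}"
  \<comment> \<open>A singleton is compact, so the index set is finite; on an infinite set
    \<open>sum\<close> would default to 0.\<close>
  have "compactin T {?c}" using fan_point_mem[of n k] by auto
  from finite_fan_bumps[OF this] have fin: "finite ?P" using fan_point_mem[of n k] by simp
  have self: "\<xi> n k (x n k) = 1" "\<upsilon> n k (u n k) = 1" "\<zeta> n k (y n) = 1"
    using x(1) u(1) y by (simp_all add: \<xi>_def \<upsilon>_def \<zeta>_def)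
  have "\<xi> n k (u n k) = 0" "\<xi> n k (y n) = 0"
    using zero_on_x_ball(1)[OF u(1), of n k n k n k] zero_on_x_ball(2)[OF y, of n k n n k] self
      nonneg_bumps(1)[of n k] by (auto simp: order_le_less)
  moreover have "\<upsilon> n k (x n k) = 0" "\<zeta> n k (x n k) = 0"
    using zero_on_x_ball[OF x(1), of n k n k n k] self by simp_all
  moreover have "\<zeta> n k (u n k) = 0" using \<upsilon>\<zeta>_disjoint[OF u(1), of n k n k] self by simp
  moreover have "\<upsilon> n k (y n) = 0"
    using \<upsilon>\<zeta>_disjoint[OF y, of n k n] self nonneg_bumps(2)[of n k "y n"] by (auto simp: order_le_less)
  ultimately have one: "fan_bump (n, k) ?c = 1"
    using self by (simp add: fan_bump_def fan_point_def)
  have "(\<Sum>p\<in>{(n, k)}. fan_bump p ?c) \<le> (\<Sum>p\<in>?P. fan_bump p ?c)"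
    by (rule sum_mono2[OF fin]) (use one in \<open>auto simp: fan_bump_def\<close>)
  then show ?thesis using one by (simp add: fan_function_def)
qed

lemma fan_function_x0: "fan_function (frag_of x0) = 0"
proof -
  have "fan_bump (n, k) (frag_of x0) = 0" for n k
  proof -
    have "x0 \<notin> mball (y n) (\<rho> n)" using y_far[of x0 n] t x0 by fastforce
    then have "\<upsilon> n k x0 = 0"
      using \<upsilon>_support[OF x0, of n k] nonneg_bumps(2)[of n k x0] by linarith
    then show ?thesis by (simp add: fan_bump_def)
  qed
  then have "fan_bump p (frag_of x0) = 0" for p by (cases p) simp
  then show ?thesis by (simp add: fan_function_def)
qed

text \<open>The order of the choices matters: first \<open>n\<close>, which brings
  \<open>x n k\<close> close to \<open>x0\<close> for all \<open>k\<close> at once, then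
  \<open>k\<close>, which brings \<open>u n k\<close> close to \<open>y n\<close> for this
  \<open>n\<close>.\<close>

lemma fan_points_accumulate:
  assumes O: "openin T W" "frag_of x0 \<in> W"
  shows "\<exists>n k. fan_point n k \<in> W"
proof -
  have "openin (prod_topology T T) {p \<in> topspace (prod_topology T T). (\<lambda>(x, y). x + y) p \<in> W}"
    by (rule openin_continuous_map_preimage[OF continuous_add O(1)])
  moreover have "(frag_of x0, 0) \<in> {p \<in> topspace (prod_topology T T). (\<lambda>(x, y). x + y) p \<in> W}"
    using O(2) x0 by (simp add: keys_frag_of)
  ultimately obtain U V where UV: "openin T U" "openin T V" "frag_of x0 \<in> U" "0 \<in> V"
      "U \<times> V \<subseteq> {p \<in> topspace (prod_topology T T). (\<lambda>(x, y). x + y) p \<in> W}"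
    unfolding openin_prod_topology_alt by meson
  have "openin mtopology {z \<in> topspace mtopology. frag_of z \<in> U}"
    by (rule openin_continuous_map_preimage[OF continuous_frag_of UV(1)])
  then obtain r where r: "r > 0" "mball x0 r \<subseteq> {z \<in> topspace mtopology. frag_of z \<in> U}"
    using x0 UV(3) unfolding openin_mtopology by (metis (no_types, lifting) mem_Collect_eq topspace_mtopology)
  have "r / (t / 2) > 0" using r(1) t by simp
  then obtain n where "inverse (real (Suc n)) < r / (t / 2)"
    using reals_Archimedean by blast
  then have "t / 2 * inverse (real (Suc n)) < r" using t by (simp add: field_simps)
  then have xU: "frag_of (x n k) \<in> U" for k
    using x(1,3)[of n k] x0 r(2) by (auto simp: subset_iff)
  have "limitin mtopology (u n) (y n) sequentially"
    by (intro limitin_mtopology_if y u)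
  then have "limitin T (\<lambda>k. frag_of (u n k) - frag_of (y n)) (frag_of (y n) - frag_of (y n)) sequentially"
    by (intro limitin_diff limitin_frag_of) (simp_all add: y keys_frag_of)
  then have "\<forall>\<^sub>F k in sequentially. frag_of (u n k) - frag_of (y n) \<in> V"
    using UV(2,4) by (simp add: limitin_def)
  then obtain k where "frag_of (u n k) - frag_of (y n) \<in> V"
    by (metis (mono_tags, lifting) eventually_happens' sequentially_bot)
  with xU have "(frag_of (x n k), frag_of (u n k) - frag_of (y n)) \<in> U \<times> V" by simp
  then have "frag_of (x n k) + (frag_of (u n k) - frag_of (y n)) \<in> W" using UV(5) by auto
  then show ?thesis by (auto simp: fan_point_def add_diff_eq)
qed

lemma fan_function_not_continuous: "\<not> continuous_map A3 euclideanreal fan_function"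
proof
  assume "continuous_map A3 euclideanreal fan_function"
  from openin_continuous_map_preimage[OF this, of "{..<1}"]
  have "openin A3 {c \<in> topspace A3. fan_function c \<in> {..<1}}" by simp
  then obtain W where W: "openin T W" "{c \<in> topspace A3. fan_function c \<in> {..<1}} = W \<inter> ball3"
    unfolding openin_subtopology by blast
  have "frag_of x0 \<in> {c \<in> topspace A3. fan_function c \<in> {..<1}}"
    using fan_function_x0 x0 by (simp add: keys_frag_of)
  then have "frag_of x0 \<in> W" using W(2) by blast
  then obtain n k where "fan_point n k \<in> W" using fan_points_accumulate[OF W(1)] by blast
  then have "fan_point n k \<in> {c \<in> topspace A3. fan_function c \<in> {..<1}}"
    using W(2) fan_point_mem[of n k] by blast
  then show False using fan_function_fan_point[of n k] by simp
qed

text \<open>On a k-space a real function that is continuous on compact sets is continuous, so one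
  function refutes both properties.\<close>

lemma not_k_space: "\<not> k_space A3" and not_k_R_space: "\<not> k_R_space A3"
  using continuous_map_from_k_space[of A3 euclideanreal fan_function] fan_function_k_continuous
    fan_function_not_continuous unfolding k_R_space_def by blast+

end

context free_metric begin

lemma closedin_non_isolated_points: "closedin mtopology (non_isolated_points mtopology)"
proof -
  have "openin mtopology (M - non_isolated_points mtopology)"
    by (subst openin_subopen) (auto simp: non_isolated_points_def intro!: exI[of _ "{_}"])
  then show ?thesis by (auto simp: closedin_def non_isolated_points_def)
qed

lemma not_k_space_and_not_k_R_space_A3:
  assumes lc: "\<not> locally_compact_space mtopology"
    and NI: "\<not> compactin mtopology (non_isolated_points mtopology)"
  shows "\<not> k_space A3" and "\<not> k_R_space A3"
proof -
  let ?A = "non_isolated_points mtopology"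
  obtain x0 where x0: "x0 \<in> M"
    "\<And>U K. openin mtopology U \<Longrightarrow> compactin mtopology K \<Longrightarrow> x0 \<in> U \<Longrightarrow> \<not> U \<subseteq> K"
    using lc unfolding locally_compact_space_def by (metis topspace_mtopology)
  have nc: "\<not> compactin mtopology (mcball x0 r)" if "r > 0" for r
    using x0(2)[of "mball x0 r" "mcball x0 r"] x0(1) that by auto
  obtain y' \<rho>' where y': "\<And>n::nat. y' n \<in> ?A" "\<And>n. \<rho>' n > 0"
      "discrete_family (\<lambda>n. mball (y' n) (\<rho>' n))"
    using noncompact_imp_discrete_family[OF closedin_non_isolated_points NI zero_less_one] by blast
  obtain t i0 where t: "t > 0" "\<And>i z. z \<in> M \<Longrightarrow> z \<in> mball (y' i) (\<rho>' i) \<Longrightarrow> d x0 z < t \<Longrightarrow> i = i0"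
    using y'(3) x0(1) unfolding discrete_family_def by meson
  \<comment> \<open>The ball of radius \<open>t\<close> about \<open>x0\<close> meets no member
    except perhaps the one with index \<open>i0\<close>; dropping the indices up to
    \<open>i0\<close> puts all others out of its reach.\<close>
  define y where "y n = y' (Suc i0 + n)" for n
  define \<rho> where "\<rho> n = \<rho>' (Suc i0 + n)" for n
  have yA: "y n \<in> ?A" and yM: "y n \<in> M" and \<rho>: "\<rho> n > 0" for n
    using y'(1,2) by (auto simp: y_def \<rho>_def non_isolated_points_def)
  have far: "t \<le> d x0 z" if "z \<in> mball (y n) (\<rho> n)" for z n
    using t(2)[of z "Suc i0 + n"] that by (force simp: y_def \<rho>_def)
  have disc: "discrete_family (\<lambda>n. mball (y n) (\<rho> n))"
    unfolding discrete_family_def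
  proof
    fix w assume "w \<in> M"
    then obtain s j where s: "s > 0" "\<forall>i. \<forall>z\<in>M. z \<in> mball (y' i) (\<rho>' i) \<longrightarrow> d w z < s \<longrightarrow> i = j"
      using y'(3) unfolding discrete_family_def by meson
    \<comment> \<open>For \<open>j\<close> \<le> \<open>i0\<close> the subtraction gives 0, but then
      no member of the shifted family comes within \<open>s\<close> of \<open>w\<close>.\<close>
    have "i = j - Suc i0" if "z \<in> M" "z \<in> mball (y i) (\<rho> i)" "d w z < s" for i z
    proof -
      have "Suc i0 + i = j" using s(2) that unfolding y_def \<rho>_def by blast
      then show ?thesis by simp
    qed
    then show "\<exists>s>0. \<exists>j. \<forall>i. \<forall>z\<in>M. z \<in> mball (y i) (\<rho> i) \<longrightarrow> d w z < s \<longrightarrow> i = j"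
      using s(1) by blast
  qed
  \<comment> \<open>However small, a closed ball about \<open>x0\<close> is not compact, so it
    contains the centres of a whole row.\<close>
  have "\<forall>n. \<exists>a s. (\<forall>k::nat. a k \<in> mcball x0 (t / 2 * inverse (real (Suc n))) \<and> 0 < s k \<and> s k \<le> t / 4) \<and>
      discrete_family (\<lambda>k. mball (a k) (s k))"
    using t(1) by (intro allI noncompact_imp_discrete_family nc) simp_all
  then obtain x \<sigma> where x: "\<And>n. (\<forall>k::nat. x n k \<in> mcball x0 (t / 2 * inverse (real (Suc n))) \<and>
      0 < \<sigma> n k \<and> \<sigma> n k \<le> t / 4) \<and> discrete_family (\<lambda>k. mball (x n k) (\<sigma> n k))"
    by metis
  have "\<exists>z\<in>M. z \<noteq> y n \<and> d (y n) z < e" if "e > 0" for n e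
  proof (rule ccontr)
    assume "\<not> ?thesis"
    then have "mball (y n) e = {y n}" using yM[of n] that by auto
    then have "openin mtopology {y n}" by (metis openin_mball)
    then show False using yA[of n] by (simp add: non_isolated_points_def)
  qed
  then have "\<forall>n k. \<exists>z. z \<in> M \<and> z \<noteq> y n \<and> d (y n) z < min (\<rho> n / 2) (inverse (real (Suc k)))"
    using \<rho> by (metis half_gt_zero inverse_positive_iff_positive min_less_iff_conj of_nat_0_less_iff zero_less_Suc)
  then obtain u where u: "\<And>n k. u n k \<in> M \<and> u n k \<noteq> y n \<and> d (y n) (u n k) < min (\<rho> n / 2) (inverse (real (Suc k)))"
    by metis
  interpret fan: free_metric_fan M d T x0 t y \<rho> x \<sigma> u
    by unfold_locales (use x0(1) t(1) yM far disc x u in \<open>auto\<close>)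
  show "\<not> k_space A3" "\<not> k_R_space A3"
    by (rule fan.not_k_space, rule fan.not_k_R_space)
qed

end

section \<open>Transfer to an arbitrary model of \<open>A(X)\<close>\<close>

lemma homeomorphic_k_R_space_imp:
  assumes "X homeomorphic_space Y" "k_R_space X"
  shows "k_R_space Y"
proof -
  obtain g h where gh: "homeomorphic_maps X Y g h"
    using assms(1) unfolding homeomorphic_space_def by blast
  have g: "continuous_map X Y g" and h: "continuous_map Y X h"
    and inv: "\<And>y. y \<in> topspace Y \<Longrightarrow> g (h y) = y"
    using gh by (auto simp: homeomorphic_maps_def)
  have "tychonoff_space Y"
    using assms homeomorphic_completely_regular_space homeomorphic_Hausdorff_space
    unfolding k_R_space_def tychonoff_space_def by metis
  moreover have "continuous_map Y euclideanreal f"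
    if f: "\<forall>K. compactin Y K \<longrightarrow> continuous_map (subtopology Y K) euclideanreal f" for f
  proof -
    have "continuous_map (subtopology X K) euclideanreal (f \<circ> g)" if K: "compactin X K" for K
    proof (rule continuous_map_compose)
      show "continuous_map (subtopology X K) (subtopology Y (g ` K)) g"
        using g by (auto simp: continuous_map_in_subtopology continuous_map_from_subtopology)
      show "continuous_map (subtopology Y (g ` K)) euclideanreal f"
        using f image_compactin[OF K g] by simp
    qed
    then have "continuous_map X euclideanreal (f \<circ> g)"
      using assms(2) unfolding k_R_space_def by blast
    from continuous_map_compose[OF h this] show ?thesis
      by (rule continuous_map_eq) (simp add: inv)
  qed
  ultimately show ?thesis unfolding k_R_space_def by blast
qed

lemma homeomorphic_k_R_space:
  "X homeomorphic_space Y \<Longrightarrow> k_R_space X \<longleftrightarrow> k_R_space Y"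
  using homeomorphic_k_R_space_imp homeomorphic_space_sym by metis

text \<open>The universal properties give continuous homomorphisms in both directions, mutually
  inverse because the composites fix the generators. They preserve length because a reduced form in
  \<open>G\<close> is carried to the formal combination with the same coefficients.\<close>

lemma bounded_length_subspace_homeomorphic:
  assumes free: "free_abelian_topological_group X G T i"
    and free': "free_abelian_topological_group X (free_Abelian_group (topspace X)) T' frag_of"
  shows "bounded_length_subspace n X G T i homeomorphic_space
    subtopology T' {c. Poly_Mapping.keys c \<subseteq> topspace X \<and> frag_length c \<le> n}"
proof -
  let ?F = "free_Abelian_group (topspace X)"
  have G: "comm_group G" and tT: "topspace T = carrier G"
    and gen: "generate G (i ` topspace X) = carrier G" and iG: "i ` topspace X \<subseteq> carrier G"
    using free by (auto simp: free_abelian_topological_group_def abelian_topological_group_def continuous_map_def)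
  have tT': "topspace T' = carrier ?F" and gen': "generate ?F (frag_of ` topspace X) = carrier ?F"
    using free' by (auto simp: free_abelian_topological_group_def abelian_topological_group_def)
  interpret G: comm_group G by (rule G)
  have aG: "abelian_topological_group G T" "continuous_map X T i"
    and aF: "abelian_topological_group ?F T'" "continuous_map X T' frag_of"
    using free free' by (simp_all add: free_abelian_topological_group_def)
  obtain h where h: "h \<in> hom G ?F" "continuous_map T T' h" "\<And>x. x \<in> topspace X \<Longrightarrow> h (i x) = frag_of x"
    using free_universal[OF free aF] by metis
  obtain k where k: "k \<in> hom ?F G" "continuous_map T' T k" "\<And>x. x \<in> topspace X \<Longrightarrow> k (frag_of x) = i x"
    using free_universal[OF free' aG] by metis
  have kh: "k (h g) = g" if "g \<in> carrier G" for g
  proof -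
    have "(k \<circ> h) g = id g"
    proof (rule generate_hom_eq[of G G "k \<circ> h" id "i ` topspace X"])
      show "k \<circ> h \<in> hom G G" using h(1) k(1) by (rule hom_compose)
      show "id \<in> hom G G" by (simp add: hom_def)
      show "g \<in> generate G (i ` topspace X)" using that gen by simp
      show "(k \<circ> h) x = id x" if "x \<in> i ` topspace X" for x
        using that h(3) k(3) by force
    qed (use iG in auto)
    then show ?thesis by simp
  qed
  have hk: "h (k c) = c" if "c \<in> carrier ?F" for c
  proof -
    have "(h \<circ> k) c = id c"
    proof (rule generate_hom_eq[of ?F ?F "h \<circ> k" id "frag_of ` topspace X"])
      show "h \<circ> k \<in> hom ?F ?F" using k(1) h(1) by (rule hom_compose)
      show "id \<in> hom ?F ?F" by (simp add: hom_def)
      show "c \<in> generate ?F (frag_of ` topspace X)" using that gen' by simp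
      show "(h \<circ> k) x = id x" if "x \<in> frag_of ` topspace X" for x
        using that h(3) k(3) by force
    qed auto
    then show ?thesis by simp
  qed
  have len: "reduced_length X G i g = frag_length (h g)" if g: "g \<in> carrier G" for g
  proof -
    obtain S r where Sr: "reduced_form X G i S r g" using reduced_form_exists[OF free g] by blast
    have S: "finite S" "S \<subseteq> topspace X" "\<forall>x\<in>S. r x \<noteq> 0" "g = finprod G (\<lambda>x. i x [^]\<^bsub>G\<^esub> r x) S"
      using Sr by (auto simp: reduced_form_def)
    have hg: "h g = (\<Sum>x\<in>S. frag_cmul (r x) (frag_of x))"
      unfolding S(4) by (rule hom_finprod_frag[OF G h(1) S(1) _ _ S(2)]) (use S(2) iG h(3) in auto)
    have lookup: "Poly_Mapping.lookup (h g) x = (if x \<in> S then r x else 0)" for x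
    proof -
      have "Poly_Mapping.lookup (h g) x = (\<Sum>y\<in>S. if y = x then r y else 0)"
        unfolding hg by (simp add: lookup_sum) (intro sum.cong, auto)
      then show ?thesis using S(1) by simp
    qed
    have "Poly_Mapping.keys (h g) \<subseteq> S"
      using lookup by (metis not_in_keys_iff_lookup_eq_zero subsetI)
    then have "frag_length (h g) = (\<Sum>x\<in>S. nat \<bar>Poly_Mapping.lookup (h g) x\<bar>)"
      by (rule frag_length_superset[OF S(1)])
    also have "\<dots> = (\<Sum>x\<in>S. nat \<bar>r x\<bar>)" by (intro sum.cong) (auto simp: lookup)
    finally show ?thesis using reduced_length_eq[OF free Sr] by simp
  qed
  have hC: "h g \<in> carrier ?F" if "g \<in> carrier G" for g using h(1) that by (rule hom_in_carrier)
  have kC: "k c \<in> carrier G" if "c \<in> carrier ?F" for c using k(1) that by (rule hom_in_carrier)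
  have "homeomorphic_maps (subtopology T {g \<in> carrier G. reduced_length X G i g \<le> n})
      (subtopology T' {c \<in> carrier ?F. frag_length c \<le> n}) h k"
    unfolding homeomorphic_maps_def
  proof (intro conjI ballI)
    show "continuous_map (subtopology T {g \<in> carrier G. reduced_length X G i g \<le> n})
        (subtopology T' {c \<in> carrier ?F. frag_length c \<le> n}) h"
      using h(2) hC len by (intro continuous_map_into_subtopology continuous_map_from_subtopology) auto
    show "continuous_map (subtopology T' {c \<in> carrier ?F. frag_length c \<le> n})
        (subtopology T {g \<in> carrier G. reduced_length X G i g \<le> n}) k"
      using k(2) kC len hk by (intro continuous_map_into_subtopology continuous_map_from_subtopology) auto
  qed (use kh hk tT tT' in auto)
  then show ?thesis
    unfolding bounded_length_subspace_def homeomorphic_space_def by auto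
qed

theorem theorem4p12:
  fixes X :: "'a topology" and G :: "('g, 'm) monoid_scheme"
    and T :: "'g topology" and i :: "'a \<Rightarrow> 'g"
  assumes "metrizable_space X" and "topspace X \<noteq> {}"
    and "free_abelian_topological_group X G T i"
  shows "(k_space (bounded_length_subspace 3 X G T i) \<longleftrightarrow>
            k_R_space (bounded_length_subspace 3 X G T i)) \<and>
         (k_R_space (bounded_length_subspace 3 X G T i) \<longleftrightarrow>
            locally_compact_space X \<or> compactin X (non_isolated_points X))"
proof -
  obtain M d where "Metric_space M d" and X: "X = Metric_space.mtopology M d"
    using assms(1) unfolding metrizable_space_def by blast
  then interpret Metric_space M d by simp
  have M: "topspace X = M" using X by simp
  obtain T' where T': "free_abelian_topological_group X (free_Abelian_group (topspace X)) T' frag_of"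
    using free_abelian_topological_group_exists by blast
  interpret free_metric M d T'
    by unfold_locales (use T' X M in simp)
  have hom: "bounded_length_subspace 3 X G T i homeomorphic_space A3"
    using bounded_length_subspace_homeomorphic[OF assms(3) T'] M by simp
  show ?thesis
    using k_space_and_k_R_space_A3 not_k_space_and_not_k_R_space_A3 homeomorphic_k_space[OF hom] homeomorphic_k_R_space[OF hom]
    unfolding X by blast
qed

end
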